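(* Let $(\Omega,\mathcal{F},\mathbb{P})$ be a probability space, $\Theta:\Omega\to\Omega$ a measurable $\mathbb{P}$-preserving transformation, $\gamma:\Omega\to\Omega_0$ measurable, and consider the random environment $\omega^x_n=\gamma(\Theta^x(\omega))_n$, $x,n\in\mathbb{Z}_+$, with associated walk $(X_n)$ under $P_\omega$. Let $\bar\beta:\Omega\to(1,\infty)$ be measurable with $\bar\beta_*:=\operatorname{ess\,inf}_{\omega\in\Omega}\bar\beta(\omega)>2$. Assume that the following conditions hold for some $q>\max\{8,\frac{2}{\bar\beta_*-2}\}$: (C1) $\mathbb{E}[\bar B^q]<\infty$, where $\bar B=\bar A$ if $\bar\beta_*>3$ and $\bar B=\bar A'$ if $\bar\beta_*\in(2,3]$; (C2) the $\alpha$-mixing coefficients satisfy $\alpha(n)=O(n^{-v})$ for some $v>\frac{2q}{q-8}$; (C3) the random variable $$\bar K(\omega)=\sup_{n\ge2}\frac{\gamma(\omega)_n-\gamma(\omega)_{n+1}}{\gamma(\omega)_1-\gamma(\omega)_2}+\frac{\gamma(\omega)_1-\gamma(\omega)_2}{1-\gamma(\omega)_1}$$ satisfies $\mathbb{E}[\bar K^{1+\delta}]<\infty$ for some $\delta>0$. Let $\mu=\mathbb{E}[m_0]$, $\sigma^2=\mathbb{E}[s_0^2]$, $\tilde\sigma^2=\sigma^2/\mu^3$, and for $\ell\ge1$ let $h_\ell$ be the density of the normal distribution $N(M_\ell,\ell\tilde\sigma^2)$ (depending on $\omega$ through $M_\ell$). Then, for $\mathbb{P}$-a.e. $\omega\in\Omega$,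 as $n\to\infty$, $$P_\omega(X_n=x)=\mu^{-1}\sum_{\ell=1}^nh_\ell(x)\,\omega^x_{n-\ell}+o(n^{-1/2}),$$ where the error term is uniform in $x\in\mathbb{Z}_+$.
   Context: $\mathbb{Z}_+=\{0,1,2,\dots\}$. $\Omega_0$ is the set of real sequences $(\omega_n)_{n\ge0}\in(0,1]^{\mathbb{Z}_+}$ with $\omega_0=1$, $\omega_n>\omega_{n+1}$ for all $n$, and $\omega_n\to0$; it carries its Borel $\sigma$-algebra. $\mathbb{E}$ is expectation with respect to $\mathbb{P}$. For each fixed $\omega\in\Omega$, with $\omega^x_n=\gamma(\Theta^x(\omega))_n$, let $Z_n=(X_n,Y_n)$, $n\ge0$, be the Markov chain on $\mathbb{Z}_+\times\mathbb{Z}_+$ with initial distribution $P_\omega(Z_0=(0,y))=\omega^0_y-\omega^0_{y+1}$, $y\in\mathbb{Z}_+$, and transitions: from $(x',y')$ with $y'>0$ the chain moves to $(x',y'-1)$ with probability $1$; from $(x',0)$ it moves to $(x'+1,y)$ with probability $\omega^{x'+1}_y-\omega^{x'+1}_{y+1}$, $y\in\mathbb{Z}_+$. $P_\omega$ denotes the law of this chain; the walk is the first coordinate $(X_n)$. Notation: $\bar A(\omega)=\sup_{n\ge1}n^{\bar\beta(\omega)}\gamma(\omega)_n$; $\bar A'(\omega)=\sup_{n\ge1}n^{\bar\beta(\omega)+1}(\gamma(\omega)_{n-1}-\gamma(\omega)_n)$; $m_x=\sum_{n=0}^\infty\omega^x_n$; $\mu_x=\sum_{w=0}^{x-1}m_w$;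 $s_x^2=\sum_{n=0}^\infty(2n+1)\omega^x_n-\bigl[\sum_{n=0}^\infty\omega^x_n\bigr]^2$; $M_n=\inf\{x\in\mathbb{Z}_+:\mu_x\ge n\}$. The $\alpha$-mixing coefficients are $$\alpha(k)=\sup\{|\mathbb{P}(A\cap B)-\mathbb{P}(A)\mathbb{P}(B)|: A\in\mathcal{F}_0^\ell,\ B\in\mathcal{F}_{\ell+k}^\infty,\ \ell\ge0\},$$ where $\mathcal{F}_0^\ell=\sigma(\gamma\circ\Theta^j:0\le j\le\ell)$ and $\mathcal{F}_{\ell+k}^\infty=\sigma(\gamma\circ\Theta^j:j\ge\ell+k)$. *)

theory Defs
  imports "HOL-Probability.Probability" "HOL-Library.Landau_Symbols"
begin

section \<open>Random environment\<close>

definition Omega0 :: "(nat \<Rightarrow> real) set" where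
  "Omega0 = {w. (\<forall>n. 0 < w n \<and> w n \<le> 1) \<and> w 0 = 1 \<and> (\<forall>n. w (Suc n) < w n) \<and> w \<longlonglongrightarrow> 0}"

text \<open>The type \<^typ>\<open>nat \<Rightarrow> real\<close> carries the product topology, so this is the Borel
  sigma-algebra of the subspace \<^const>\<open>Omega0\<close>.\<close>

abbreviation Omega0_borel :: "(nat \<Rightarrow> real) measure" where
  "Omega0_borel \<equiv> restrict_space borel Omega0"

text \<open>\<open>env \<Theta> \<gamma> \<omega> x n\<close> is $\omega^x_n = \gamma(\Theta^x(\omega))_n$.\<close>

definition env :: "('a \<Rightarrow> 'a) \<Rightarrow> ('a \<Rightarrow> nat \<Rightarrow> real) \<Rightarrow> 'a \<Rightarrow> nat \<Rightarrow> nat \<Rightarrow> real" where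
  "env \<Theta> \<gamma> \<omega> x n = \<gamma> ((\<Theta> ^^ x) \<omega>) n"

definition measure_preserving_map :: "'a measure \<Rightarrow> ('a \<Rightarrow> 'a) \<Rightarrow> bool" where
  "measure_preserving_map M \<Theta> \<longleftrightarrow>
     \<Theta> \<in> M \<rightarrow>\<^sub>M M \<and> (\<forall>A\<in>sets M. measure M (\<Theta> -` A \<inter> space M) = measure M A)"

section \<open>The walk in a fixed environment\<close>

definition walk_init :: "(nat \<Rightarrow> nat \<Rightarrow> real) \<Rightarrow> nat \<times> nat \<Rightarrow> real" where
  "walk_init w = (\<lambda>(x, y). if x = 0 then w 0 y - w 0 (y + 1) else 0)"

definition walk_trans :: "(nat \<Rightarrow> nat \<Rightarrow> real) \<Rightarrow> nat \<times> nat \<Rightarrow> nat \<times> nat \<Rightarrow> real" where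
  "walk_trans w = (\<lambda>(x', y') (x, y).
     if y' > 0 then (if x = x' \<and> y = y' - 1 then 1 else 0)
     else (if x = x' + 1 then w (x' + 1) y - w (x' + 1) (y + 1) else 0))"

text \<open>\<open>Z\<close> is a Markov chain on the probability space \<open>N\<close> with initial distribution \<open>p0\<close> and
  transition probabilities \<open>p\<close>. The conditional probabilities are prescribed only for
  histories of positive probability.\<close>

definition markov_chain ::
    "'b measure \<Rightarrow> (nat \<Rightarrow> 'b \<Rightarrow> 's::countable) \<Rightarrow> ('s \<Rightarrow> real) \<Rightarrow> ('s \<Rightarrow> 's \<Rightarrow> real) \<Rightarrow> bool" where
  "markov_chain N Z p0 p \<longleftrightarrow>
     prob_space N \<and>
     (\<forall>n. Z n \<in> N \<rightarrow>\<^sub>M count_space UNIV) \<and>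
     (\<forall>z. \<P>(\<xi> in N. Z 0 \<xi> = z) = p0 z) \<and>
     (\<forall>n z. \<P>(\<xi> in N. \<forall>i\<le>n. Z i \<xi> = z i) > 0 \<longrightarrow>
        (\<forall>z'. \<P>(\<xi> in N. Z (Suc n) \<xi> = z' \<bar> \<forall>i\<le>n. Z i \<xi> = z i) = p (z n) z'))"

section \<open>Functionals of the environment\<close>

definition ess_inf :: "'a measure \<Rightarrow> ('a \<Rightarrow> real) \<Rightarrow> ereal" where
  "ess_inf M f = - esssup M (\<lambda>\<omega>. - ereal (f \<omega>))"

text \<open>The suprema below may be infinite, hence are taken in \<^typ>\<open>ennreal\<close>;
  \<open>ennreal_powr\<close> is the power with a positive real exponent.\<close>

definition ennreal_powr :: "ennreal \<Rightarrow> real \<Rightarrow> ennreal" where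
  "ennreal_powr a p = (if a = \<top> then \<top> else ennreal (enn2real a powr p))"

definition Abar :: "('a \<Rightarrow> real) \<Rightarrow> ('a \<Rightarrow> nat \<Rightarrow> real) \<Rightarrow> 'a \<Rightarrow> ennreal" where
  "Abar \<beta> \<gamma> \<omega> = (SUP n\<in>{1..}. ennreal (real n powr \<beta> \<omega> * \<gamma> \<omega> n))"

definition Abar' :: "('a \<Rightarrow> real) \<Rightarrow> ('a \<Rightarrow> nat \<Rightarrow> real) \<Rightarrow> 'a \<Rightarrow> ennreal" where
  "Abar' \<beta> \<gamma> \<omega> =
     (SUP n\<in>{1..}. ennreal (real n powr (\<beta> \<omega> + 1) * (\<gamma> \<omega> (n - 1) - \<gamma> \<omega> n)))"

definition Kbar :: "('a \<Rightarrow> nat \<Rightarrow> real) \<Rightarrow> 'a \<Rightarrow> ennreal" where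
  "Kbar \<gamma> \<omega> =
     (SUP n\<in>{2..}. ennreal ((\<gamma> \<omega> n - \<gamma> \<omega> (n + 1)) / (\<gamma> \<omega> 1 - \<gamma> \<omega> 2)))
     + ennreal ((\<gamma> \<omega> 1 - \<gamma> \<omega> 2) / (1 - \<gamma> \<omega> 1))"

definition m_env :: "(nat \<Rightarrow> nat \<Rightarrow> real) \<Rightarrow> nat \<Rightarrow> real" where
  "m_env w x = (\<Sum>n. w x n)"

definition mu_env :: "(nat \<Rightarrow> nat \<Rightarrow> real) \<Rightarrow> nat \<Rightarrow> real" where
  "mu_env w x = (\<Sum>u<x. m_env w u)"

definition s2_env :: "(nat \<Rightarrow> nat \<Rightarrow> real) \<Rightarrow> nat \<Rightarrow> real" where
  "s2_env w x = (\<Sum>n. (2 * real n + 1) * w x n) - (\<Sum>n. w x n)\<^sup>2"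

definition M_env :: "(nat \<Rightarrow> nat \<Rightarrow> real) \<Rightarrow> nat \<Rightarrow> nat" where
  "M_env w n = Inf {x. mu_env w x \<ge> real n}"

section \<open>Mixing coefficients\<close>

definition env_events ::
    "'a measure \<Rightarrow> ('a \<Rightarrow> 'a) \<Rightarrow> ('a \<Rightarrow> nat \<Rightarrow> real) \<Rightarrow> nat set \<Rightarrow> 'a set set" where
  "env_events M \<Theta> \<gamma> J = sigma_sets (space M)
     (\<Union>j\<in>J. {(\<gamma> \<circ> (\<Theta> ^^ j)) -` S \<inter> space M | S. S \<in> sets Omega0_borel})"

definition alpha_mixing ::
    "'a measure \<Rightarrow> ('a \<Rightarrow> 'a) \<Rightarrow> ('a \<Rightarrow> nat \<Rightarrow> real) \<Rightarrow> nat \<Rightarrow> real" where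
  "alpha_mixing M \<Theta> \<gamma> k = Sup {\<bar>measure M (A \<inter> B) - measure M A * measure M B\<bar> | A B l.
     A \<in> env_events M \<Theta> \<gamma> {..l} \<and> B \<in> env_events M \<Theta> \<gamma> {l + k..}}"

end

theory Submission
  imports Defs "HOL-Real_Asymp.Real_Asymp"
begin

text \<open>The walk is at \<open>x\<close> at time \<open>n\<close> iff it arrived there at some time \<open>l \<le> n\<close> and then stayed longer
  than \<open>n - l\<close>, and the arrival time at \<open>x\<close> is a sum of \<open>x\<close> independent holding times. Fourier inversion
  gives a local limit theorem for this sum with error \<open>x powr (- 1 / 2 - \<delta> / 2)\<close>, where \<open>\<delta> / 2 > 1 / q\<close>;
  its Gaussian has mean equal to the sum of the first \<open>x\<close> holding means. Replacing \<open>mean - l\<close> by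
  \<open>\<mu> * (M_env w l - x)\<close> costs the fluctuation of the holding means over a window of length about
  \<open>n powr (1 / 2 + \<epsilon>)\<close>. Almost surely all these fluctuations are below
  \<open>n powr (1 / 2 - 1 / q - 3 * \<epsilon>)\<close>, by fourth moments under mixing, dyadic chaining and Borel-Cantelli.
  Summation over \<open>l\<close> loses one factor \<open>m\<^sub>x\<close>, which is at most \<open>n powr (1 / q + 2 * \<epsilon>)\<close>, so the
  total error is still \<open>o(n powr (- 1 / 2))\<close>.\<close>

section \<open>Covariances and fourth moments under mixing\<close>

text \<open>The exponents in the hypotheses come from one count. On time scale \<open>N\<close>,
  moments of order \<open>q\<close> force truncation of the holding functionals at \<open>K\<close>,
  about \<open>N powr (1 / q)\<close>. For blocks of length up to \<open>n\<close>, about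
  \<open>N powr (1 / 2)\<close>, clustered indices contribute
  \<open>K ^ 4 * n powr (1 + \<rho>)\<close> to the fourth moment; the union bound over blocks at
  threshold \<open>N powr (1 / 2 - 1 / q)\<close> then has exponent
  \<open>8 / q + \<rho> / 2 - 1\<close>, up to multiples of \<open>\<epsilon>\<close>. Hence
  \<open>q > 8\<close>, with room \<open>1 - 8 / q\<close>. The condition on \<open>v\<close> says
  that covariances remain summable when raised to half that room as a power. The order
  \<open>2 + \<delta>\<close> of the moments must exceed \<open>2 + 2 / q\<close>, so that the local
  limit error beats the loss in the summation, and stay below the essential infimum of
  \<open>\<beta>\<close>; \<open>q > 2 / (\<beta>s - 2)\<close> leaves such a
  \<open>\<delta>\<close>. The obstacle to a local theorem with unequal lattice summands is the
  decay of characteristic functions away from 0. It comes from the adjacent masses at 1 and 2: their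
  product is a bounded functional of the environment with positive mean, so its sums grow linearly
  along almost every environment.\<close>

lemma (in prob_space) covariance_le_sign:
  fixes X Y :: "'a \<Rightarrow> real"
  assumes F: "subalgebra M F" and X: "X \<in> borel_measurable F" and Y: "Y \<in> borel_measurable M"
    and bX: "\<And>\<omega>. \<omega> \<in> space M \<Longrightarrow> \<bar>X \<omega>\<bar> \<le> K1" and bY: "\<And>\<omega>. \<omega> \<in> space M \<Longrightarrow> \<bar>Y \<omega>\<bar> \<le> K2"
  obtains A where "A \<in> sets F"
    "\<bar>expectation (\<lambda>\<omega>. X \<omega> * Y \<omega>) - expectation X * expectation Y\<bar>
      \<le> K1 * \<bar>expectation (\<lambda>\<omega>. (2 * indicator A \<omega> - 1) * Y \<omega>) - expectation (\<lambda>\<omega>. 2 * indicator A \<omega> - 1) * expectation Y\<bar>"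
proof -
  interpret S: finite_measure_subalgebra M F
    by (simp add: F finite_measure_axioms finite_measure_subalgebra.intro finite_measure_subalgebra_axioms.intro)
  note [measurable] = Y
  have XM[measurable]: "X \<in> borel_measurable M" by (rule measurable_from_subalg[OF F X])
  have bdd: "integrable M f" if "f \<in> borel_measurable M" "\<And>\<omega>. \<omega> \<in> space M \<Longrightarrow> \<bar>f \<omega>\<bar> \<le> K" for f :: "'a \<Rightarrow> real" and K
    by (rule integrable_const_bound[where B=K]) (use that in \<open>auto intro!: AE_I2\<close>)
  have K1: "0 \<le> K1" using bX not_empty by (metis abs_ge_zero equals0I order_trans)
  have K2: "0 \<le> K2" using bY not_empty by (metis abs_ge_zero equals0I order_trans)
  define c where "c = expectation Y"
  define W where "W = real_cond_exp M F (\<lambda>\<omega>. Y \<omega> - c)"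
  have iY: "integrable M Y" by (rule bdd[OF Y bY])
  have WF[measurable]: "W \<in> borel_measurable F" unfolding W_def by simp
  have WM[measurable]: "W \<in> borel_measurable M" by (rule measurable_from_subalg[OF F WF])
  have key: "expectation (\<lambda>\<omega>. f \<omega> * Y \<omega>) - expectation f * c = expectation (\<lambda>\<omega>. f \<omega> * W \<omega>)"
    "integrable M (\<lambda>\<omega>. f \<omega> * W \<omega>)"
    if f: "f \<in> borel_measurable F" "\<And>\<omega>. \<omega> \<in> space M \<Longrightarrow> \<bar>f \<omega>\<bar> \<le> K" for f K
  proof -
    have fM[measurable]: "f \<in> borel_measurable M" by (rule measurable_from_subalg[OF F f(1)])
    have K: "0 \<le> K" using f(2) not_empty by (metis abs_ge_zero equals0I order_trans)
    have "integrable M f" using bdd[OF fM f(2)] .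
    have ifY: "integrable M (\<lambda>\<omega>. f \<omega> * Y \<omega>)"
      by (rule bdd[of _ "K*K2"]) (auto simp: abs_mult intro!: mult_mono f(2) bY K)
    have i: "integrable M (\<lambda>\<omega>. f \<omega> * (Y \<omega> - c))"
      using ifY \<open>integrable M f\<close> by (simp add: right_diff_distrib)
    have "expectation (\<lambda>\<omega>. f \<omega> * W \<omega>) = expectation (\<lambda>\<omega>. f \<omega> * (Y \<omega> - c))"
      unfolding W_def by (rule S.real_cond_exp_intg(2)[OF i f(1)]) simp
    also have "\<dots> = expectation (\<lambda>\<omega>. f \<omega> * Y \<omega>) - expectation f * c"
      using ifY \<open>integrable M f\<close> by (simp add: right_diff_distrib)
    finally show "expectation (\<lambda>\<omega>. f \<omega> * Y \<omega>) - expectation f * c = expectation (\<lambda>\<omega>. f \<omega> * W \<omega>)" by simp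
    show "integrable M (\<lambda>\<omega>. f \<omega> * W \<omega>)"
      unfolding W_def by (rule S.real_cond_exp_intg(1)[OF i f(1)]) simp
  qed
  \<comment> \<open>For fixed \<open>Y\<close>, the covariance is linear in \<open>X\<close> and is
    maximised, among \<open>F\<close>-measurable functions bounded by \<open>K1\<close>, by
    \<open>K1\<close> times the sign of the conditional expectation \<open>W\<close> of the centred
    \<open>Y\<close>.\<close>
  define A where "A = {\<omega> \<in> space F. 0 \<le> W \<omega>}"
  have sp: "space F = space M" using F by (simp add: subalgebra_def)
  have A: "A \<in> sets F" unfolding A_def by measurable
  let ?s = "\<lambda>\<omega>. 2 * indicator A \<omega> - 1 :: real"
  have sF: "?s \<in> borel_measurable F" using A by measurable
  have sb: "\<bar>?s \<omega>\<bar> \<le> 1" for \<omega> by (simp add: indicator_def)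
  have "\<bar>expectation (\<lambda>\<omega>. X \<omega> * Y \<omega>) - expectation X * c\<bar> = \<bar>expectation (\<lambda>\<omega>. X \<omega> * W \<omega>)\<bar>"
    using key(1)[OF X bX] by simp
  also have "\<dots> \<le> expectation (\<lambda>\<omega>. \<bar>X \<omega> * W \<omega>\<bar>)" by (rule integral_abs_bound)
  also have "\<dots> \<le> expectation (\<lambda>\<omega>. K1 * (?s \<omega> * W \<omega>))"
  proof (rule integral_mono)
    show "integrable M (\<lambda>\<omega>. \<bar>X \<omega> * W \<omega>\<bar>)" using key(2)[OF X bX] by (rule integrable_abs)
    show "integrable M (\<lambda>\<omega>. K1 * (?s \<omega> * W \<omega>))" using key(2)[OF sF sb] by simp
    fix \<omega> assume "\<omega> \<in> space M"
    then have "?s \<omega> * W \<omega> = \<bar>W \<omega>\<bar>" by (auto simp: A_def indicator_def sp)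
    then show "\<bar>X \<omega> * W \<omega>\<bar> \<le> K1 * (?s \<omega> * W \<omega>)"
      using bX[OF \<open>\<omega> \<in> space M\<close>] by (simp only: abs_mult) (intro mult_right_mono, auto)
  qed
  also have "\<dots> = K1 * expectation (\<lambda>\<omega>. ?s \<omega> * W \<omega>)" by simp
  also have "\<dots> = K1 * (expectation (\<lambda>\<omega>. ?s \<omega> * Y \<omega>) - expectation ?s * c)"
    using key(1)[OF sF sb] by simp
  also have "\<dots> \<le> K1 * \<bar>expectation (\<lambda>\<omega>. ?s \<omega> * Y \<omega>) - expectation ?s * c\<bar>"
    using K1 by (intro mult_left_mono) auto
  finally show ?thesis using that[OF A] unfolding c_def by simp
qed

text \<open>Both functions are replaced in turn by signs \<open>2 * indicator A - 1\<close>, first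
  with respect to \<open>F\<close>, then with respect to \<open>G\<close>. The covariance of two
  such signs is four times that of the events, hence the factor 4.\<close>

lemma (in prob_space) covariance_le_mixing:
  fixes X Y :: "'a \<Rightarrow> real"
  assumes F: "subalgebra M F" and G: "subalgebra M G"
    and X: "X \<in> borel_measurable F" and Y: "Y \<in> borel_measurable G"
    and bX: "\<And>\<omega>. \<omega> \<in> space M \<Longrightarrow> \<bar>X \<omega>\<bar> \<le> K1" and bY: "\<And>\<omega>. \<omega> \<in> space M \<Longrightarrow> \<bar>Y \<omega>\<bar> \<le> K2"
    and mix: "\<And>A B. A \<in> sets F \<Longrightarrow> B \<in> sets G \<Longrightarrow> \<bar>prob (A \<inter> B) - prob A * prob B\<bar> \<le> a"
  shows "\<bar>expectation (\<lambda>\<omega>. X \<omega> * Y \<omega>) - expectation X * expectation Y\<bar> \<le> 4 * a * K1 * K2"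
proof -
  have K1: "0 \<le> K1" using bX not_empty by (metis abs_ge_zero equals0I order_trans)
  have K2: "0 \<le> K2" using bY not_empty by (metis abs_ge_zero equals0I order_trans)
  have YM: "Y \<in> borel_measurable M" by (rule measurable_from_subalg[OF G Y])
  obtain A where A: "A \<in> sets F" and 1: "\<bar>expectation (\<lambda>\<omega>. X \<omega> * Y \<omega>) - expectation X * expectation Y\<bar>
      \<le> K1 * \<bar>expectation (\<lambda>\<omega>. (2 * indicator A \<omega> - 1) * Y \<omega>) - expectation (\<lambda>\<omega>. 2 * indicator A \<omega> - 1) * expectation Y\<bar>"
    using covariance_le_sign[OF F X YM bX bY] by blast
  have AM[measurable]: "A \<in> sets M" using A F by (auto simp: subalgebra_def)
  let ?s = "\<lambda>A \<omega>. 2 * indicator A \<omega> - 1 :: real"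
  have sM: "?s A \<in> borel_measurable M" by measurable
  have sb: "\<bar>?s A \<omega>\<bar> \<le> 1" for \<omega> by (simp add: indicator_def)
  obtain B where B: "B \<in> sets G" and 2: "\<bar>expectation (\<lambda>\<omega>. Y \<omega> * ?s A \<omega>) - expectation Y * expectation (?s A)\<bar>
      \<le> K2 * \<bar>expectation (\<lambda>\<omega>. ?s B \<omega> * ?s A \<omega>) - expectation (?s B) * expectation (?s A)\<bar>"
    using covariance_le_sign[OF G Y sM bY sb] by blast
  have BM[measurable]: "B \<in> sets M" using B G by (auto simp: subalgebra_def)
  have e: "expectation (?s C) = 2 * prob C - 1" if "C \<in> sets M" for C
    using that by (subst Bochner_Integration.integral_diff) (auto simp: prob_space less_top[symmetric])
  have "expectation (\<lambda>\<omega>. ?s B \<omega> * ?s A \<omega>) = expectation (\<lambda>\<omega>. 4 * indicator (A \<inter> B) \<omega> - 2 * indicator A \<omega> - 2 * indicator B \<omega> + 1)"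
    by (rule Bochner_Integration.integral_cong) (auto simp: indicator_def)
  also have "\<dots> = 4 * prob (A \<inter> B) - 2 * prob A - 2 * prob B + 1"
    using AM BM by (simp add: prob_space less_top[symmetric])
  finally have "expectation (\<lambda>\<omega>. ?s B \<omega> * ?s A \<omega>) - expectation (?s B) * expectation (?s A)
     = 4 * (prob (A \<inter> B) - prob A * prob B)"
    by (simp only: e[OF AM] e[OF BM]) (simp add: algebra_simps)
  then have 3: "\<bar>expectation (\<lambda>\<omega>. ?s B \<omega> * ?s A \<omega>) - expectation (?s B) * expectation (?s A)\<bar> \<le> 4 * a"
    using mix[OF A B] by (simp add: abs_mult)
  have "\<bar>expectation (\<lambda>\<omega>. ?s A \<omega> * Y \<omega>) - expectation (?s A) * expectation Y\<bar> \<le> K2 * (4 * a)"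
    using 2 mult_left_mono[OF 3 K2] by (simp add: mult.commute)
  with 1 mult_left_mono[OF this K1] show ?thesis by (simp add: mult_ac)
qed

text \<open>Adjacent transpositions generate all permutations, so a predicate invariant under them
  need only be checked on sorted indices.\<close>

lemma sorted4_induct:
  fixes P :: "nat \<Rightarrow> nat \<Rightarrow> nat \<Rightarrow> nat \<Rightarrow> bool"
  assumes s1: "\<And>i j k l. P i j k l \<Longrightarrow> P j i k l"
    and s2: "\<And>i j k l. P i j k l \<Longrightarrow> P i k j l"
    and s3: "\<And>i j k l. P i j k l \<Longrightarrow> P i j l k"
    and sorted: "\<And>i j k l. i \<le> j \<Longrightarrow> j \<le> k \<Longrightarrow> k \<le> l \<Longrightarrow> P i j k l"
  shows "P i j k l"
proof -
  have 1: "P i j k l" if "i \<le> j" "j \<le> k" for i j k l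
    using that sorted[of i j k l] s3[OF sorted[of i j l k]] s3[OF s2[OF sorted[of i l j k]]]
      s3[OF s2[OF s1[OF sorted[of l i j k]]]] by linarith
  have 2: "P i j k l" if "i \<le> j" for i j k l
    using that 1[of i j k l] s2[OF 1[of i k j l]] s2[OF s1[OF 1[of k i j l]]] by linarith
  show ?thesis
    using 2[of i j k l] s1[OF 2[of j i k l]] by linarith
qed

text \<open>For \<open>p > 1\<close> this is the value of the Riemann zeta function at
  \<open>p\<close>, indexed from 0 to fit distances that may vanish.\<close>

definition zeta_shift :: "real \<Rightarrow> real" where
  "zeta_shift p = (\<Sum>r. (real r + 1) powr (- p))"

lemma summable_zeta_shift: "1 < p \<Longrightarrow> summable (\<lambda>r. (real r + 1) powr (- p))"
  using summable_real_powr_iff[of "- p"] summable_Suc_iff[of "\<lambda>n. real n powr (- p)"]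
  by (simp add: add.commute)

definition nat_dist :: "nat \<Rightarrow> nat \<Rightarrow> nat" where
  "nat_dist i j = (i - j) + (j - i)"

text \<open>Each distance from \<open>i\<close> occurs at most once on either side of
  \<open>i\<close>.\<close>

lemma sum_nat_dist_le:
  assumes "1 < p" "finite I"
  shows "(\<Sum>j\<in>I. (real (nat_dist i j) + 1) powr (- p)) \<le> 2 * zeta_shift p"
proof -
  let ?f = "\<lambda>r. (real r + 1) powr (- p)"
  have *: "(\<Sum>j\<in>J. ?f (nat_dist i j)) \<le> zeta_shift p" if "inj_on (nat_dist i) J" "J \<subseteq> I" for J
  proof -
    have "(\<Sum>j\<in>J. ?f (nat_dist i j)) = sum ?f (nat_dist i ` J)"
      by (simp add: sum.reindex[OF that(1)])
    also have "\<dots> \<le> zeta_shift p" unfolding zeta_shift_def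
      by (rule sum_le_suminf[OF summable_zeta_shift[OF assms(1)]])
        (use that assms in \<open>auto intro: finite_subset\<close>)
    finally show ?thesis .
  qed
  have "I = {j\<in>I. j \<le> i} \<union> {j\<in>I. i < j}" by auto
  then have "(\<Sum>j\<in>I. ?f (nat_dist i j)) = (\<Sum>j\<in>{j\<in>I. j \<le> i}. ?f (nat_dist i j)) + (\<Sum>j\<in>{j\<in>I. i < j}. ?f (nat_dist i j))"
    using assms by (subst sum.union_disjoint[symmetric]) auto
  also have "\<dots> \<le> zeta_shift p + zeta_shift p"
    by (intro add_mono *) (auto simp: inj_on_def nat_dist_def)
  finally show ?thesis by simp
qed

text \<open>\<open>Fp l\<close> is the past up to \<open>l\<close> and \<open>Ff l\<close> the
  future from \<open>l\<close>. The rate is written in \<open>k + 1\<close> so that it also covers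
  \<open>k = 0\<close>.\<close>

locale mixing_filtration = prob_space +
  fixes Fp Ff :: "nat \<Rightarrow> 'a measure" and Ca v :: real
  assumes sub_Fp: "\<And>l. subalgebra M (Fp l)" and sub_Ff: "\<And>l. subalgebra M (Ff l)"
    and mix: "\<And>A B l k. A \<in> sets (Fp l) \<Longrightarrow> B \<in> sets (Ff (l + k)) \<Longrightarrow>
      \<bar>prob (A \<inter> B) - prob A * prob B\<bar> \<le> Ca * (real k + 1) powr (- v)"
    and Ca: "1 \<le> Ca" and v: "0 < v"

text \<open>The sup bound \<open>K\<close> will be a truncation level that grows with the time
  scale, whereas \<open>C0\<close> stays fixed. Keeping them apart makes the power of
  \<open>K\<close> in the fourth moment visible.\<close>

locale mixing_sequence = mixing_filtration +
  fixes X :: "nat \<Rightarrow> 'a \<Rightarrow> real" and K C0 :: real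
  assumes X_Fp: "\<And>i l. i \<le> l \<Longrightarrow> X i \<in> borel_measurable (Fp l)"
    and X_Ff: "\<And>i l. l \<le> i \<Longrightarrow> X i \<in> borel_measurable (Ff l)"
    and X_bound: "\<And>i \<omega>. \<omega> \<in> space M \<Longrightarrow> \<bar>X i \<omega>\<bar> \<le> K"
    and X_mean: "\<And>i. expectation (X i) = 0"
    and X_second: "\<And>i. expectation (\<lambda>\<omega>. (X i \<omega>)\<^sup>2) \<le> C0"
    and K_pos: "0 < K" and C0: "1 \<le> C0"
begin

lemma X_meas[measurable]: "X i \<in> borel_measurable M"
  by (rule measurable_from_subalg[OF sub_Fp X_Fp[of i i]]) simp

lemma cov_split:
  assumes "f \<in> borel_measurable (Fp i)" "g \<in> borel_measurable (Ff j)" "i \<le> j"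
    "\<And>\<omega>. \<omega> \<in> space M \<Longrightarrow> \<bar>f \<omega>\<bar> \<le> K1" "\<And>\<omega>. \<omega> \<in> space M \<Longrightarrow> \<bar>g \<omega>\<bar> \<le> K2"
  shows "\<bar>expectation (\<lambda>\<omega>. f \<omega> * g \<omega>) - expectation f * expectation g\<bar>
    \<le> 4 * (Ca * (real (j - i) + 1) powr (- v)) * K1 * K2"
  by (rule covariance_le_mixing[OF sub_Fp sub_Ff assms(1,2,4,5)])
    (use mix[of _ i _ "j - i"] assms(3) in auto)

lemma X_prod_bound:
  assumes "\<omega> \<in> space M"
  shows "\<bar>X i \<omega> * X j \<omega>\<bar> \<le> K\<^sup>2" "\<bar>X i \<omega> * X j \<omega> * X k \<omega>\<bar> \<le> K ^ 3"
    "\<bar>X i \<omega> * X j \<omega> * X k \<omega> * X l \<omega>\<bar> \<le> K ^ 4"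
proof -
  show 2: "\<bar>X i \<omega> * X j \<omega>\<bar> \<le> K\<^sup>2"
    unfolding abs_mult power2_eq_square using X_bound[OF assms] K_pos by (intro mult_mono) auto
  then show 3: "\<bar>X i \<omega> * X j \<omega> * X k \<omega>\<bar> \<le> K ^ 3"
    unfolding abs_mult[of "_ * _"] power3_eq_cube power2_eq_square using X_bound[OF assms] K_pos
    by (intro mult_mono) auto
  show "\<bar>X i \<omega> * X j \<omega> * X k \<omega> * X l \<omega>\<bar> \<le> K ^ 4"
    unfolding abs_mult[of "_ * _ * _"] using X_bound[OF assms, of l] K_pos mult_mono[OF 3 X_bound[OF assms, of l]]
    by (simp add: power4_eq_xxxx power3_eq_cube)
qed

lemma integrable_X4: "integrable M (\<lambda>\<omega>. X i \<omega> * X j \<omega> * X k \<omega> * X l \<omega>)"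
  by (rule integrable_const_bound[where B="K^4"]) (auto intro!: AE_I2 X_prod_bound)

lemma integrable_X2: "integrable M (\<lambda>\<omega>. X i \<omega> * X j \<omega>)"
  by (rule integrable_const_bound[where B="K^2"]) (auto intro!: AE_I2 X_prod_bound)

text \<open>A covariance is bounded both by \<open>C0\<close> and by a multiple of \<open>K\<^sup>2 * (r + 1) powr (- v)\<close>; the
  geometric mean with weight \<open>\<theta>\<close> keeps a summable decay at the price of only \<open>K powr (2 * \<theta>)\<close>.\<close>

definition pair_bound :: "real \<Rightarrow> nat \<Rightarrow> real" where
  "pair_bound \<theta> r = 4 * C0 * Ca * K powr (2 * \<theta>) * (real r + 1) powr (- (v * \<theta>))"

lemma pair_bound_nonneg: "0 \<le> pair_bound \<theta> r"
  unfolding pair_bound_def using C0 Ca by simp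

lemma covariance_le_pair_bound:
  assumes "i \<le> j" "0 \<le> \<theta>" "\<theta> \<le> 1"
  shows "\<bar>expectation (\<lambda>\<omega>. X i \<omega> * X j \<omega>)\<bar> \<le> pair_bound \<theta> (j - i)"
proof -
  let ?m = "\<bar>expectation (\<lambda>\<omega>. X i \<omega> * X j \<omega>)\<bar>"
  let ?B = "4 * (Ca * (real (j - i) + 1) powr (- v)) * K * K"
  have 1: "?m \<le> ?B"
    using cov_split[OF X_Fp[of i i] X_Ff[of j j] assms(1) X_bound X_bound] X_mean by simp
  have "?m \<le> expectation (\<lambda>\<omega>. \<bar>X i \<omega> * X j \<omega>\<bar>)" by (rule integral_abs_bound)
  also have "\<dots> \<le> expectation (\<lambda>\<omega>. (X i \<omega> * X i \<omega> + X j \<omega> * X j \<omega>) / 2)"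
  proof (rule integral_mono)
    fix \<omega> show "\<bar>X i \<omega> * X j \<omega>\<bar> \<le> (X i \<omega> * X i \<omega> + X j \<omega> * X j \<omega>) / 2"
      using sum_squares_bound[of "X i \<omega>" "X j \<omega>"] sum_squares_bound[of "X i \<omega>" "- X j \<omega>"]
      by (auto simp: abs_if power2_eq_square)
  qed (use integrable_X2 in auto)
  also have "\<dots> = (expectation (\<lambda>\<omega>. (X i \<omega>)\<^sup>2) + expectation (\<lambda>\<omega>. (X j \<omega>)\<^sup>2)) / 2"
    using integrable_X2 by (simp add: power2_eq_square)
  also have "\<dots> \<le> C0" using X_second[of i] X_second[of j] by simp
  finally have 2: "?m \<le> C0" .
  have B0: "0 \<le> ?B" using Ca K_pos by simp
  show ?thesis
  proof (cases "?m = 0")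
    case True then show ?thesis using pair_bound_nonneg by simp
  next
    case False
    then have "?m = ?m powr (1 - \<theta>) * ?m powr \<theta>" by (simp add: powr_add[symmetric])
    also have "\<dots> \<le> C0 powr (1 - \<theta>) * ?B powr \<theta>"
      using 1 2 assms by (intro mult_mono powr_mono2) auto
    also have "\<dots> \<le> C0 powr 1 * ?B powr \<theta>"
      using C0 assms by (intro mult_right_mono powr_mono) auto
    finally have 3: "?m \<le> C0 * ?B powr \<theta>" using C0 by simp
    have "?B powr \<theta> = (4 * Ca) powr \<theta> * (K powr (2 * \<theta>) * (real (j - i) + 1) powr (- (v * \<theta>)))"
      using Ca K_pos by (simp add: powr_mult powr_powr mult_ac powr_add[symmetric] flip: mult_2_right)
    also have "\<dots> \<le> (4 * Ca) powr 1 * (K powr (2 * \<theta>) * (real (j - i) + 1) powr (- (v * \<theta>)))"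
      using Ca assms by (intro mult_right_mono powr_mono) auto
    finally have "C0 * ?B powr \<theta> \<le> C0 * (4 * Ca * (K powr (2 * \<theta>) * (real (j - i) + 1) powr (- (v * \<theta>))))"
      using C0 Ca by (intro mult_left_mono) auto
    then show ?thesis using 3 by (simp add: pair_bound_def mult_ac)
  qed
qed

definition spread :: "nat \<Rightarrow> nat \<Rightarrow> nat \<Rightarrow> nat \<Rightarrow> nat" where
  "spread i j k l = max (max i j) (max k l) - min (min i j) (min k l)"

text \<open>The first term pays for cutting the four factors at a wide gap, the others for the
  product of two covariances left by a cut in the middle. All three pairings appear, although sorted
  indices produce just one, because the bound must be invariant under permutations.\<close>

definition quad_bound :: "real \<Rightarrow> nat \<Rightarrow> nat \<Rightarrow> nat \<Rightarrow> nat \<Rightarrow> real" where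
  "quad_bound \<theta> i j k l = 4 * Ca * 3 powr v * K ^ 4 * (real (spread i j k l) + 1) powr (- v)
     + pair_bound \<theta> (nat_dist i j) * pair_bound \<theta> (nat_dist k l)
     + pair_bound \<theta> (nat_dist i k) * pair_bound \<theta> (nat_dist j l)
     + pair_bound \<theta> (nat_dist i l) * pair_bound \<theta> (nat_dist j k)"

text \<open>For sorted indices the largest of the three gaps is at least a third of the spread; the
  expectation is split at that gap.\<close>

lemma fourth_product_le:
  assumes \<theta>: "0 \<le> \<theta>" "\<theta> \<le> 1"
  shows "\<bar>expectation (\<lambda>\<omega>. X i \<omega> * X j \<omega> * X k \<omega> * X l \<omega>)\<bar> \<le> quad_bound \<theta> i j k l"
proof (induction i j k l rule: sorted4_induct)
  case (1 i j k l)
  have "(\<lambda>\<omega>. X j \<omega> * X i \<omega> * X k \<omega> * X l \<omega>) = (\<lambda>\<omega>. X i \<omega> * X j \<omega> * X k \<omega> * X l \<omega>)" by (simp add: mult_ac)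
  moreover have "quad_bound \<theta> j i k l = quad_bound \<theta> i j k l"
    by (simp add: quad_bound_def spread_def nat_dist_def add_ac mult_ac max.commute min.commute)
  ultimately show ?case using 1 by simp
next
  case (2 i j k l)
  have "(\<lambda>\<omega>. X i \<omega> * X k \<omega> * X j \<omega> * X l \<omega>) = (\<lambda>\<omega>. X i \<omega> * X j \<omega> * X k \<omega> * X l \<omega>)" by (simp add: mult_ac)
  moreover have "quad_bound \<theta> i k j l = quad_bound \<theta> i j k l"
    by (simp add: quad_bound_def spread_def nat_dist_def add_ac mult_ac max.commute min.commute max.left_commute min.left_commute max.assoc min.assoc)
  ultimately show ?case using 2 by simp
next
  case (3 i j k l)
  have "(\<lambda>\<omega>. X i \<omega> * X j \<omega> * X l \<omega> * X k \<omega>) = (\<lambda>\<omega>. X i \<omega> * X j \<omega> * X k \<omega> * X l \<omega>)" by (simp add: mult_ac)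
  moreover have "quad_bound \<theta> i j l k = quad_bound \<theta> i j k l"
    by (simp add: quad_bound_def spread_def nat_dist_def add_ac mult_ac max.commute min.commute)
  ultimately show ?case using 3 by simp
next
  case (4 i j k l)
  let ?E = "expectation (\<lambda>\<omega>. X i \<omega> * X j \<omega> * X k \<omega> * X l \<omega>)"
  let ?a = "\<lambda>r. Ca * (real r + 1) powr (- v)"
  have sp: "spread i j k l = l - i" using 4 by (auto simp: spread_def max_def min_def)
  have gap: "4 * ?a r * K ^ 4 \<le> 4 * Ca * 3 powr v * K ^ 4 * (real (spread i j k l) + 1) powr (- v)"
    if "l - i \<le> 3 * r" for r
  proof -
    have "(real r + 1) powr (- v) \<le> ((real (l - i) + 1) / 3) powr (- v)"
      using that v by (intro powr_mono2') auto
    also have "\<dots> = 3 powr v * (real (l - i) + 1) powr (- v)"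
      by (simp add: powr_divide powr_minus field_simps)
    finally have "(4 * Ca * K ^ 4) * (real r + 1) powr (- v) \<le> (4 * Ca * K ^ 4) * (3 powr v * (real (l - i) + 1) powr (- v))"
      using Ca K_pos by (intro mult_left_mono) auto
    then show ?thesis by (simp add: sp mult_ac)
  qed
  have pp: "0 \<le> pair_bound \<theta> a * pair_bound \<theta> b" for a b by (simp add: pair_bound_nonneg)
  consider "l - i \<le> 3 * (j - i)" | "l - i \<le> 3 * (k - j)" | "l - i \<le> 3 * (l - k)"
    using 4 by linarith
  then show ?case
  proof cases
    \<comment> \<open>A cut behind the first or before the last index isolates one centred factor,
      so the product of the two expectations vanishes.\<close>
    case 1
    have g: "(\<lambda>\<omega>. X j \<omega> * X k \<omega> * X l \<omega>) \<in> borel_measurable (Ff j)"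
      using X_Ff 4 by (intro borel_measurable_times) auto
    have "\<bar>?E\<bar> \<le> 4 * ?a (j - i) * K * K ^ 3"
      using cov_split[OF X_Fp[of i i] g \<open>i \<le> j\<close> X_bound X_prod_bound(2)] X_mean by (simp add: mult_ac)
    also have "\<dots> = 4 * ?a (j - i) * K ^ 4" by (simp add: power4_eq_xxxx power3_eq_cube)
    finally show ?thesis using gap[OF 1] pp unfolding quad_bound_def by (smt (verit))
  next
    case 3
    have g: "(\<lambda>\<omega>. X i \<omega> * X j \<omega> * X k \<omega>) \<in> borel_measurable (Fp k)"
      using X_Fp 4 by (intro borel_measurable_times) auto
    have "\<bar>?E\<bar> \<le> 4 * ?a (l - k) * K ^ 3 * K"
      using cov_split[OF g X_Ff[of l l] \<open>k \<le> l\<close> X_prod_bound(2) X_bound] X_mean by (simp add: mult_ac)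
    also have "\<dots> = 4 * ?a (l - k) * K ^ 4" by (simp add: power4_eq_xxxx power3_eq_cube)
    finally show ?thesis using gap[OF 3] pp unfolding quad_bound_def by (smt (verit))
  next
    case 2
    have f: "(\<lambda>\<omega>. X i \<omega> * X j \<omega>) \<in> borel_measurable (Fp j)"
      using X_Fp 4 by (intro borel_measurable_times) auto
    have g: "(\<lambda>\<omega>. X k \<omega> * X l \<omega>) \<in> borel_measurable (Ff k)"
      using X_Ff 4 by (intro borel_measurable_times) auto
    let ?p = "expectation (\<lambda>\<omega>. X i \<omega> * X j \<omega>)" and ?q = "expectation (\<lambda>\<omega>. X k \<omega> * X l \<omega>)"
    have "\<bar>?E - ?p * ?q\<bar> \<le> 4 * ?a (k - j) * K\<^sup>2 * K\<^sup>2"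
      using cov_split[OF f g \<open>j \<le> k\<close> X_prod_bound(1) X_prod_bound(1)] by (simp add: mult_ac)
    also have "\<dots> = 4 * ?a (k - j) * K ^ 4" by (simp add: power4_eq_xxxx power2_eq_square)
    finally have "\<bar>?E - ?p * ?q\<bar> \<le> 4 * ?a (k - j) * K ^ 4" .
    moreover have "\<bar>?p * ?q\<bar> \<le> pair_bound \<theta> (nat_dist i j) * pair_bound \<theta> (nat_dist k l)"
      using covariance_le_pair_bound[OF \<open>i \<le> j\<close> \<theta>] covariance_le_pair_bound[OF \<open>k \<le> l\<close> \<theta>] 4
      unfolding abs_mult by (intro mult_mono) (auto simp: nat_dist_def pair_bound_nonneg)
    ultimately show ?thesis using gap[OF 2] pp[of "nat_dist i k" "nat_dist j l"] pp[of "nat_dist i l" "nat_dist j k"]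
      unfolding quad_bound_def by (smt (verit))
  qed
qed

end

text \<open>Independent of \<open>K\<close> and of the block length. The first summand comes from
  the spread of all four indices, the second from the three pairings.\<close>

definition moment_const :: "real \<Rightarrow> real \<Rightarrow> real \<Rightarrow> real \<Rightarrow> real \<Rightarrow> real" where
  "moment_const Ca v C0 \<rho> \<theta> =
     4 * Ca * 3 powr v * (2 * zeta_shift ((v + \<rho>) / 3)) ^ 3 + 3 * (8 * C0 * Ca * zeta_shift (v * \<theta>))\<^sup>2"

context mixing_sequence
begin

text \<open>Decay with \<open>v > 3\<close> would give order \<open>n\<close>. Slower decay is
  compensated by a factor \<open>spread powr \<rho>\<close>, which on a block of length
  \<open>n\<close> costs at most \<open>n powr \<rho>\<close>.\<close>

lemma sum_spread_le:
  fixes s n :: nat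
  assumes \<rho>: "0 \<le> \<rho>" "3 < v + \<rho>"
  defines "I \<equiv> {s..<s + n}"
  shows "(\<Sum>i\<in>I. \<Sum>j\<in>I. \<Sum>k\<in>I. \<Sum>l\<in>I. (real (spread i j k l) + 1) powr (- v))
    \<le> real n powr (1 + \<rho>) * (2 * zeta_shift ((v + \<rho>) / 3)) ^ 3"
proof (cases "n = 0")
  case True then show ?thesis by (simp add: I_def)
next
  case False
  define p where "p = (v + \<rho>) / 3"
  have p: "1 < p" using \<rho> by (simp add: p_def)
  let ?f = "\<lambda>i j. (real (nat_dist i j) + 1) powr (- p)"
  \<comment> \<open>splitting the decay over the three distances from \<open>i\<close> makes the sum factorise\<close>
  have "(real (spread i j k l) + 1) powr (- v) \<le> real n powr \<rho> * (?f i j * ?f i k * ?f i l)"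
    if "i \<in> I" "j \<in> I" "k \<in> I" "l \<in> I" for i j k l
  proof -
    let ?R = "real (spread i j k l) + 1"
    have d: "nat_dist i j \<le> spread i j k l" "nat_dist i k \<le> spread i j k l" "nat_dist i l \<le> spread i j k l"
      by (auto simp: nat_dist_def spread_def max_def min_def)
    have Rn: "?R \<le> real n" using that False by (auto simp: spread_def max_def min_def I_def)
    have "?R powr (- v) = ?R powr \<rho> * (?R powr (- p) * ?R powr (- p) * ?R powr (- p))"
    proof -
      have e: "- v = \<rho> + (- p + - p + - p)" by (simp add: p_def field_simps)
      show ?thesis by (subst e) (simp only: powr_add)
    qed
    also have "\<dots> \<le> real n powr \<rho> * (?f i j * ?f i k * ?f i l)"
      using d Rn \<rho> p by (intro mult_mono powr_mono2 powr_mono2') auto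
    finally show ?thesis .
  qed
  then have "(\<Sum>i\<in>I. \<Sum>j\<in>I. \<Sum>k\<in>I. \<Sum>l\<in>I. (real (spread i j k l) + 1) powr (- v))
     \<le> (\<Sum>i\<in>I. \<Sum>j\<in>I. \<Sum>k\<in>I. \<Sum>l\<in>I. real n powr \<rho> * (?f i j * ?f i k * ?f i l))"
    by (intro sum_mono) auto
  also have "\<dots> = real n powr \<rho> * (\<Sum>i\<in>I. (\<Sum>j\<in>I. ?f i j) ^ 3)"
    by (simp add: sum_distrib_left sum_distrib_right power3_eq_cube mult_ac)
  also have "\<dots> \<le> real n powr \<rho> * (\<Sum>i\<in>I. (2 * zeta_shift p) ^ 3)"
    using p by (intro mult_left_mono sum_mono power_mono sum_nat_dist_le sum_nonneg) (auto simp: I_def)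
  also have "\<dots> = real n powr (1 + \<rho>) * (2 * zeta_shift p) ^ 3"
    using False by (simp add: I_def powr_add)
  finally show ?thesis unfolding p_def .
qed

lemma sum_pair_bound_le:
  fixes s n :: nat
  assumes \<theta>: "1 < v * \<theta>"
  defines "I \<equiv> {s..<s + n}"
  shows "(\<Sum>i\<in>I. \<Sum>j\<in>I. pair_bound \<theta> (nat_dist i j))
    \<le> real n * (8 * C0 * Ca * zeta_shift (v * \<theta>)) * K powr (2 * \<theta>)"
proof -
  have "(\<Sum>i\<in>I. \<Sum>j\<in>I. pair_bound \<theta> (nat_dist i j))
     = 4 * C0 * Ca * K powr (2 * \<theta>) * (\<Sum>i\<in>I. \<Sum>j\<in>I. (real (nat_dist i j) + 1) powr (- (v * \<theta>)))"
    by (simp add: pair_bound_def sum_distrib_left)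
  also have "\<dots> \<le> 4 * C0 * Ca * K powr (2 * \<theta>) * (\<Sum>i\<in>I. 2 * zeta_shift (v * \<theta>))"
    using C0 Ca assms by (intro mult_left_mono sum_mono sum_nat_dist_le) auto
  finally show ?thesis by (simp add: I_def mult_ac)
qed

text \<open>Clustered indices are few but carry the full \<open>K ^ 4\<close>; paired indices number
  about \<open>n\<^sup>2\<close> but carry only \<open>K powr (4 * \<theta>)\<close>. A small
  \<open>\<theta>\<close> is what keeps the second term close to its size for independent
  summands.\<close>

lemma fourth_moment_le:
  assumes \<theta>: "0 \<le> \<theta>" "\<theta> \<le> 1" "1 < v * \<theta>" and \<rho>: "0 \<le> \<rho>" "3 < v + \<rho>"
  shows "expectation (\<lambda>\<omega>. (\<Sum>i\<in>{s..<s + n}. X i \<omega>) ^ 4)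
    \<le> moment_const Ca v C0 \<rho> \<theta> * (K ^ 4 * real n powr (1 + \<rho>) + K powr (4 * \<theta>) * (real n)\<^sup>2)"
proof -
  define I where "I = {s..<s + n}"
  let ?p = "\<lambda>i j. pair_bound \<theta> (nat_dist i j)"
  define S where "S = (\<Sum>i\<in>I. \<Sum>j\<in>I. ?p i j)"
  have "expectation (\<lambda>\<omega>. (\<Sum>i\<in>I. X i \<omega>) ^ 4)
     = expectation (\<lambda>\<omega>. \<Sum>i\<in>I. \<Sum>j\<in>I. \<Sum>k\<in>I. \<Sum>l\<in>I. X i \<omega> * X j \<omega> * X k \<omega> * X l \<omega>)"
    by (simp add: power4_eq_xxxx sum_distrib_left sum_distrib_right mult_ac)
  also have "\<dots> = (\<Sum>i\<in>I. \<Sum>j\<in>I. \<Sum>k\<in>I. \<Sum>l\<in>I. expectation (\<lambda>\<omega>. X i \<omega> * X j \<omega> * X k \<omega> * X l \<omega>))"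
    using integrable_X4 by simp
  also have "\<dots> \<le> (\<Sum>i\<in>I. \<Sum>j\<in>I. \<Sum>k\<in>I. \<Sum>l\<in>I. quad_bound \<theta> i j k l)"
    by (intro sum_mono order_trans[OF abs_ge_self fourth_product_le] \<theta>)
  also have "\<dots> = 4 * Ca * 3 powr v * K ^ 4 * (\<Sum>i\<in>I. \<Sum>j\<in>I. \<Sum>k\<in>I. \<Sum>l\<in>I. (real (spread i j k l) + 1) powr (- v))
      + ((\<Sum>i\<in>I. \<Sum>j\<in>I. \<Sum>k\<in>I. \<Sum>l\<in>I. ?p i j * ?p k l)
      + (\<Sum>i\<in>I. \<Sum>j\<in>I. \<Sum>k\<in>I. \<Sum>l\<in>I. ?p i k * ?p j l)
      + (\<Sum>i\<in>I. \<Sum>j\<in>I. \<Sum>k\<in>I. \<Sum>l\<in>I. ?p i l * ?p j k))"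
    unfolding quad_bound_def sum.distrib by (simp add: sum_distrib_left)
  also have "(\<Sum>i\<in>I. \<Sum>j\<in>I. \<Sum>k\<in>I. \<Sum>l\<in>I. ?p i j * ?p k l) = S\<^sup>2"
    unfolding S_def power2_eq_square by (simp flip: sum_distrib_left sum_distrib_right)
  also have "(\<Sum>i\<in>I. \<Sum>j\<in>I. \<Sum>k\<in>I. \<Sum>l\<in>I. ?p i k * ?p j l) = S\<^sup>2"
    unfolding S_def power2_eq_square
    by (subst sum.swap[of _ I I]) (simp add: sum_distrib_left sum_distrib_right mult_ac)
  also have "(\<Sum>i\<in>I. \<Sum>j\<in>I. \<Sum>k\<in>I. \<Sum>l\<in>I. ?p i l * ?p j k) = S\<^sup>2"
  proof -
    have "(\<Sum>i\<in>I. \<Sum>j\<in>I. \<Sum>k\<in>I. \<Sum>l\<in>I. ?p i l * ?p j k) = (\<Sum>i\<in>I. (\<Sum>l\<in>I. ?p i l) * S)"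
      unfolding S_def by (intro sum.cong refl) (simp flip: sum_distrib_left sum_distrib_right)
    then show ?thesis by (simp add: S_def power2_eq_square sum_distrib_right)
  qed
  also have "4 * Ca * 3 powr v * K ^ 4 * (\<Sum>i\<in>I. \<Sum>j\<in>I. \<Sum>k\<in>I. \<Sum>l\<in>I. (real (spread i j k l) + 1) powr (- v))
      + (S\<^sup>2 + S\<^sup>2 + S\<^sup>2) \<le> 4 * Ca * 3 powr v * K ^ 4 * (real n powr (1 + \<rho>) * (2 * zeta_shift ((v + \<rho>) / 3)) ^ 3)
      + 3 * (real n * (8 * C0 * Ca * zeta_shift (v * \<theta>)) * K powr (2 * \<theta>))\<^sup>2"
  proof -
    have "S\<^sup>2 \<le> (real n * (8 * C0 * Ca * zeta_shift (v * \<theta>)) * K powr (2 * \<theta>))\<^sup>2"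
      using sum_pair_bound_le[OF \<theta>(3), of s n] unfolding S_def I_def
      by (intro power_mono) (auto intro!: sum_nonneg pair_bound_nonneg)
    moreover have "4 * Ca * 3 powr v * K ^ 4 * (\<Sum>i\<in>I. \<Sum>j\<in>I. \<Sum>k\<in>I. \<Sum>l\<in>I. (real (spread i j k l) + 1) powr (- v))
      \<le> 4 * Ca * 3 powr v * K ^ 4 * (real n powr (1 + \<rho>) * (2 * zeta_shift ((v + \<rho>) / 3)) ^ 3)"
      unfolding I_def using Ca K_pos by (intro mult_left_mono sum_spread_le[OF \<rho>]) auto
    ultimately show ?thesis by linarith
  qed
  also have "\<dots> = (4 * Ca * 3 powr v * (2 * zeta_shift ((v + \<rho>) / 3)) ^ 3) * (K ^ 4 * real n powr (1 + \<rho>))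
      + (3 * (8 * C0 * Ca * zeta_shift (v * \<theta>))\<^sup>2) * (K powr (4 * \<theta>) * (real n)\<^sup>2)"
  proof -
    have "(K powr (2 * \<theta>))\<^sup>2 = K powr (4 * \<theta>)" using K_pos by (simp add: power2_eq_square powr_add[symmetric])
    then show ?thesis by (simp add: power_mult_distrib mult_ac)
  qed
  also have "\<dots> \<le> moment_const Ca v C0 \<rho> \<theta> * (K ^ 4 * real n powr (1 + \<rho>)) + moment_const Ca v C0 \<rho> \<theta> * (K powr (4 * \<theta>) * (real n)\<^sup>2)"
  proof -
    have "0 \<le> zeta_shift ((v + \<rho>) / 3)"
      unfolding zeta_shift_def using \<rho> by (intro suminf_nonneg summable_zeta_shift) auto
    then show ?thesis
      using Ca K_pos unfolding moment_const_def by (intro add_mono mult_right_mono) auto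
  qed
  finally show ?thesis by (simp add: I_def distrib_left)
qed

end

section \<open>Interval sums of a mixing sequence\<close>

text \<open>\<open>a div 2 ^ i * 2 ^ i\<close> is \<open>a\<close> with its \<open>i\<close> lowest
  binary digits cleared. Clearing one more digit either changes nothing or removes one aligned block
  of length \<open>2 ^ i\<close>, at cost \<open>\<tau>\<close>.\<close>

lemma dyadic_rounding_le:
  fixes F :: "nat \<Rightarrow> real"
  assumes "\<And>j k. j \<le> J \<Longrightarrow> (k + 1) * 2 ^ j \<le> N \<Longrightarrow> \<bar>F ((k + 1) * 2 ^ j) - F (k * 2 ^ j)\<bar> \<le> \<tau>"
    and "0 \<le> \<tau>" "a \<le> N" "i \<le> Suc J"
  shows "\<bar>F a - F (a div 2 ^ i * 2 ^ i)\<bar> \<le> real i * \<tau>"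
  using \<open>i \<le> Suc J\<close>
proof (induction i)
  case 0 then show ?case by simp
next
  case (Suc i)
  define c where "c = a div 2 ^ Suc i"
  have d: "a div 2 ^ i = 2 * c + a div 2 ^ i mod 2"
    by (simp add: c_def div_mult2_eq power_Suc2 del: power_Suc)
  have "\<bar>F (a div 2 ^ i * 2 ^ i) - F (c * 2 ^ Suc i)\<bar> \<le> \<tau>"
  proof (cases "a div 2 ^ i mod 2 = 0")
    case True
    then have "a div 2 ^ i * 2 ^ i = c * 2 ^ Suc i" using d by simp
    then show ?thesis using assms by (simp del: power_Suc)
  next
    case False
    then have e: "a div 2 ^ i = 2 * c + 1" using d by simp
    have "(2 * c + 1) * 2 ^ i \<le> a" using div_times_less_eq_dividend[of a "2 ^ i"] unfolding e by simp
    then show ?thesis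
      using assms(1)[of i "2 * c"] assms(3) Suc.prems unfolding e by (simp add: mult_ac)
  qed
  then show ?case using Suc.IH Suc.prems unfolding c_def[symmetric] by (simp add: algebra_simps)
qed

text \<open>After \<open>J\<close> digits have been cleared at both ends, the endpoints are equal or
  neighbouring multiples of \<open>2 ^ J\<close>. This uses \<open>2 * J + 1\<close> blocks at
  most.\<close>

lemma dyadic_chaining:
  fixes F :: "nat \<Rightarrow> real"
  assumes A: "\<And>j k. j \<le> J \<Longrightarrow> (k + 1) * 2 ^ j \<le> N \<Longrightarrow> \<bar>F ((k + 1) * 2 ^ j) - F (k * 2 ^ j)\<bar> \<le> \<tau>"
    and \<tau>: "0 \<le> \<tau>" and ab: "a \<le> b" "b \<le> N" "b \<le> a + 2 ^ J"
  shows "\<bar>F b - F a\<bar> \<le> (2 * real J + 1) * \<tau>"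
proof -
  let ?r = "\<lambda>a. a div 2 ^ J * 2 ^ J"
  have 1: "\<bar>F a - F (?r a)\<bar> \<le> real J * \<tau>" "\<bar>F b - F (?r b)\<bar> \<le> real J * \<tau>"
    using dyadic_rounding_le[of J N F \<tau>] A \<tau> ab by auto
  have "a div 2 ^ J \<le> b div 2 ^ J" using ab by (intro div_le_mono)
  moreover have "b div 2 ^ J \<le> a div 2 ^ J + 1"
    using div_le_mono[OF ab(3), of "2 ^ J"] by simp
  ultimately consider "b div 2 ^ J = a div 2 ^ J" | "b div 2 ^ J = a div 2 ^ J + 1" by linarith
  then have "\<bar>F (?r b) - F (?r a)\<bar> \<le> \<tau>"
  proof cases
    case 1 then show ?thesis using \<tau> by simp
  next
    case 2
    then have "(a div 2 ^ J + 1) * 2 ^ J \<le> N" using ab(2) div_times_less_eq_dividend[of b "2 ^ J"] by simp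
    then show ?thesis using A[of J "a div 2 ^ J"] 2 by simp
  qed
  with 1 show ?thesis by (simp add: algebra_simps)
qed

text \<open>The \<open>Y i\<close> are unbounded with uniformly bounded moments of order
  \<open>q\<close> and a common mean; truncation reduces them to
  \<open>mixing_sequence\<close>.\<close>

locale mixing_average = mixing_filtration +
  fixes Y :: "nat \<Rightarrow> 'a \<Rightarrow> real" and q B e :: real
  assumes Y_Fp: "\<And>i l. i \<le> l \<Longrightarrow> Y i \<in> borel_measurable (Fp l)"
    and Y_Ff: "\<And>i l. l \<le> i \<Longrightarrow> Y i \<in> borel_measurable (Ff l)"
    and Y_nonneg: "\<And>i \<omega>. \<omega> \<in> space M \<Longrightarrow> 0 \<le> Y i \<omega>"
    and Y_int: "\<And>i. integrable M (\<lambda>\<omega>. Y i \<omega> powr q)"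
    and Y_moment: "\<And>i. expectation (\<lambda>\<omega>. Y i \<omega> powr q) \<le> B"
    and Y_mean: "\<And>i. expectation (Y i) = e"
    and q: "8 < q" and v_q: "2 * q / (q - 8) < v"
begin

text \<open>The mixing assumption reads \<open>v * margin > 2\<close>. The fourth moment bound is applied with \<open>\<rho> = margin\<close>
  and \<open>\<theta> = margin / 2\<close>.\<close>

definition "margin = (q - 8) / q"

lemma margin: "0 < margin" "margin < 1" "1 < v * (margin / 2)" "3 < v + margin" "1 / q = (1 - margin) / 8"
proof -
  show y: "0 < margin" "margin < 1" using q by (auto simp: margin_def field_simps)
  show "1 / q = (1 - margin) / 8" using q by (simp add: margin_def field_simps)
  have v: "2 / margin < v" using v_q by (simp add: margin_def)
  then show "1 < v * (margin / 2)" using y by (simp add: field_simps)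
  \<comment> \<open>This product is \<open>2 + margin\<^sup>2 - 3 * margin\<close>; so
    \<open>v > 2 / margin\<close> already implies \<open>v + margin > 3\<close>, the other decay
    condition of the fourth moment bound.\<close>
  have "0 < (1 - margin) * (2 - margin)" using y by simp
  then have "3 * margin < 2 + margin * margin" by (simp add: algebra_simps)
  then have "3 < 2 / margin + margin" using y by (simp add: field_simps)
  then show "3 < v + margin" using v by simp
qed

lemma Y_meas[measurable]: "Y i \<in> borel_measurable M"
  by (rule measurable_from_subalg[OF sub_Fp Y_Fp[of i i]]) simp

lemma B_nonneg: "0 \<le> B"
  using order_trans[OF integral_nonneg_AE Y_moment[of 0]] by auto

lemma powr_le_one_add: "0 \<le> (y::real) \<Longrightarrow> a \<le> q \<Longrightarrow> 0 < a \<Longrightarrow> y powr a \<le> 1 + y powr q"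
proof (cases "y \<le> 1")
  case True assume "0 \<le> y" "0 < a" then show ?thesis using True powr_le1[of a y] by (smt (verit) powr_ge_zero)
next
  case False assume "a \<le> q" then show ?thesis using False powr_mono[of a q y] by (simp add: add_increasing)
qed

lemma Y_integrable: "integrable M (Y i)"
proof (rule Bochner_Integration.integrable_bound)
  show "integrable M (\<lambda>\<omega>. 1 + Y i \<omega> powr q)" using Y_int by simp
  show "AE \<omega> in M. norm (Y i \<omega>) \<le> norm (1 + Y i \<omega> powr q)"
    using powr_le_one_add[of "Y i _" 1] Y_nonneg q by (intro AE_I2) fastforce
qed simp

definition trunc :: "real \<Rightarrow> nat \<Rightarrow> 'a \<Rightarrow> real" where
  "trunc K i \<omega> = min (Y i \<omega>) K - expectation (\<lambda>\<omega>. min (Y i \<omega>) K)"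

lemma min_integrable: "0 \<le> K \<Longrightarrow> integrable M (\<lambda>\<omega>. min (Y i \<omega>) K)"
  by (rule integrable_const_bound[where B=K]) (auto intro!: AE_I2 simp: Y_nonneg)

text \<open>For the bias: where \<open>Y > K\<close>, the missing part is at most \<open>Y\<close>,
  and \<open>Y = Y powr (1 - q) * Y powr q\<close> with \<open>1 - q\<close> negative.\<close>

lemma min_mean:
  assumes "0 < K"
  shows "0 \<le> expectation (\<lambda>\<omega>. min (Y i \<omega>) K)" "expectation (\<lambda>\<omega>. min (Y i \<omega>) K) \<le> K"
    "\<bar>expectation (\<lambda>\<omega>. min (Y i \<omega>) K) - e\<bar> \<le> K powr (1 - q) * B"
proof -
  show "0 \<le> expectation (\<lambda>\<omega>. min (Y i \<omega>) K)"
    using assms by (intro integral_nonneg_AE AE_I2) (auto simp: Y_nonneg)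
  show "expectation (\<lambda>\<omega>. min (Y i \<omega>) K) \<le> K"
    using min_integrable[of K i] assms by (intro integral_le_const) (auto intro!: AE_I2)
  have "\<bar>expectation (\<lambda>\<omega>. min (Y i \<omega>) K) - e\<bar> = \<bar>expectation (\<lambda>\<omega>. min (Y i \<omega>) K - Y i \<omega>)\<bar>"
    using min_integrable[of K i] Y_integrable[of i] assms Y_mean[of i] by simp
  also have "\<dots> \<le> expectation (\<lambda>\<omega>. \<bar>min (Y i \<omega>) K - Y i \<omega>\<bar>)" by (rule integral_abs_bound)
  also have "\<dots> \<le> expectation (\<lambda>\<omega>. K powr (1 - q) * Y i \<omega> powr q)"
  proof (rule integral_mono)
    show "integrable M (\<lambda>\<omega>. \<bar>min (Y i \<omega>) K - Y i \<omega>\<bar>)"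
      using min_integrable[of K i] Y_integrable[of i] assms by auto
    show "integrable M (\<lambda>\<omega>. K powr (1 - q) * Y i \<omega> powr q)" using Y_int by simp
    fix \<omega> assume w: "\<omega> \<in> space M"
    show "\<bar>min (Y i \<omega>) K - Y i \<omega>\<bar> \<le> K powr (1 - q) * Y i \<omega> powr q"
    proof (cases "Y i \<omega> \<le> K")
      case False
      then have Y: "0 < Y i \<omega>" "K \<le> Y i \<omega>" using assms by auto
      have "Y i \<omega> = Y i \<omega> powr (1 - q) * Y i \<omega> powr q" using Y by (simp add: powr_add[symmetric])
      also have "\<dots> \<le> K powr (1 - q) * Y i \<omega> powr q"
        using Y assms q by (intro mult_right_mono powr_mono2') auto
      finally show ?thesis using False assms by simp
    qed simp
  qed
  also have "\<dots> \<le> K powr (1 - q) * B" using Y_moment[of i] by (simp add: mult_left_mono)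
  finally show "\<bar>expectation (\<lambda>\<omega>. min (Y i \<omega>) K) - e\<bar> \<le> K powr (1 - q) * B" .
qed

text \<open>Truncating a nonnegative variable does not increase its second moment, so
  \<open>1 + B\<close> serves as \<open>C0\<close> for every \<open>K\<close>.\<close>

lemma trunc_mixing_sequence:
  assumes K: "0 < K"
  shows "mixing_sequence M Fp Ff Ca v (trunc K) K (1 + B)"
proof
  fix i l :: nat
  show "trunc K i \<in> borel_measurable (Fp l)" if "i \<le> l"
    unfolding trunc_def using Y_Fp[OF that] by measurable
  show "trunc K i \<in> borel_measurable (Ff l)" if "l \<le> i"
    unfolding trunc_def using Y_Ff[OF that] by measurable
  show "\<bar>trunc K i \<omega>\<bar> \<le> K" if "\<omega> \<in> space M" for \<omega>
    using min_mean(1,2)[OF K, of i] Y_nonneg[OF that, of i] K unfolding trunc_def by (auto simp: abs_if min_def)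
  show "expectation (trunc K i) = 0"
    unfolding trunc_def using min_integrable[of K i] K by (simp add: prob_space)
  show "expectation (\<lambda>\<omega>. (trunc K i \<omega>)\<^sup>2) \<le> 1 + B"
  proof -
    have i2: "integrable M (\<lambda>\<omega>. (min (Y i \<omega>) K)\<^sup>2)"
      by (rule integrable_const_bound[where B="K\<^sup>2"]) (use K in \<open>auto intro!: AE_I2 power_mono simp: Y_nonneg\<close>)
    have "expectation (\<lambda>\<omega>. (trunc K i \<omega>)\<^sup>2) = expectation (\<lambda>\<omega>. (min (Y i \<omega>) K)\<^sup>2) - (expectation (\<lambda>\<omega>. min (Y i \<omega>) K))\<^sup>2"
      unfolding trunc_def using min_integrable[of K i] i2 K by (subst variance_eq) auto
    also have "\<dots> \<le> expectation (\<lambda>\<omega>. (min (Y i \<omega>) K)\<^sup>2)" by simp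
    also have "\<dots> \<le> expectation (\<lambda>\<omega>. 1 + Y i \<omega> powr q)"
    proof (rule integral_mono[OF i2])
      show "integrable M (\<lambda>\<omega>. 1 + Y i \<omega> powr q)" using Y_int by simp
      fix \<omega> assume w: "\<omega> \<in> space M"
      have "(min (Y i \<omega>) K)\<^sup>2 \<le> (Y i \<omega>)\<^sup>2" using Y_nonneg[OF w, of i] K by (intro power_mono) auto
      also have "\<dots> = Y i \<omega> powr 2" using Y_nonneg[OF w, of i] by simp
      also have "\<dots> \<le> 1 + Y i \<omega> powr q" using q Y_nonneg[OF w, of i] by (intro powr_le_one_add) auto
      finally show "(min (Y i \<omega>) K)\<^sup>2 \<le> 1 + Y i \<omega> powr q" .
    qed
    also have "\<dots> \<le> 1 + B" using Y_int Y_moment[of i] by (simp add: prob_space)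
    finally show ?thesis .
  qed
qed (use K B_nonneg in auto)

text \<open>Either truncation at \<open>K\<close> is felt before \<open>N\<close>, or some aligned
  dyadic block of length at most \<open>2 ^ J\<close> has a large sum. Only aligned blocks enter,
  which keeps the union small; chaining recovers arbitrary intervals. The fourth powers prepare
  Markov's inequality.\<close>

definition bad_event :: "real \<Rightarrow> real \<Rightarrow> nat \<Rightarrow> nat \<Rightarrow> 'a set" where
  "bad_event K \<tau> J N = (\<Union>w\<in>{..<N}. {\<omega> \<in> space M. K < Y w \<omega>}) \<union>
     (\<Union>j\<in>{..J}. \<Union>k\<in>{..<N div 2 ^ j}. {\<omega> \<in> space M. \<tau> ^ 4 \<le> (\<Sum>i\<in>{k * 2 ^ j..<k * 2 ^ j + 2 ^ j}. trunc K i \<omega>) ^ 4})"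

lemma trunc_meas[measurable]: "trunc K i \<in> borel_measurable M"
  unfolding trunc_def by measurable

lemma bad_event_sets[measurable]: "bad_event K \<tau> J N \<in> sets M"
  unfolding bad_event_def by measurable

definition "moment_bound_const = moment_const Ca v (1 + B) margin (margin / 2)"

lemma mconst_nonneg: "0 \<le> moment_bound_const"
proof -
  have "0 \<le> zeta_shift ((v + margin) / 3)"
    unfolding zeta_shift_def using margin by (intro suminf_nonneg summable_zeta_shift) auto
  then show ?thesis unfolding moment_bound_const_def moment_const_def using Ca by simp
qed

lemma block_prob_le:
  assumes K: "0 < K" and \<tau>: "0 < \<tau>"
  shows "prob {\<omega> \<in> space M. \<tau> ^ 4 \<le> (\<Sum>i\<in>{s..<s + n}. trunc K i \<omega>) ^ 4}
    \<le> moment_bound_const * (K ^ 4 * real n powr (1 + margin) + K powr (2 * margin) * (real n)\<^sup>2) / \<tau> ^ 4"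
proof -
  interpret S: mixing_sequence M Fp Ff Ca v "trunc K" K "1 + B" by (rule trunc_mixing_sequence[OF K])
  have int: "integrable M (\<lambda>\<omega>. (\<Sum>i\<in>{s..<s + n}. trunc K i \<omega>) ^ 4)"
  proof (rule integrable_const_bound[where B="(real n * K) ^ 4"])
    have "\<bar>\<Sum>i\<in>{s..<s + n}. trunc K i \<omega>\<bar> \<le> real n * K" if "\<omega> \<in> space M" for \<omega>
    proof -
      have "\<bar>\<Sum>i\<in>{s..<s + n}. trunc K i \<omega>\<bar> \<le> (\<Sum>i\<in>{s..<s + n}. K)"
        by (rule order_trans[OF sum_abs]) (intro sum_mono S.X_bound that)
      then show ?thesis by simp
    qed
    then show "AE \<omega> in M. norm ((\<Sum>i\<in>{s..<s + n}. trunc K i \<omega>) ^ 4) \<le> (real n * K) ^ 4"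
      by (intro AE_I2) (metis power_abs power_mono abs_ge_zero real_norm_def)
  qed simp
  have "prob {\<omega> \<in> space M. \<tau> ^ 4 \<le> (\<Sum>i\<in>{s..<s + n}. trunc K i \<omega>) ^ 4}
     \<le> expectation (\<lambda>\<omega>. (\<Sum>i\<in>{s..<s + n}. trunc K i \<omega>) ^ 4) / \<tau> ^ 4"
    by (rule integral_Markov_inequality_measure[OF int, of "{}"]) (use \<tau> in auto)
  also have "\<dots> \<le> moment_bound_const * (K ^ 4 * real n powr (1 + margin) + K powr (2 * margin) * (real n)\<^sup>2) / \<tau> ^ 4"
    using S.fourth_moment_le[of "margin / 2" margin s n] margin \<tau> unfolding moment_bound_const_def
    by (intro divide_right_mono) auto
  finally show ?thesis .
qed

lemma exceed_prob_le:
  assumes K: "0 < K"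
  shows "prob {\<omega> \<in> space M. K < Y w \<omega>} \<le> B * K powr (- q)"
proof -
  have "prob {\<omega> \<in> space M. K < Y w \<omega>} \<le> prob {\<omega> \<in> space M. K powr q \<le> Y w \<omega> powr q}"
    using K q by (intro finite_measure_mono) (auto intro!: powr_mono2)
  also have "\<dots> \<le> expectation (\<lambda>\<omega>. Y w \<omega> powr q) / K powr q"
    by (rule integral_Markov_inequality_measure[OF Y_int, of "{}"]) (use K in auto)
  also have "\<dots> \<le> B / K powr q" using Y_moment by (intro divide_right_mono) auto
  finally show ?thesis by (simp add: powr_minus_divide)
qed

text \<open>At level \<open>j\<close> there are at most \<open>N / 2 ^ j\<close> blocks. The fourth
  moment grows faster than linearly in the block length, so the top level \<open>J\<close> dominates
  each of the \<open>J + 1\<close> levels.\<close>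

lemma bad_event_prob_le:
  assumes K: "0 < K" and \<tau>: "0 < \<tau>"
  shows "prob (bad_event K \<tau> J N) \<le> real N * (B * K powr (- q))
    + (real J + 1) * (real N * moment_bound_const * (K ^ 4 * 2 powr (real J * margin) + K powr (2 * margin) * 2 powr J) / \<tau> ^ 4)"
proof -
  let ?A = "\<lambda>j k. {\<omega> \<in> space M. \<tau> ^ 4 \<le> (\<Sum>i\<in>{k * 2 ^ j..<k * 2 ^ j + 2 ^ j}. trunc K i \<omega>) ^ 4}"
  have "prob (bad_event K \<tau> J N) \<le> prob (\<Union>w\<in>{..<N}. {\<omega> \<in> space M. K < Y w \<omega>}) + prob (\<Union>j\<in>{..J}. \<Union>k\<in>{..<N div 2 ^ j}. ?A j k)"
    unfolding bad_event_def by (intro measure_Un_le) measurable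
  also have "prob (\<Union>w\<in>{..<N}. {\<omega> \<in> space M. K < Y w \<omega>}) \<le> (\<Sum>w<N. prob {\<omega> \<in> space M. K < Y w \<omega>})"
    by (intro measure_UNION_le) auto
  also have "\<dots> \<le> (\<Sum>w<N. B * K powr (- q))"
    by (intro sum_mono exceed_prob_le K)
  also have "prob (\<Union>j\<in>{..J}. \<Union>k\<in>{..<N div 2 ^ j}. ?A j k) \<le> (\<Sum>j\<le>J. prob (\<Union>k\<in>{..<N div 2 ^ j}. ?A j k))"
    by (intro measure_UNION_le) auto
  also have "\<dots> \<le> (\<Sum>j\<le>J. real N * moment_bound_const * (K ^ 4 * 2 powr (real J * margin) + K powr (2 * margin) * 2 powr J) / \<tau> ^ 4)"
  proof (rule sum_mono)
    fix j assume j: "j \<in> {..J}"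
    have "prob (\<Union>k\<in>{..<N div 2 ^ j}. ?A j k) \<le> (\<Sum>k<N div 2 ^ j. prob (?A j k))"
      by (intro measure_UNION_le) auto
    also have "\<dots> \<le> (\<Sum>k<N div 2 ^ j. moment_bound_const * (K ^ 4 * real (2 ^ j) powr (1 + margin) + K powr (2 * margin) * (real (2 ^ j))\<^sup>2) / \<tau> ^ 4)"
      by (intro sum_mono block_prob_le K \<tau>)
    also have "\<dots> = real (N div 2 ^ j) * (moment_bound_const * (K ^ 4 * real (2 ^ j) powr (1 + margin) + K powr (2 * margin) * (real (2 ^ j))\<^sup>2) / \<tau> ^ 4)"
      by simp
    also have "\<dots> \<le> (real N / 2 ^ j) * (moment_bound_const * (K ^ 4 * real (2 ^ j) powr (1 + margin) + K powr (2 * margin) * (real (2 ^ j))\<^sup>2) / \<tau> ^ 4)"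
      using of_nat_div_le_of_nat[of N "2 ^ j"] mconst_nonneg by (intro mult_right_mono) auto
    also have "\<dots> = real N * moment_bound_const * (K ^ 4 * 2 powr (real j * margin) + K powr (2 * margin) * 2 powr j) / \<tau> ^ 4"
    proof -
      have "real (2 ^ j) powr (1 + margin) = 2 ^ j * 2 powr (real j * margin)"
        by (simp add: powr_add powr_realpow[symmetric] powr_powr)
      moreover have "(2::real) powr j = 2 ^ j" by (simp add: powr_realpow)
      moreover have "n / c * (m * (k * (c * a) + h * c\<^sup>2) / t) = n * m * (k * a + h * c) / t"
        if "c \<noteq> 0" for n c m k a h t :: real
      proof -
        have "k * (c * a) + h * c\<^sup>2 = c * (k * a + h * c)" by algebra
        then show ?thesis using that by simp
      qed
      ultimately show ?thesis by simp
    qed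
    also have "\<dots> \<le> real N * moment_bound_const * (K ^ 4 * 2 powr (real J * margin) + K powr (2 * margin) * 2 powr J) / \<tau> ^ 4"
      using j margin(1) mconst_nonneg K
      by (intro divide_right_mono mult_left_mono add_mono powr_mono mult_nonneg_nonneg mult_right_mono) auto
    finally show "prob (\<Union>k\<in>{..<N div 2 ^ j}. ?A j k) \<le> real N * moment_bound_const * (K ^ 4 * 2 powr (real J * margin) + K powr (2 * margin) * 2 powr J) / \<tau> ^ 4" .
  qed
  finally show ?thesis by (simp add: algebra_simps)
qed

text \<open>Off the bad event \<open>Y\<close> coincides with its truncation below \<open>N\<close>.
  What remains beside the chained sum is the bias of the truncated means, at most
  \<open>2 ^ J\<close> times.\<close>

lemma not_bad_event:
  assumes K: "0 < K" and \<tau>: "0 < \<tau>" and \<omega>: "\<omega> \<in> space M" "\<omega> \<notin> bad_event K \<tau> J N"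
  shows "w < N \<Longrightarrow> Y w \<omega> \<le> K"
    and "a \<le> b \<Longrightarrow> b \<le> N \<Longrightarrow> b \<le> a + 2 ^ J \<Longrightarrow>
      \<bar>\<Sum>i\<in>{a..<b}. (Y i \<omega> - e)\<bar> \<le> (2 * real J + 1) * \<tau> + 2 ^ J * (K powr (1 - q) * B)"
proof -
  show YK: "Y w \<omega> \<le> K" if "w < N" for w
    using \<omega> that unfolding bad_event_def by force
  assume ab: "a \<le> b" "b \<le> N" "b \<le> a + 2 ^ J"
  define F where "F n = (\<Sum>i<n. trunc K i \<omega>)" for n
  have F: "F b - F a = (\<Sum>i\<in>{a..<b}. trunc K i \<omega>)" if "a \<le> b" for a b
    using sum_diff_nat_ivl[of 0 a b "\<lambda>i. trunc K i \<omega>"] that by (simp add: F_def lessThan_atLeast0)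
  have "\<bar>F b - F a\<bar> \<le> (2 * real J + 1) * \<tau>"
  proof (rule dyadic_chaining[OF _ less_imp_le[OF \<tau>] ab])
    fix j k :: nat assume j: "j \<le> J" "(k + 1) * 2 ^ j \<le> N"
    then have "k < N div 2 ^ j" using less_eq_div_iff_mult_less_eq[of "2 ^ j" "k + 1" N] by simp
    then have "\<not> \<tau> ^ 4 \<le> (\<Sum>i\<in>{k * 2 ^ j..<k * 2 ^ j + 2 ^ j}. trunc K i \<omega>) ^ 4"
      using \<omega> j(1) unfolding bad_event_def by blast
    then have "\<bar>\<Sum>i\<in>{k * 2 ^ j..<k * 2 ^ j + 2 ^ j}. trunc K i \<omega>\<bar> < \<tau>"
      using \<tau> power_mono[of \<tau> "\<bar>\<Sum>i\<in>{k * 2 ^ j..<k * 2 ^ j + 2 ^ j}. trunc K i \<omega>\<bar>" 4] by force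
    then show "\<bar>F ((k + 1) * 2 ^ j) - F (k * 2 ^ j)\<bar> \<le> \<tau>"
      using F[of "k * 2 ^ j" "(k + 1) * 2 ^ j"] by (simp add: add.commute)
  qed
  moreover have "\<bar>(\<Sum>i\<in>{a..<b}. (Y i \<omega> - e)) - (F b - F a)\<bar> \<le> 2 ^ J * (K powr (1 - q) * B)"
  proof -
    have "(\<Sum>i\<in>{a..<b}. (Y i \<omega> - e)) - (F b - F a) = (\<Sum>i\<in>{a..<b}. expectation (\<lambda>\<omega>. min (Y i \<omega>) K) - e)"
      unfolding F[OF ab(1)] sum_subtractf[symmetric] using YK ab by (intro sum.cong) (auto simp: trunc_def)
    also have "\<bar>\<dots>\<bar> \<le> (\<Sum>i\<in>{a..<b}. K powr (1 - q) * B)"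
      by (rule order_trans[OF sum_abs]) (intro sum_mono min_mean(3) K)
    also have "\<dots> = real (b - a) * (K powr (1 - q) * B)" by simp
    also have "\<dots> \<le> 2 ^ J * (K powr (1 - q) * B)"
    proof -
      have "real (b - a) \<le> real (2 ^ J)" using ab by (simp only: of_nat_le_iff)
      then show ?thesis using B_nonneg by (intro mult_right_mono) auto
    qed
    finally show ?thesis .
  qed
  ultimately show "\<bar>\<Sum>i\<in>{a..<b}. (Y i \<omega> - e)\<bar> \<le> (2 * real J + 1) * \<tau> + 2 ^ J * (K powr (1 - q) * B)"
    by linarith
qed

section \<open>Choice of scales and almost sure bounds\<close>

context
  fixes \<epsilon> :: real
  assumes \<epsilon>: "0 < \<epsilon>" "\<epsilon> \<le> margin / 100"
begin

text \<open>With \<open>N = 2 ^ p\<close>, these scales are powers of \<open>N\<close>.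
  \<open>level\<close> makes an exceedance anywhere before \<open>N\<close> have probability of
  order \<open>N powr (- q * \<epsilon>)\<close>; \<open>thresh\<close> lies one factor
  \<open>N powr \<epsilon>\<close> below the final bound, to absorb the logarithmic number of
  levels; \<open>2 ^ depth p\<close> covers the window length
  \<open>N powr (1 / 2 + \<epsilon>)\<close>. \<open>gain\<close> is the exponent left after the
  union bound.\<close>

definition "level p = (2::real) powr (real p * (1 / q + \<epsilon>))"
definition "thresh p = (2::real) powr (real p * (1 / 2 - 1 / q - 4 * \<epsilon>))"
definition "depth p = nat \<lceil>real p * (1 / 2 + \<epsilon>)\<rceil>"
definition "gain = min (q * \<epsilon>) (margin / 20)"

lemma depth: "real p * (1 / 2 + \<epsilon>) \<le> real (depth p)" "real (depth p) \<le> real p * (1 / 2 + \<epsilon>) + 1"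
    "real (depth p) \<le> real p + 1"
proof -
  show "real p * (1 / 2 + \<epsilon>) \<le> real (depth p)" "real (depth p) \<le> real p * (1 / 2 + \<epsilon>) + 1"
  proof -
    have "0 \<le> real p * (1 / 2 + \<epsilon>)" using \<epsilon> by simp
    then show "real p * (1 / 2 + \<epsilon>) \<le> real (depth p)" "real (depth p) \<le> real p * (1 / 2 + \<epsilon>) + 1"
      unfolding depth_def by linarith+
  qed
  then show "real (depth p) \<le> real p + 1"
    using mult_left_mono[of "1 / 2 + \<epsilon>" 1 "real p"] \<epsilon> margin(2) by auto
qed

lemma two_powr_depth: "2 powr real (depth p) \<le> 2 * 2 powr (real p * (1 / 2 + \<epsilon>))"
proof -
  have "(2::real) powr real (depth p) \<le> 2 powr (real p * (1 / 2 + \<epsilon>) + 1)"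
    using depth by (intro powr_mono) auto
  then show ?thesis by (simp add: powr_add)
qed

lemma bad_event_dyadic_prob_le:
  "prob (bad_event (level p) (thresh p) (depth p) (2 ^ p)) \<le> (B + 4 * moment_bound_const) * ((real p + 2) * 2 powr (- (gain * real p)))"
proof -
  have K: "0 < level p" and T: "0 < thresh p" by (auto simp: level_def thresh_def)
  have N: "real (2 ^ p) = 2 powr real p" by (simp add: powr_realpow)
  have g: "gain \<le> q * \<epsilon>" "gain \<le> margin / 20" by (auto simp: gain_def)
  have "real (2 ^ p) * (B * level p powr (- q)) = B * 2 powr (real p * (- (q * \<epsilon>)))"
    unfolding N level_def powr_powr using q by (simp add: powr_add[symmetric] field_simps)
  also have "\<dots> \<le> B * 2 powr (- (gain * real p))"
    using g B_nonneg by (intro mult_left_mono powr_mono) (auto simp: mult.commute mult_left_mono)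
  also have "\<dots> \<le> B * ((real p + 2) * 2 powr (- (gain * real p)))"
    using B_nonneg by (intro mult_left_mono) (auto simp: mult_le_cancel_right1)
  finally have 1: "real (2 ^ p) * (B * level p powr (- q)) \<le> B * ((real p + 2) * 2 powr (- (gain * real p)))" .
  \<comment> \<open>Exponent of the clustered term. As \<open>8 / q = 1 - margin\<close>, it is at
    most \<open>- margin / 2 + 21 * \<epsilon>\<close>.\<close>
  have e1: "1 + 4 * (1 / q + \<epsilon>) + (1 / 2 + \<epsilon>) * margin - 4 * (1 / 2 - 1 / q - 4 * \<epsilon>) \<le> - gain"
  proof -
    have "\<epsilon> * margin \<le> \<epsilon>" using \<epsilon> margin by (simp add: mult_left_le)
    moreover have "(1 / 2 + \<epsilon>) * margin = margin / 2 + \<epsilon> * margin" by (simp add: algebra_simps)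
    moreover have "1 + 4 * (u + \<epsilon>) + (margin / 2 + z) - 4 * (1 / 2 - u - 4 * \<epsilon>) \<le> - gain"
      if "u = (1 - margin) / 8" "z \<le> \<epsilon>" for u z
      using that margin(1) \<epsilon> g(2) by (simp add: field_simps)
    ultimately show ?thesis using margin(5) by metis
  qed
  \<comment> \<open>Exponent of the paired term, at most
    \<open>- margin / 4 + 19 * \<epsilon>\<close>. With \<open>\<epsilon> \<le> margin / 100\<close>
    this is at most \<open>- 0.06 * margin\<close>, whence the \<open>margin / 20\<close> in
    \<open>gain\<close>.\<close>
  have e2: "1 + (1 / q + \<epsilon>) * (2 * margin) + (1 / 2 + \<epsilon>) - 4 * (1 / 2 - 1 / q - 4 * \<epsilon>) \<le> - gain"
  proof -
    have "\<epsilon> * margin \<le> \<epsilon>" using \<epsilon> margin by (simp add: mult_left_le)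
    moreover have "1 / q * margin \<le> 1 / 8 * margin" using q margin by (intro mult_right_mono) (auto simp: field_simps)
    moreover have "(1 / q + \<epsilon>) * (2 * margin) = 2 * (1 / q * margin) + 2 * (\<epsilon> * margin)" by (simp add: algebra_simps)
    moreover have "1 + (2 * w + 2 * z) + (1 / 2 + \<epsilon>) - 4 * (1 / 2 - u - 4 * \<epsilon>) \<le> - gain"
      if "u = (1 - margin) / 8" "w \<le> 1 / 8 * margin" "z \<le> \<epsilon>" for u w z
      using that margin(1) \<epsilon> g(2) by (simp add: field_simps)
    ultimately show ?thesis using margin(5) by metis
  qed
  have powr_collect: "2 powr x * (2 powr a * (2 * 2 powr b)) / 2 powr c = 2 * 2 powr (x + a + b - c)" for x a b c :: real
    by (simp add: powr_add powr_diff)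
  have t4: "thresh p ^ 4 = 2 powr (real p * (4 * (1 / 2 - 1 / q - 4 * \<epsilon>)))"
    by (simp add: thresh_def powr_power mult_ac)
  have k4: "level p ^ 4 = 2 powr (real p * (4 * (1 / q + \<epsilon>)))"
    by (simp add: level_def powr_power mult_ac)
  have "2 powr (real (depth p) * margin) \<le> 2 * 2 powr (real p * ((1 / 2 + \<epsilon>) * margin))"
  proof -
    have "real (depth p) * margin \<le> (real p * (1 / 2 + \<epsilon>) + 1) * margin"
      using depth(2) margin by (intro mult_right_mono) auto
    also have "\<dots> \<le> real p * ((1 / 2 + \<epsilon>) * margin) + 1" using margin by (simp add: algebra_simps)
    finally have "(2::real) powr (real (depth p) * margin) \<le> 2 powr (real p * ((1 / 2 + \<epsilon>) * margin) + 1)"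
      by (intro powr_mono) auto
    then show ?thesis by (simp add: powr_add)
  qed
  then have "real (2 ^ p) * (level p ^ 4 * 2 powr (real (depth p) * margin)) / thresh p ^ 4
     \<le> real (2 ^ p) * (level p ^ 4 * (2 * 2 powr (real p * ((1 / 2 + \<epsilon>) * margin)))) / thresh p ^ 4"
    using K T by (intro divide_right_mono mult_left_mono) auto
  also have "\<dots> = 2 * 2 powr (real p * (1 + 4 * (1 / q + \<epsilon>) + (1 / 2 + \<epsilon>) * margin - 4 * (1 / 2 - 1 / q - 4 * \<epsilon>)))"
    unfolding N t4 k4 powr_collect by (simp add: algebra_simps)
  also have "\<dots> \<le> 2 * 2 powr (real p * (- gain))"
    using e1 by (intro mult_left_mono powr_mono) auto
  finally have 2: "real (2 ^ p) * (level p ^ 4 * 2 powr (real (depth p) * margin)) / thresh p ^ 4 \<le> 2 * 2 powr (- (gain * real p))"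
    by (simp add: mult.commute)
  have "real (2 ^ p) * (level p powr (2 * margin) * 2 powr real (depth p)) / thresh p ^ 4
     \<le> real (2 ^ p) * (level p powr (2 * margin) * (2 * 2 powr (real p * (1 / 2 + \<epsilon>)))) / thresh p ^ 4"
    using K T two_powr_depth by (intro divide_right_mono mult_left_mono) auto
  also have "\<dots> = 2 * 2 powr (real p * (1 + (1 / q + \<epsilon>) * (2 * margin) + (1 / 2 + \<epsilon>) - 4 * (1 / 2 - 1 / q - 4 * \<epsilon>)))"
    unfolding N t4 level_def powr_powr powr_collect by (simp add: algebra_simps)
  also have "\<dots> \<le> 2 * 2 powr (real p * (- gain))"
    using e2 by (intro mult_left_mono powr_mono) auto
  finally have 3: "real (2 ^ p) * (level p powr (2 * margin) * 2 powr real (depth p)) / thresh p ^ 4 \<le> 2 * 2 powr (- (gain * real p))"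
    by (simp add: mult.commute)
  have "(real (depth p) + 1) * (real (2 ^ p) * moment_bound_const * (level p ^ 4 * 2 powr (real (depth p) * margin) + level p powr (2 * margin) * 2 powr real (depth p)) / thresh p ^ 4)
     = (real (depth p) + 1) * (moment_bound_const * (real (2 ^ p) * (level p ^ 4 * 2 powr (real (depth p) * margin)) / thresh p ^ 4
         + real (2 ^ p) * (level p powr (2 * margin) * 2 powr real (depth p)) / thresh p ^ 4))"
    using T by (simp add: field_simps)
  also have "\<dots> \<le> (real p + 2) * (moment_bound_const * (4 * 2 powr (- (gain * real p))))"
    using 2 3 depth(3)[of p] mconst_nonneg K T by (intro mult_mono mult_nonneg_nonneg) auto
  finally have 4: "(real (depth p) + 1) * (real (2 ^ p) * moment_bound_const * (level p ^ 4 * 2 powr (real (depth p) * margin) + level p powr (2 * margin) * 2 powr real (depth p)) / thresh p ^ 4)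
     \<le> 4 * moment_bound_const * ((real p + 2) * 2 powr (- (gain * real p)))" by (simp add: mult_ac)
  show ?thesis
    using bad_event_prob_le[OF K T, of "depth p" "2 ^ p"] 1 4 by (simp add: distrib_right)
qed

text \<open>Borel-Cantelli is applied only at the times \<open>2 ^ p\<close>, where the
  probabilities decay geometrically. A general \<open>N\<close> is handled by the next power of two,
  and the spare factors \<open>N powr \<epsilon>\<close> pay for the change of scale.\<close>

lemma AE_interval_sums:
  "AE \<omega> in M. \<forall>\<^sub>F N in sequentially.
     (\<forall>w<N. Y w \<omega> \<le> real N powr (1 / q + 2 * \<epsilon>)) \<and>
     (\<forall>a b. a \<le> b \<longrightarrow> b \<le> N \<longrightarrow> real (b - a) \<le> real N powr (1 / 2 + \<epsilon>) \<longrightarrow>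
        \<bar>\<Sum>i\<in>{a..<b}. (Y i \<omega> - e)\<bar> \<le> real N powr (1 / 2 - 1 / q - 3 * \<epsilon>))"
proof -
  let ?bad = "\<lambda>p. bad_event (level p) (thresh p) (depth p) (2 ^ p)"
  have g: "0 < gain" using \<epsilon> margin q by (simp add: gain_def)
  have "summable (\<lambda>p. prob (?bad p))"
  proof (rule summable_comparison_test_ev)
    have "\<forall>\<^sub>F p in sequentially. (real p + 2) * 2 powr (- (gain * real p)) \<le> 2 powr (- (gain / 2 * real p))"
      using g by real_asymp
    then show "\<forall>\<^sub>F p in sequentially. norm (prob (?bad p)) \<le> (B + 4 * moment_bound_const) * (2 powr (- (gain / 2))) ^ p"
    proof eventually_elim
      case (elim p)
      have "(B + 4 * moment_bound_const) * ((real p + 2) * 2 powr (- (gain * real p))) \<le> (B + 4 * moment_bound_const) * 2 powr (- (gain / 2 * real p))"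
        using elim B_nonneg mconst_nonneg by (intro mult_left_mono) auto
      moreover have "(2 powr (- (gain / 2))) ^ p = (2::real) powr (- (gain / 2 * real p))"
        by (simp add: powr_power mult.commute)
      ultimately show ?case using bad_event_dyadic_prob_le[of p] by simp
    qed
    have "(2::real) powr (- (gain / 2)) < 2 powr 0" using g by (intro powr_less_mono) auto
    then show "summable (\<lambda>p. (B + 4 * moment_bound_const) * (2 powr (- (gain / 2))) ^ p)"
      by (intro summable_mult summable_geometric) simp
  qed
  then have "AE \<omega> in M. \<forall>\<^sub>F p in sequentially. \<omega> \<in> space M - ?bad p"
    by (intro borel_cantelli_AE1) (auto simp: less_top[symmetric])
  then show ?thesis
  proof eventually_elim
    case (elim \<omega>)
    \<comment> \<open>Here \<open>2 * p + 3\<close> bounds the chaining factor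
      \<open>2 * depth p + 1\<close>, \<open>2 * B\<close> the truncation bias, and the leading 2
      the passage from \<open>2 ^ P\<close> to \<open>2 ^ (P - 1)\<close>. The second condition
      below does the same for \<open>level\<close>.\<close>
    have "\<forall>\<^sub>F p in sequentially. 2 * (2 * real p + 3 + 2 * B) \<le> 2 powr (\<epsilon> * real p)"
      using \<epsilon> by real_asymp
    moreover have "\<forall>\<^sub>F p in sequentially. 1 / q + 2 * \<epsilon> \<le> real p * \<epsilon>"
      using \<epsilon> by real_asymp
    ultimately have "\<forall>\<^sub>F p in sequentially. \<omega> \<in> space M - ?bad p \<and> 2 * (2 * real p + 3 + 2 * B) \<le> 2 powr (\<epsilon> * real p)
        \<and> 1 / q + 2 * \<epsilon> \<le> real p * \<epsilon>" using elim by eventually_elim auto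
    then obtain p0 where p0: "\<And>p. p0 \<le> p \<Longrightarrow> \<omega> \<in> space M - ?bad p \<and> 2 * (2 * real p + 3 + 2 * B) \<le> 2 powr (\<epsilon> * real p)
        \<and> 1 / q + 2 * \<epsilon> \<le> real p * \<epsilon>" by (auto simp: eventually_sequentially)
    show ?case unfolding eventually_sequentially
    proof (intro exI allI impI)
      fix N :: nat assume N: "2 ^ Suc p0 \<le> N"
      obtain p where p: "2 ^ p \<le> N" "N < 2 ^ Suc p"
      proof -
        have "1 \<le> N" using order_trans[OF one_le_power[of 2 "Suc p0"] N] by simp
        then show ?thesis using ex_power_ivl1[of 2 N] that by auto
      qed
      \<comment> \<open>Now \<open>2 ^ (P - 1) \<le> N < 2 ^ P\<close>: the upper bound puts
        \<open>N\<close> inside the event at scale \<open>P\<close>, the lower one turns powers of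
        \<open>2 ^ P\<close> into powers of \<open>N\<close>.\<close>
      define P where "P = Suc p"
      have "p0 \<le> P"
      proof (rule ccontr)
        assume "\<not> p0 \<le> P"
        then have "(2::nat) ^ Suc p \<le> 2 ^ Suc p0" unfolding P_def by (intro power_increasing) auto
        then show False using N p by linarith
      qed
      note E = p0[OF this]
      have NP: "2 powr (real P - 1) \<le> real N" "N \<le> 2 ^ P" "real N \<le> 2 powr real P"
      proof -
        show "2 powr (real P - 1) \<le> real N"
          using of_nat_mono[OF p(1), where 'a=real] by (simp add: P_def powr_realpow)
        show "N \<le> 2 ^ P" using p(2) by (simp add: P_def)
        then show "real N \<le> 2 powr real P" using of_nat_mono[of N "2 ^ P", where 'a=real] by (simp add: powr_realpow)
      qed
      have K: "0 < level P" and T: "0 < thresh P" by (auto simp: level_def thresh_def)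
      have w: "\<omega> \<in> space M" "\<omega> \<notin> ?bad P" using E by auto
      have lev: "level P \<le> real N powr (1 / q + 2 * \<epsilon>)"
      proof -
        have "level P \<le> 2 powr ((real P - 1) * (1 / q + 2 * \<epsilon>))"
          unfolding level_def using E by (intro powr_mono) (auto simp: algebra_simps)
        also have "\<dots> = (2 powr (real P - 1)) powr (1 / q + 2 * \<epsilon>)" by (simp add: powr_powr)
        also have "\<dots> \<le> real N powr (1 / q + 2 * \<epsilon>)"
          using NP(1) \<epsilon> q by (intro powr_mono2) auto
        finally show ?thesis .
      qed
      define s where "s = 1 / 2 - 1 / q - 4 * \<epsilon>"
      have q8: "1 / q \<le> 1 / 8" using q by (simp add: field_simps)
      have "0 < 1 / q" using q by simp
      then have s: "0 \<le> s" "s + \<epsilon> \<le> 1" using q8 \<epsilon> margin(2) unfolding s_def by linarith+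
      have tot: "(2 * real (depth P) + 1) * thresh P + 2 ^ depth P * (level P powr (1 - q) * B) \<le> real N powr (1 / 2 - 1 / q - 3 * \<epsilon>)"
      proof -
        have "2 ^ depth P * (level P powr (1 - q) * B) \<le> (2 * 2 powr (real P * (1 / 2 + \<epsilon>))) * (level P powr (1 - q) * B)"
          using two_powr_depth[of P] B_nonneg by (intro mult_right_mono) (auto simp: powr_realpow)
        also have "\<dots> = 2 * B * 2 powr (real P * (1 / 2 + \<epsilon>) + real P * (1 / q + \<epsilon>) * (1 - q))"
          unfolding level_def powr_powr by (simp add: powr_add)
        also have "\<dots> \<le> 2 * B * 2 powr (real P * s)"
        proof -
          have "1 / 2 + \<epsilon> + (1 / q + \<epsilon>) * (1 - q) = - 1 / 2 + 2 * \<epsilon> + 1 / q - \<epsilon> * q"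
            using q by (simp add: field_simps)
          also have "\<dots> \<le> s" using q8 \<epsilon> q margin(2) mult_pos_pos[of \<epsilon> q] unfolding s_def by linarith
          finally have "real P * (1 / 2 + \<epsilon> + (1 / q + \<epsilon>) * (1 - q)) \<le> real P * s" by (intro mult_left_mono) auto
          then show ?thesis using B_nonneg by (intro mult_left_mono powr_mono) (auto simp: algebra_simps)
        qed
        finally have tail: "2 ^ depth P * (level P powr (1 - q) * B) \<le> 2 * B * 2 powr (real P * s)" .
        have "(2 * real (depth P) + 1) * thresh P + 2 ^ depth P * (level P powr (1 - q) * B)
           \<le> (2 * real P + 3) * 2 powr (real P * s) + 2 * B * 2 powr (real P * s)"
        proof (rule add_mono[OF _ tail])
          have "2 * real (depth P) + 1 \<le> 2 * real P + 3" using depth(3)[of P] by linarith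
          then show "(2 * real (depth P) + 1) * thresh P \<le> (2 * real P + 3) * 2 powr (real P * s)"
            unfolding thresh_def s_def by (intro mult_right_mono) auto
        qed
        also have "\<dots> = (2 * (2 * real P + 3 + 2 * B)) * 2 powr (real P * s - 1)"
          by (simp add: algebra_simps powr_diff)
        also have "\<dots> \<le> 2 powr (\<epsilon> * real P) * 2 powr (real P * s - 1)"
          using E by (intro mult_right_mono) auto
        also have "\<dots> = 2 powr (real P * (s + \<epsilon>) - 1)" by (simp add: powr_add[symmetric] algebra_simps)
        also have "\<dots> \<le> 2 powr ((real P - 1) * (s + \<epsilon>))" using s by (intro powr_mono) (auto simp: algebra_simps)
        also have "\<dots> = (2 powr (real P - 1)) powr (s + \<epsilon>)" by (simp add: powr_powr)
        also have "\<dots> \<le> real N powr (s + \<epsilon>)" using NP(1) s \<epsilon> by (intro powr_mono2) auto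
        finally show ?thesis by (simp add: s_def)
      qed
      show "(\<forall>w<N. Y w \<omega> \<le> real N powr (1 / q + 2 * \<epsilon>)) \<and>
         (\<forall>a b. a \<le> b \<longrightarrow> b \<le> N \<longrightarrow> real (b - a) \<le> real N powr (1 / 2 + \<epsilon>) \<longrightarrow>
        \<bar>\<Sum>i\<in>{a..<b}. (Y i \<omega> - e)\<bar> \<le> real N powr (1 / 2 - 1 / q - 3 * \<epsilon>))"
      proof (intro conjI allI impI)
        fix w assume "w < N"
        then show "Y w \<omega> \<le> real N powr (1 / q + 2 * \<epsilon>)"
          using not_bad_event(1)[OF K T w, of w] NP(2) lev by simp
      next
        fix a b :: nat assume ab: "a \<le> b" "b \<le> N" "real (b - a) \<le> real N powr (1 / 2 + \<epsilon>)"
        have "real N powr (1 / 2 + \<epsilon>) \<le> (2 powr real P) powr (1 / 2 + \<epsilon>)"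
          using NP \<epsilon> by (intro powr_mono2) auto
        also have "\<dots> \<le> 2 powr real (depth P)" using depth(1)[of P] by (simp add: powr_powr)
        finally have "real (b - a) \<le> 2 powr real (depth P)" using ab(3) by (rule order_trans[rotated])
        then have "b - a \<le> 2 ^ depth P" using of_nat_le_iff[of "b - a" "2 ^ depth P", where 'a=real] by (simp add: powr_realpow)
        then have "b \<le> a + 2 ^ depth P" by linarith
        then show "\<bar>\<Sum>i\<in>{a..<b}. (Y i \<omega> - e)\<bar> \<le> real N powr (1 / 2 - 1 / q - 3 * \<epsilon>)"
          using not_bad_event(2)[OF K T w, of a b] ab NP(2) tot by simp
      qed
    qed
  qed
qed

end
end

section \<open>Holding times\<close>

lemma pmf_expectation_sums:
  fixes p :: "nat pmf" and f :: "nat \<Rightarrow> 'b::{banach, second_countable_topology}"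
  assumes "integrable (measure_pmf p) f"
  shows "(\<lambda>k. pmf p k *\<^sub>R f k) sums measure_pmf.expectation p f"
proof -
  have e: "measure_pmf p = density (count_space UNIV) (\<lambda>k. ennreal (pmf p k))" by (rule measure_pmf_eq_density)
  have "integrable (count_space UNIV) (\<lambda>k. pmf p k *\<^sub>R f k)"
    using assms unfolding e by (subst (asm) integrable_density) auto
  moreover have "measure_pmf.expectation p f = (\<integral>k. pmf p k *\<^sub>R f k \<partial>count_space UNIV)"
    unfolding e by (rule integral_density) auto
  ultimately show ?thesis using sums_integral_count_space_nat by metis
qed

text \<open>The law of the time spent at a site with environment \<open>a\<close>: it exceeds \<open>j\<close> with probability \<open>a j\<close>.\<close>

definition hold :: "(nat \<Rightarrow> real) \<Rightarrow> nat pmf" where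
  "hold a = embed_pmf (\<lambda>k. if k = 0 then 0 else a (k - 1) - a k)"

context
  fixes a :: "nat \<Rightarrow> real"
  assumes a: "a \<in> Omega0"
begin

lemma Omega0_props: "0 < a n" "a n \<le> 1" "a 0 = 1" "a (Suc n) < a n" "a \<longlonglongrightarrow> 0"
  using a by (auto simp: Omega0_def)

lemma hold_mass_sums: "(\<lambda>k. if k = 0 then 0 else a (k - 1) - a k) sums 1"
proof -
  have "(\<lambda>k. a k - a (Suc k)) sums (a 0 - 0)" by (rule telescope_sums'[OF Omega0_props(5)])
  then have "(\<lambda>k. (\<lambda>k. if k = 0 then 0 else a (k - 1) - a k) (Suc k)) sums 1" by (simp add: Omega0_props(3))
  then show ?thesis by (subst (asm) sums_Suc_iff) simp
qed

lemma pmf_hold: "pmf (hold a) k = (if k = 0 then 0 else a (k - 1) - a k)"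
  unfolding hold_def
proof (rule pmf_embed_pmf)
  let ?f = "\<lambda>k. if k = 0 then 0 else a (k - 1) - a k"
  show nn: "0 \<le> ?f k" for k using Omega0_props(4)[of "k - 1"] by auto
  show "(\<integral>\<^sup>+ k. ennreal (?f k) \<partial>count_space UNIV) = 1"
    using hold_mass_sums nn by (simp only: nn_integral_count_space_nat suminf_ennreal2 sums_summable sums_unique[symmetric]) simp
qed

lemma pmf_hold_Suc: "pmf (hold a) (Suc k) = a k - a (Suc k)"
  by (simp add: pmf_hold)

lemma prob_hold_greater: "measure_pmf.prob (hold a) {k. j < k} = a j"
proof -
  have "measure_pmf.prob (hold a) {..j} = (\<Sum>k\<in>{..j}. pmf (hold a) k)"
    by (rule measure_measure_pmf_finite) simp
  also have "\<dots> = 1 - a j"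
    by (induction j) (simp_all add: pmf_hold Omega0_props(3))
  finally have "measure_pmf.prob (hold a) (UNIV - {..j}) = a j"
    using measure_pmf.prob_compl[of "{..j}" "hold a"] by simp
  moreover have "UNIV - {..j} = {k. j < k}" by auto
  ultimately show ?thesis by simp
qed

text \<open>Tonelli: \<open>\<Sum>j<k. c j\<close> sums \<open>c j\<close> over the \<open>j\<close>
  with \<open>k > j\<close>, an event of probability \<open>a j\<close>. With \<open>c\<close> equal
  to 1, \<open>2 * j + 1\<close> or \<open>(j + 1) powr (1 + \<delta>)\<close> this turns series in
  \<open>a\<close> into moments of \<open>hold a\<close>.\<close>

lemma expectation_hold_tail:
  fixes c :: "nat \<Rightarrow> real"
  assumes c: "\<And>j. 0 \<le> c j" and s: "summable (\<lambda>j. c j * a j)"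
  shows "integrable (hold a) (\<lambda>k. \<Sum>j<k. c j)"
    and "measure_pmf.expectation (hold a) (\<lambda>k. \<Sum>j<k. c j) = (\<Sum>j. c j * a j)"
proof -
  have "(\<integral>\<^sup>+k. ennreal (\<Sum>j<k. c j) \<partial>hold a) = (\<integral>\<^sup>+k. (\<Sum>j. ennreal (c j) * indicator {k. j < k} k) \<partial>hold a)"
  proof (rule nn_integral_cong)
    fix k
    have "(\<Sum>j. ennreal (c j) * indicator {k. j < k} k) = (\<Sum>j<k. ennreal (c j) * indicator {k. j < k} k)"
      by (rule suminf_finite) auto
    also have "\<dots> = ennreal (\<Sum>j<k. c j)" using c by (simp add: sum_ennreal)
    finally show "ennreal (\<Sum>j<k. c j) = (\<Sum>j. ennreal (c j) * indicator {k. j < k} k)" by simp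
  qed
  also have "\<dots> = (\<Sum>j. ennreal (c j) * emeasure (hold a) {k. j < k})"
    by (subst nn_integral_suminf) (auto simp: nn_integral_cmult_indicator)
  also have "\<dots> = (\<Sum>j. ennreal (c j * a j))"
    using c Omega0_props(1) by (simp add: measure_pmf.emeasure_eq_measure prob_hold_greater ennreal_mult' less_imp_le)
  also have "\<dots> = ennreal (\<Sum>j. c j * a j)"
    using c Omega0_props(1) by (intro suminf_ennreal2 s) (simp add: less_imp_le)
  finally have "(\<integral>\<^sup>+k. ennreal (\<Sum>j<k. c j) \<partial>hold a) = ennreal (\<Sum>j. c j * a j)" .
  then have "integrable (hold a) (\<lambda>k. \<Sum>j<k. c j) \<and> measure_pmf.expectation (hold a) (\<lambda>k. \<Sum>j<k. c j) = (\<Sum>j. c j * a j)"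
    by (subst (asm) nn_integral_eq_integrable)
      (use c Omega0_props(1) in \<open>auto intro!: sum_nonneg suminf_nonneg s simp: less_imp_le\<close>)
  then show "integrable (hold a) (\<lambda>k. \<Sum>j<k. c j)"
    and "measure_pmf.expectation (hold a) (\<lambda>k. \<Sum>j<k. c j) = (\<Sum>j. c j * a j)" by auto
qed

lemma AE_hold_pos: "AE k in hold a. 1 \<le> k"
  by (auto simp: AE_measure_pmf_iff set_pmf_iff pmf_hold split: if_splits)

end

section \<open>Elementary estimates with remainders of order \<open>2 + \<delta>\<close>\<close>

lemma power_sum_diff_le:
  fixes p :: real
  assumes "1 \<le> p"
  shows "real k powr p \<le> p * (\<Sum>j<k. (real j + 1) powr (p - 1))"
proof (induction k)
  case (Suc k)
  have "(real k + 1) powr p - real k powr p \<le> p * (real k + 1) powr (p - 1)"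
  proof (cases "k = 0")
    case True then show ?thesis using assms by simp
  next
    case False
    have "\<exists>z. real k < z \<and> z < real k + 1 \<and> (real k + 1) powr p - real k powr p = (real k + 1 - real k) * (p * z powr (p - 1))"
    proof (rule MVT2)
      fix x assume "real k \<le> x"
      then have "0 < x" using False by linarith
      then show "((\<lambda>x. x powr p) has_real_derivative p * x powr (p - 1)) (at x)"
        by (auto intro!: derivative_eq_intros)
    qed simp
    then obtain z where z: "real k < z" "z < real k + 1" "(real k + 1) powr p - real k powr p = p * z powr (p - 1)" by auto
    have "z powr (p - 1) \<le> (real k + 1) powr (p - 1)" using z assms by (intro powr_mono2) auto
    then show ?thesis unfolding z(3) using assms by (intro mult_left_mono) auto
  qed
  then show ?case using Suc by (simp add: algebra_simps)
qed simp

text \<open>Interpolates between the cubic Taylor remainder for \<open>\<bar>x\<bar> \<le> 1\<close>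
  and the quadratic one beyond, so that a moment of order \<open>2 + \<delta>\<close> suffices in
  place of a third moment.\<close>

lemma cis_approx_powr:
  assumes "0 \<le> \<delta>" "\<delta> \<le> 1"
  shows "cmod (cis x - (1 + \<i> * of_real x - of_real (x\<^sup>2 / 2))) \<le> \<bar>x\<bar> powr (2 + \<delta>)"
proof -
  have e: "(\<Sum>k\<le>2. (\<i> * of_real x) ^ k / fact k) = 1 + \<i> * of_real x - of_real (x\<^sup>2 / 2)"
    by (simp add: eval_nat_numeral field_simps complex_eq_iff)
  have c: "cis x = iexp x" by (simp add: cis_conv_exp mult.commute)
  show ?thesis
  proof (cases "\<bar>x\<bar> \<le> 1")
    case True
    have "cmod (cis x - (1 + \<i> * of_real x - of_real (x\<^sup>2 / 2))) \<le> \<bar>x\<bar> ^ 3 / 6"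
      using iexp_approx1[of x 2] unfolding e c by (simp add: eval_nat_numeral fact_numeral)
    also have "\<dots> \<le> \<bar>x\<bar> powr 3" by (cases "x = 0") (auto simp: powr_numeral)
    also have "\<dots> \<le> \<bar>x\<bar> powr (2 + \<delta>)"
      using assms True by (intro powr_mono') auto
    finally show ?thesis .
  next
    case False
    have "cmod (cis x - (1 + \<i> * of_real x - of_real (x\<^sup>2 / 2))) \<le> \<bar>x\<bar> ^ 2"
      using iexp_approx2[of x 2] unfolding e c by simp
    also have "\<dots> = \<bar>x\<bar> powr 2" using False by (simp add: powr_numeral)
    also have "\<dots> \<le> \<bar>x\<bar> powr (2 + \<delta>)"
      using assms False by (intro powr_mono) auto
    finally show ?thesis .
  qed
qed

lemma one_minus_cos_ge:
  assumes "\<bar>t\<bar> \<le> pi"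
  shows "t\<^sup>2 / 12 \<le> 1 - cos t"
proof -
  have e: "(\<Sum>k\<le>3. (\<i> * of_real t) ^ k / fact k) = 1 - of_real (t\<^sup>2 / 2) + \<i> * of_real (t - t ^ 3 / 6)"
    by (simp add: eval_nat_numeral field_simps complex_eq_iff)
  then have "cmod (cis t - (1 - of_real (t\<^sup>2 / 2) + \<i> * of_real (t - t ^ 3 / 6))) \<le> \<bar>t\<bar> ^ 4 / 24"
    using iexp_approx1[of t 3] unfolding e by (simp add: cis_conv_exp mult.commute fact_numeral)
  then have "\<bar>Re (cis t - (1 - of_real (t\<^sup>2 / 2) + \<i> * of_real (t - t ^ 3 / 6)))\<bar> \<le> \<bar>t\<bar> ^ 4 / 24"
    using abs_Re_le_cmod order_trans by blast
  then have "\<bar>cos t - (1 - t\<^sup>2 / 2)\<bar> \<le> t ^ 4 / 24" by simp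
  then have 1: "cos t \<le> 1 - t\<^sup>2 / 2 + t ^ 4 / 24" unfolding abs_le_iff by linarith
  \<comment> \<open>From \<open>t\<^sup>2 \<le> 10\<close> the quartic term is at most
    \<open>10 / 24\<close> of \<open>t\<^sup>2\<close>, and
    \<open>1 / 2 - 10 / 24 = 1 / 12\<close>.\<close>
  have "pi\<^sup>2 \<le> (3.15::real)\<^sup>2" using pi_approx by (intro power_mono) auto
  then have "t\<^sup>2 \<le> 10" using assms power_mono[of "\<bar>t\<bar>" pi 2] by (simp add: power2_eq_square)
  then have "t\<^sup>2 * t\<^sup>2 \<le> 10 * t\<^sup>2" by (intro mult_right_mono) auto
  then show ?thesis using 1 by (simp add: power2_eq_square power4_eq_xxxx)
qed

lemma exp_minus_approx_powr:
  fixes u \<delta> :: real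
  assumes "0 \<le> u" "0 \<le> \<delta>" "\<delta> \<le> 1"
  shows "\<bar>exp (- u) - (1 - u)\<bar> \<le> u powr (1 + \<delta> / 2)"
proof -
  have l: "1 - u \<le> exp (- u)" using exp_ge_add_one_self[of "- u"] by simp
  show ?thesis
  proof (cases "u \<le> 1")
    case True
    have "exp (- u) \<le> 1 - u + u\<^sup>2"
    proof -
      have "exp (- u) = 1 / exp u" by (simp add: exp_minus inverse_eq_divide)
      also have "\<dots> \<le> 1 / (1 + u)"
        using assms exp_ge_add_one_self[of u] by (intro divide_left_mono) auto
      also have "\<dots> \<le> 1 - u + u\<^sup>2"
      proof -
        have "1 \<le> (1 - u + u\<^sup>2) * (1 + u)" using assms by (simp add: power2_eq_square algebra_simps)
        then show ?thesis using assms by (simp add: divide_simps)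
      qed
      finally show ?thesis .
    qed
    then have "\<bar>exp (- u) - (1 - u)\<bar> \<le> u powr 2" using l assms by simp
    also have "\<dots> \<le> u powr (1 + \<delta> / 2)" using True assms by (intro powr_mono') auto
    finally show ?thesis .
  next
    case False
    have "exp (- u) \<le> 1" using assms by simp
    then have "\<bar>exp (- u) - (1 - u)\<bar> \<le> u powr 1" using l False by simp
    also have "\<dots> \<le> u powr (1 + \<delta> / 2)" using False assms by (intro powr_mono) auto
    finally show ?thesis .
  qed
qed

section \<open>Characteristic function and moments of a holding time\<close>

definition cf :: "nat pmf \<Rightarrow> real \<Rightarrow> complex" where
  "cf p t = measure_pmf.expectation p (\<lambda>k. cis (t * real k))"

lemma integrable_pmf_cis: "integrable (measure_pmf p) (\<lambda>k. cis (f k))"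
  by (rule measure_pmf.integrable_const_bound[where B=1]) auto

text \<open>Up to a constant factor, the moment of order \<open>2 + \<delta>\<close> of
  \<open>hold a\<close>, in tail form. Like the definitions that follow, it is a functional of the
  environment sequence alone, so its values along the orbit are stationary and mixing.\<close>

definition hold_moment :: "real \<Rightarrow> (nat \<Rightarrow> real) \<Rightarrow> real" where
  "hold_moment \<delta> a = (\<Sum>n. (real n + 1) powr (1 + \<delta>) * a n)"

definition hold_mean :: "(nat \<Rightarrow> real) \<Rightarrow> real" where "hold_mean a = (\<Sum>n. a n)"

definition hold_second :: "(nat \<Rightarrow> real) \<Rightarrow> real" where
  "hold_second a = (\<Sum>n. (2 * real n + 1) * a n)"

definition hold_var :: "(nat \<Rightarrow> real) \<Rightarrow> real" where
  "hold_var a = hold_second a - (hold_mean a)\<^sup>2"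

text \<open>The product of the masses of \<open>hold a\<close> at 1 and 2. As these points are adjacent, it controls the
  characteristic function on all of \<open>{-pi..pi}\<close>.\<close>

definition hold_gap :: "(nat \<Rightarrow> real) \<Rightarrow> real" where
  "hold_gap a = (1 - a 1) * (a 1 - a 2)"

lemma square_powr: "0 \<le> x \<Longrightarrow> (x\<^sup>2) powr (1 + \<delta> / 2) = x powr (2 + \<delta>)" for x :: real
proof (cases "x = 0")
  case False assume "0 \<le> x"
  then have "x\<^sup>2 = x powr 2" using False by (simp add: powr_numeral)
  then show ?thesis by (simp only: powr_powr) (simp add: algebra_simps)
qed simp

lemma Omega0_head_props:
  assumes "a \<in> Omega0"
  shows "a 1 < 1" "a 2 < a 1" "0 < a 2"
  using Omega0_props(4)[OF assms, of 0] Omega0_props(4)[OF assms, of 1] Omega0_props(1)[OF assms, of 2]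
  by (auto simp: Omega0_props(3)[OF assms] eval_nat_numeral)

context
  fixes a :: "nat \<Rightarrow> real"
  assumes a: "a \<in> Omega0"
begin

lemma hold_gap_bounds: "0 < hold_gap a" "hold_gap a \<le> 1"
proof -
  have "0 < 1 - a 1" "0 < a 1 - a 2" "1 - a 1 \<le> 1" "a 1 - a 2 \<le> 1"
    using Omega0_head_props[OF a] by auto
  then show "0 < hold_gap a" "hold_gap a \<le> 1" unfolding hold_gap_def by (auto intro: mult_le_one)
qed

text \<open>The masses \<open>b\<close> at 1 and \<open>c\<close> at 2 contribute modulus
  \<open>\<bar>b + c * cis t\<bar>\<close>, smaller than \<open>b + c\<close> by at least
  \<open>b * c * (1 - cos t)\<close>; all other atoms contribute at most their total mass
  \<open>1 - b - c\<close>.\<close>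

lemma hold_cf_le:
  assumes t: "\<bar>t\<bar> \<le> pi"
  shows "cmod (cf (hold a) t) \<le> exp (- hold_gap a * t\<^sup>2 / 12)"
proof -
  define b c where "b = 1 - a 1" and "c = a 1 - a 2"
  have b: "0 < b" and c: "0 < c" and bc: "b + c \<le> 1"
    using Omega0_head_props[OF a] by (auto simp: b_def c_def)
  have p1: "pmf (hold a) 1 = b" and p2: "pmf (hold a) 2 = c"
    by (auto simp: pmf_hold[OF a] b_def c_def Omega0_props(3)[OF a])
  let ?i = "\<lambda>j k. indicator {j::nat} k :: real"
  have i1: "measure_pmf.expectation (hold a) (\<lambda>k. ?i j k *\<^sub>R z) = pmf (hold a) j *\<^sub>R z" for j and z :: complex
    by (subst integral_scaleR_left) (simp_all add: measure_pmf_single less_top[symmetric])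
  have int: "integrable (hold a) (\<lambda>k. ?i j k *\<^sub>R z)" for j and z :: complex
    by (rule measure_pmf.integrable_const_bound[where B="cmod z"]) (auto simp: indicator_def)
  let ?r = "\<lambda>k. indicator (- {1, 2}) k *\<^sub>R cis (t * real k)"
  have intr: "integrable (hold a) ?r"
    by (rule measure_pmf.integrable_const_bound[where B=1]) (auto simp: indicator_def)
  have "cf (hold a) t = measure_pmf.expectation (hold a) (\<lambda>k. ?i 1 k *\<^sub>R cis t + ?i 2 k *\<^sub>R cis (2 * t) + ?r k)"
    unfolding cf_def by (rule Bochner_Integration.integral_cong) (auto simp: indicator_def mult.commute)
  also have "\<dots> = b *\<^sub>R cis t + c *\<^sub>R cis (2 * t) + measure_pmf.expectation (hold a) ?r"
    using int[of 1 "cis t"] int[of 2 "cis (2 * t)"] intr i1[of 1 "cis t"] i1[of 2 "cis (2 * t)"] p1 p2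
    by (simp add: Bochner_Integration.integral_add)
  finally have e: "cf (hold a) t = b *\<^sub>R cis t + c *\<^sub>R cis (2 * t) + measure_pmf.expectation (hold a) ?r" .
  have "cmod (measure_pmf.expectation (hold a) ?r) \<le> measure_pmf.expectation (hold a) (\<lambda>k. cmod (?r k))"
    by (rule integral_norm_bound)
  also have "\<dots> = measure_pmf.expectation (hold a) (indicator (- {1, 2}))"
    by (rule Bochner_Integration.integral_cong) (auto simp: indicator_def)
  also have "\<dots> = measure_pmf.prob (hold a) (- {1, 2})" by simp
  also have "\<dots> = 1 - measure_pmf.prob (hold a) {1, 2}"
    using measure_pmf.prob_compl[of "{1,2}" "hold a"] by (simp add: Compl_eq_Diff_UNIV)
  also have "measure_pmf.prob (hold a) {1, 2} = b + c"
    by (subst measure_measure_pmf_finite) (auto simp: p1[simplified] p2)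
  finally have r: "cmod (measure_pmf.expectation (hold a) ?r) \<le> 1 - (b + c)" .
  define s where "s = 1 - cos t"
  have s: "0 \<le> s" "s \<le> 2" using cos_ge_minus_one[of t] by (auto simp: s_def)
  have "b *\<^sub>R cis t + c *\<^sub>R cis (2 * t) = cis t * (of_real b + of_real c * cis t)"
    by (simp add: cis_mult algebra_simps scaleR_conv_of_real)
  then have n: "cmod (b *\<^sub>R cis t + c *\<^sub>R cis (2 * t)) = cmod (of_real b + of_real c * cis t)" by (simp add: norm_mult)
  have "(cmod (of_real b + of_real c * cis t))\<^sup>2 = (b + c * cos t)\<^sup>2 + (c * sin t)\<^sup>2"
    by (simp add: cmod_power2)
  also have "\<dots> = (b + c)\<^sup>2 - 2 * (b * c * s)"
    using sin_cos_squared_add[of t] unfolding s_def by algebra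
  \<comment> \<open>Completing the square yields the cross term
    \<open>2 * (b + c) * (b * c * s)\<close>, which \<open>b + c \<le> 1\<close> bounds by the term
    at hand.\<close>
  also have "\<dots> \<le> ((b + c) - b * c * s)\<^sup>2"
  proof -
    have "(b + c) * (b * c * s) \<le> 1 * (b * c * s)" using b c s bc by (intro mult_right_mono) auto
    moreover have "((b + c) - b * c * s)\<^sup>2 = (b + c)\<^sup>2 - 2 * ((b + c) * (b * c * s)) + (b * c * s)\<^sup>2"
      by (simp add: power2_eq_square algebra_simps)
    ultimately show ?thesis using zero_le_power2[of "b * c * s"] by linarith
  qed
  finally have "(cmod (of_real b + of_real c * cis t))\<^sup>2 \<le> ((b + c) - b * c * s)\<^sup>2" .
  moreover have "0 \<le> (b + c) - b * c * s"
  proof -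
    have "b * c \<le> b * 1" "b * c \<le> 1 * c" using b c bc by (intro mult_left_mono mult_right_mono; simp)+
    then have "2 * (b * c) \<le> b + c" by linarith
    moreover have "b * c * s \<le> b * c * 2" using b c s by (intro mult_left_mono) auto
    ultimately show ?thesis by simp
  qed
  ultimately have "cmod (of_real b + of_real c * cis t) \<le> (b + c) - b * c * s"
    by (rule power2_le_imp_le)
  then have "cmod (cf (hold a) t) \<le> 1 - b * c * s"
    unfolding e using n r norm_triangle_ineq[of "b *\<^sub>R cis t + c *\<^sub>R cis (2 * t)" "measure_pmf.expectation (hold a) ?r"] by linarith
  also have "\<dots> \<le> exp (- (b * c * s))" using exp_ge_add_one_self[of "- (b * c * s)"] by simp
  also have "\<dots> \<le> exp (- hold_gap a * t\<^sup>2 / 12)"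
  proof -
    have "b * c * (t\<^sup>2 / 12) \<le> b * c * s"
      using one_minus_cos_ge[OF t] b c unfolding s_def by (intro mult_left_mono) auto
    then show ?thesis by (simp add: hold_gap_def b_def c_def)
  qed
  finally show ?thesis .
qed

context
  assumes sq: "summable (\<lambda>n. (2 * real n + 1) * a n)"
begin

lemma summable_hold: "summable a"
proof (rule summable_comparison_test'[OF sq, of 0])
  fix n
  have "1 * a n \<le> (2 * real n + 1) * a n" using Omega0_props(1)[OF a, of n] by (intro mult_right_mono) auto
  then show "norm (a n) \<le> (2 * real n + 1) * a n" using Omega0_props(1)[OF a, of n] by simp
qed

lemma integrable_hold: "integrable (hold a) real"
  and expectation_hold: "measure_pmf.expectation (hold a) real = hold_mean a"
  using expectation_hold_tail[OF a, of "\<lambda>_. 1"] summable_hold by (auto simp: hold_mean_def)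

lemma sum_odd_real: "(\<Sum>j<k. 2 * real j + 1) = (real k)\<^sup>2"
  by (induction k) (auto simp: power2_eq_square algebra_simps)

lemma integrable_hold_sq: "integrable (hold a) (\<lambda>k. (real k)\<^sup>2)"
  and expectation_hold_sq: "measure_pmf.expectation (hold a) (\<lambda>k. (real k)\<^sup>2) = hold_second a"
  using expectation_hold_tail[OF a, of "\<lambda>j. 2 * real j + 1"] sq unfolding sum_odd_real by (auto simp: hold_second_def)

lemma variance_hold:
  "integrable (hold a) (\<lambda>k. (real k - hold_mean a)\<^sup>2)"
  "measure_pmf.expectation (hold a) (\<lambda>k. (real k - hold_mean a)\<^sup>2) = hold_var a"
proof -
  show "measure_pmf.expectation (hold a) (\<lambda>k. (real k - hold_mean a)\<^sup>2) = hold_var a"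
    using measure_pmf.variance_eq[OF integrable_hold integrable_hold_sq] expectation_hold expectation_hold_sq
    by (simp add: hold_var_def)
  show "integrable (hold a) (\<lambda>k. (real k - hold_mean a)\<^sup>2)"
    unfolding power2_diff using integrable_hold integrable_hold_sq by simp
qed

text \<open>The variance is at least the part carried by 1 and 2, whose minimum over all centres
  \<open>m\<close> is \<open>b * c / (b + c)\<close>. Consequently the matching Gaussian decays at
  least as fast as the bound for the characteristic function.\<close>

lemma hold_gap_le_var: "hold_gap a \<le> hold_var a"
proof -
  define b c where "b = 1 - a 1" and "c = a 1 - a 2"
  have b: "0 < b" and c: "0 < c" and bc: "b + c \<le> 1"
    using Omega0_head_props[OF a] by (auto simp: b_def c_def)
  define m where "m = hold_mean a"
  have p1: "pmf (hold a) 1 = b" and p2: "pmf (hold a) 2 = c"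
    by (auto simp: pmf_hold[OF a] b_def c_def Omega0_props(3)[OF a])
  have "b * c * (b + c) \<le> b * c * 1" using b c bc by (intro mult_left_mono) auto
  then have "b * c \<le> (b * c) / (b + c)" using b c by (simp add: le_divide_eq)
  also have "\<dots> \<le> b * (1 - m)\<^sup>2 + c * (2 - m)\<^sup>2"
  proof -
    \<comment> \<open>Lagrange's identity behind the Cauchy-Schwarz inequality; the square on the
      right vanishes at the centre of mass of the two atoms.\<close>
    have "(b * (1 - m)\<^sup>2 + c * (2 - m)\<^sup>2) * (b + c) - b * c = (b * (m - 1) - c * (2 - m))\<^sup>2"
      by algebra
    then have "b * c \<le> (b * (1 - m)\<^sup>2 + c * (2 - m)\<^sup>2) * (b + c)"
      using zero_le_power2[of "b * (m - 1) - c * (2 - m)"] by linarith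
    then show ?thesis using b c by (simp add: divide_le_eq)
  qed
  also have "\<dots> = measure_pmf.expectation (hold a) (\<lambda>k. indicator {1} k * (1 - m)\<^sup>2 + indicator {2} k * (2 - m)\<^sup>2)"
    by (subst Bochner_Integration.integral_add) (simp_all add: measure_pmf_single p1[simplified] p2 less_top[symmetric])
  also have "\<dots> \<le> measure_pmf.expectation (hold a) (\<lambda>k. (real k - m)\<^sup>2)"
  proof (rule integral_mono)
    show "integrable (hold a) (\<lambda>k. indicator {1} k * (1 - m)\<^sup>2 + indicator {2} k * (2 - m)\<^sup>2)"
      by (intro Bochner_Integration.integrable_add integrable_mult_left) (simp_all add: less_top[symmetric])
  qed (use variance_hold(1) in \<open>auto simp: indicator_def m_def\<close>)
  also have "\<dots> = hold_var a" using variance_hold(2) by (simp add: m_def)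
  finally show ?thesis by (simp add: hold_gap_def b_def c_def)
qed

lemma hold_var_nonneg: "0 \<le> hold_var a"
  using hold_gap_le_var hold_gap_bounds by linarith

lemma hold_mean_ge: "1 \<le> hold_mean a"
  using sum_le_suminf[OF summable_hold, of "{0}"] Omega0_props(1,3)[OF a] by (auto simp: hold_mean_def less_imp_le)

context
  fixes \<delta> :: real
  assumes \<delta>: "0 \<le> \<delta>" "\<delta> \<le> 1" and sd: "summable (\<lambda>n. (real n + 1) powr (1 + \<delta>) * a n)"
begin

lemma hold_moment_le:
  "integrable (hold a) (\<lambda>k. real k powr (2 + \<delta>))"
  "measure_pmf.expectation (hold a) (\<lambda>k. real k powr (2 + \<delta>)) \<le> 3 * hold_moment \<delta> a"
proof -
  let ?S = "\<lambda>k. \<Sum>j<k. (real j + 1) powr (1 + \<delta>)"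
  have S: "integrable (hold a) ?S" "measure_pmf.expectation (hold a) ?S = hold_moment \<delta> a"
    using expectation_hold_tail[OF a, of "\<lambda>j. (real j + 1) powr (1 + \<delta>)"] sd by (auto simp: hold_moment_def)
  have le: "real k powr (2 + \<delta>) \<le> 3 * ?S k" for k
  proof -
    have "real k powr (2 + \<delta>) \<le> (2 + \<delta>) * ?S k" using power_sum_diff_le[of "2 + \<delta>" k] \<delta> by (simp add: add.commute)
    also have "\<dots> \<le> 3 * ?S k" using \<delta> by (intro mult_right_mono) (auto intro: sum_nonneg)
    finally show ?thesis .
  qed
  show i: "integrable (hold a) (\<lambda>k. real k powr (2 + \<delta>))"
    by (rule Bochner_Integration.integrable_bound[where f="\<lambda>k. 3 * ?S k"])
      (use S le in \<open>auto intro!: AE_I2 intro: order_trans[OF _ abs_ge_self]\<close>)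
  have "measure_pmf.expectation (hold a) (\<lambda>k. real k powr (2 + \<delta>)) \<le> measure_pmf.expectation (hold a) (\<lambda>k. 3 * ?S k)"
    by (rule integral_mono[OF i]) (use S le in auto)
  then show "measure_pmf.expectation (hold a) (\<lambda>k. real k powr (2 + \<delta>)) \<le> 3 * hold_moment \<delta> a"
    using S by simp
qed

text \<open>Jensen's inequality for the convex power \<open>1 + \<delta> / 2\<close>, stated on the
  positive axis, where holding times live.\<close>

lemma hold_second_powr_le: "hold_second a powr (1 + \<delta> / 2) \<le> 3 * hold_moment \<delta> a"
proof -
  have e: "((real k)\<^sup>2) powr (1 + \<delta> / 2) = real k powr (2 + \<delta>)" for k
    by (simp add: square_powr)
  have "hold_second a powr (1 + \<delta> / 2) \<le> measure_pmf.expectation (hold a) (\<lambda>k. ((real k)\<^sup>2) powr (1 + \<delta> / 2))"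
    unfolding expectation_hold_sq[symmetric]
  proof (rule measure_pmf.jensens_inequality[where I="{0<..}" and a=0])
    show "AE x in hold a. (real x)\<^sup>2 \<in> {0<..}" using AE_hold_pos[OF a] by eventually_elim auto
    show "convex_on {0<..} (\<lambda>x. x powr (1 + \<delta> / 2))" using \<delta> by (intro powr_convex) auto
  qed (use integrable_hold_sq hold_moment_le(1) in \<open>auto simp: e\<close>)
  then show ?thesis using hold_moment_le(2) by (simp add: e)
qed

lemma hold_moment_nonneg: "0 \<le> hold_moment \<delta> a"
  using hold_second_powr_le order_trans[OF powr_ge_zero hold_second_powr_le] by simp

lemma hold_mean_powr_le: "hold_mean a powr (2 + \<delta>) \<le> 3 * hold_moment \<delta> a"
proof -
  have "(hold_mean a)\<^sup>2 \<le> hold_second a" using hold_var_nonneg by (simp add: hold_var_def)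
  then have "((hold_mean a)\<^sup>2) powr (1 + \<delta> / 2) \<le> hold_second a powr (1 + \<delta> / 2)"
    using \<delta> by (intro powr_mono2) auto
  moreover have "((hold_mean a)\<^sup>2) powr (1 + \<delta> / 2) = hold_mean a powr (2 + \<delta>)"
    using hold_mean_ge by (simp add: square_powr)
  ultimately show ?thesis using hold_second_powr_le by linarith
qed

text \<open>Both sides, once centred, are compared with
  \<open>1 - hold_var a * t\<^sup>2 / 2\<close>. The characteristic function costs
  \<open>3 + 3\<close> moments, from \<open>k\<close> and from the centre \<open>m\<close>, and the
  exponential 3 more.\<close>

lemma hold_cf_approx:
  "cmod (cf (hold a) t - cis (t * hold_mean a) * exp (- hold_var a * t\<^sup>2 / 2)) \<le> 9 * hold_moment \<delta> a * \<bar>t\<bar> powr (2 + \<delta>)"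
proof -
  define m where "m = hold_mean a"
  define \<psi> where "\<psi> = measure_pmf.expectation (hold a) (\<lambda>k. cis (t * (real k - m)))"
  define q where "q k = 1 + \<i> * of_real (t * (real k - m)) - of_real ((t * (real k - m))\<^sup>2 / 2)" for k
  have cf: "cf (hold a) t = cis (t * m) * \<psi>"
    unfolding cf_def \<psi>_def integral_mult_right_zero[symmetric]
    by (rule Bochner_Integration.integral_cong) (auto simp: cis_mult algebra_simps)
  have iq1: "integrable (hold a) (\<lambda>k. t * (real k - m))" using integrable_hold by simp
  have iq2: "integrable (hold a) (\<lambda>k. (t * (real k - m))\<^sup>2 / 2)"
    using variance_hold(1) by (simp add: power_mult_distrib m_def)
  have e1: "measure_pmf.expectation (hold a) (\<lambda>k. t * (real k - m)) = 0"
    using integrable_hold expectation_hold by (simp add: m_def)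
  have e2: "measure_pmf.expectation (hold a) (\<lambda>k. (t * (real k - m))\<^sup>2 / 2) = hold_var a * t\<^sup>2 / 2"
    using variance_hold by (simp add: power_mult_distrib m_def)
  have iq: "integrable (hold a) q" unfolding q_def
    by (intro Bochner_Integration.integrable_add Bochner_Integration.integrable_diff integrable_mult_right integrable_of_real iq1 iq2) auto
  have eq: "measure_pmf.expectation (hold a) q = of_real (1 - hold_var a * t\<^sup>2 / 2)"
  proof -
    have "measure_pmf.expectation (hold a) q = 1 + \<i> * of_real (measure_pmf.expectation (hold a) (\<lambda>k. t * (real k - m)))
        - of_real (measure_pmf.expectation (hold a) (\<lambda>k. (t * (real k - m))\<^sup>2 / 2))"
    proof -
      have c1: "integrable (hold a) (\<lambda>k. \<i> * complex_of_real (t * (real k - m)))"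
        by (intro integrable_mult_right integrable_of_real iq1)
      have c2: "integrable (hold a) (\<lambda>k. complex_of_real ((t * (real k - m))\<^sup>2 / 2))"
        by (intro integrable_of_real iq2)
      have c0: "integrable (hold a) (\<lambda>k. 1::complex)" by simp
      show ?thesis
        unfolding q_def Bochner_Integration.integral_diff[OF Bochner_Integration.integrable_add[OF c0 c1] c2]
          Bochner_Integration.integral_add[OF c0 c1] integral_mult_right_zero integral_complex_of_real by simp
    qed
    then show ?thesis unfolding e1 e2 by simp
  qed
  have b1: "cmod (\<psi> - of_real (1 - hold_var a * t\<^sup>2 / 2)) \<le> 6 * hold_moment \<delta> a * \<bar>t\<bar> powr (2 + \<delta>)"
  proof -
    have "\<psi> - of_real (1 - hold_var a * t\<^sup>2 / 2) = measure_pmf.expectation (hold a) (\<lambda>k. cis (t * (real k - m)) - q k)"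
      unfolding \<psi>_def eq[symmetric] by (rule Bochner_Integration.integral_diff[symmetric]) (auto simp: integrable_pmf_cis iq)
    also have "cmod \<dots> \<le> measure_pmf.expectation (hold a) (\<lambda>k. cmod (cis (t * (real k - m)) - q k))"
      by (rule integral_norm_bound)
    also have "\<dots> \<le> measure_pmf.expectation (hold a) (\<lambda>k. \<bar>t\<bar> powr (2 + \<delta>) * (real k powr (2 + \<delta>) + m powr (2 + \<delta>)))"
    proof (rule integral_mono)
      show "integrable (hold a) (\<lambda>k. cmod (cis (t * (real k - m)) - q k))"
        by (intro integrable_norm Bochner_Integration.integrable_diff integrable_pmf_cis iq)
      show "integrable (hold a) (\<lambda>k. \<bar>t\<bar> powr (2 + \<delta>) * (real k powr (2 + \<delta>) + m powr (2 + \<delta>)))"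
        using hold_moment_le(1) by simp
      fix k
      have "cmod (cis (t * (real k - m)) - q k) \<le> \<bar>t * (real k - m)\<bar> powr (2 + \<delta>)"
        unfolding q_def by (rule cis_approx_powr[OF \<delta>])
      also have "\<dots> = \<bar>t\<bar> powr (2 + \<delta>) * \<bar>real k - m\<bar> powr (2 + \<delta>)" by (simp add: abs_mult powr_mult)
      also have "\<bar>real k - m\<bar> powr (2 + \<delta>) \<le> (max (real k) m) powr (2 + \<delta>)"
        using hold_mean_ge \<delta> by (intro powr_mono2) (auto simp: m_def)
      also have "(max (real k) m) powr (2 + \<delta>) \<le> real k powr (2 + \<delta>) + m powr (2 + \<delta>)"
        by (auto simp: max_def)
      finally show "cmod (cis (t * (real k - m)) - q k) \<le> \<bar>t\<bar> powr (2 + \<delta>) * (real k powr (2 + \<delta>) + m powr (2 + \<delta>))"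
        by (simp add: mult_left_mono)
    qed
    also have "\<dots> = \<bar>t\<bar> powr (2 + \<delta>) * (measure_pmf.expectation (hold a) (\<lambda>k. real k powr (2 + \<delta>)) + m powr (2 + \<delta>))"
      using hold_moment_le(1) by simp
    also have "\<dots> \<le> \<bar>t\<bar> powr (2 + \<delta>) * (3 * hold_moment \<delta> a + 3 * hold_moment \<delta> a)"
      using hold_moment_le(2) hold_mean_powr_le by (intro mult_left_mono add_mono) (auto simp: m_def)
    finally show ?thesis by (simp add: mult_ac)
  qed
  have b2: "cmod (of_real (1 - hold_var a * t\<^sup>2 / 2) - exp (- hold_var a * t\<^sup>2 / 2)) \<le> 3 * hold_moment \<delta> a * \<bar>t\<bar> powr (2 + \<delta>)"
  proof -
    let ?u = "hold_var a * t\<^sup>2 / 2"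
    have u: "0 \<le> ?u" using hold_var_nonneg by simp
    have "cmod (of_real (1 - ?u) - exp (- hold_var a * t\<^sup>2 / 2)) = \<bar>exp (- ?u) - (1 - ?u)\<bar>"
      by (simp only: of_real_diff[symmetric] norm_of_real) (simp add: abs_minus_commute)
    also have "\<dots> \<le> ?u powr (1 + \<delta> / 2)" by (rule exp_minus_approx_powr[OF u \<delta>])
    also have "\<dots> \<le> (hold_second a * t\<^sup>2) powr (1 + \<delta> / 2)"
    proof (rule powr_mono2)
      have "hold_var a \<le> hold_second a" by (simp add: hold_var_def)
      then have "hold_var a * t\<^sup>2 \<le> hold_second a * t\<^sup>2" by (intro mult_right_mono) auto
      then show "?u \<le> hold_second a * t\<^sup>2" using u by linarith
    qed (use \<delta> u in auto)
    also have "\<dots> = hold_second a powr (1 + \<delta> / 2) * (t\<^sup>2) powr (1 + \<delta> / 2)"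
      by (simp add: powr_mult)
    also have "(t\<^sup>2) powr (1 + \<delta> / 2) = \<bar>t\<bar> powr (2 + \<delta>)"
      using square_powr[of "\<bar>t\<bar>" \<delta>] by simp
    finally show ?thesis using hold_second_powr_le by (meson mult_right_mono order_trans powr_ge_zero)
  qed
  have "cf (hold a) t - cis (t * m) * exp (- hold_var a * t\<^sup>2 / 2)
     = cis (t * m) * ((\<psi> - of_real (1 - hold_var a * t\<^sup>2 / 2)) + (of_real (1 - hold_var a * t\<^sup>2 / 2) - exp (- hold_var a * t\<^sup>2 / 2)))"
    unfolding cf by (simp add: algebra_simps)
  then have "cmod (cf (hold a) t - cis (t * m) * exp (- hold_var a * t\<^sup>2 / 2))
     \<le> cmod (\<psi> - of_real (1 - hold_var a * t\<^sup>2 / 2)) + cmod (of_real (1 - hold_var a * t\<^sup>2 / 2) - exp (- hold_var a * t\<^sup>2 / 2))"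
    by (simp only: norm_mult norm_cis mult_1_left norm_triangle_ineq)
  then show ?thesis using b1 b2 unfolding m_def by (simp add: algebra_simps)
qed

end
end
end

section \<open>Local limit theorem for arrival times\<close>

text \<open>The holding time at \<open>x\<close> itself is excluded: \<open>arrival w x\<close> adds
  those at the sites below \<open>x\<close>.\<close>

primrec arrival :: "(nat \<Rightarrow> nat \<Rightarrow> real) \<Rightarrow> nat \<Rightarrow> nat pmf" where
  "arrival w 0 = return_pmf 0"
| "arrival w (Suc x) = bind_pmf (arrival w x) (\<lambda>i. map_pmf (\<lambda>k. i + k) (hold (w x)))"

lemma pmf_shift: "pmf (map_pmf (\<lambda>k. i + k) q) l = (if i \<le> l then pmf q (l - i) else 0)" for i l :: nat
proof (cases "i \<le> l")
  case True
  then show ?thesis using pmf_map_inj'[of "\<lambda>k. i + k" q "l - i"] by (simp add: inj_def)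
next
  case False
  then have "l \<notin> (\<lambda>k. i + k) ` set_pmf q" by auto
  then show ?thesis using False by (simp add: pmf_map_outside)
qed

lemma pmf_arrival_Suc:
  "pmf (arrival w (Suc x)) l = (\<Sum>i\<le>l. pmf (arrival w x) i * pmf (hold (w x)) (l - i))"
proof -
  have "pmf (arrival w (Suc x)) l = measure_pmf.expectation (arrival w x) (\<lambda>i. if i \<le> l then pmf (hold (w x)) (l - i) else 0)"
    by (simp add: pmf_bind pmf_shift)
  also have "\<dots> = (\<Sum>i\<in>{..l}. (if i \<le> l then pmf (hold (w x)) (l - i) else 0) * pmf (arrival w x) i)"
    by (rule integral_measure_pmf_real) (auto split: if_splits)
  also have "\<dots> = (\<Sum>i\<le>l. pmf (arrival w x) i * pmf (hold (w x)) (l - i))"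
    by (rule sum.cong) auto
  finally show ?thesis .
qed

section \<open>Fourier inversion on the lattice and on the line\<close>

lemma cf_sums: "(\<lambda>k. pmf p k *\<^sub>R cis (t * real k)) sums cf p t"
  unfolding cf_def by (rule pmf_expectation_sums[OF integrable_pmf_cis])

lemma summable_pmf: "summable (pmf p)" for p :: "nat pmf"
  using sums_summable[OF pmf_expectation_sums[of p "\<lambda>_. 1::real"]] by simp

lemma cf_arrival_Suc: "cf (arrival w (Suc x)) t = cf (arrival w x) t * cf (hold (w x)) t"
proof -
  let ?a = "\<lambda>p k. pmf p k *\<^sub>R cis (t * real k)"
  have s: "summable (\<lambda>k. norm (?a p k))" for p using summable_pmf[of p] by simp
  have "(\<lambda>k. \<Sum>i\<le>k. ?a (arrival w x) i * ?a (hold (w x)) (k - i)) sums (cf (arrival w x) t * cf (hold (w x)) t)"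
    using Cauchy_product_sums[OF s s] unfolding sums_unique[OF cf_sums, symmetric] .
  moreover have "(\<Sum>i\<le>k. ?a (arrival w x) i * ?a (hold (w x)) (k - i)) = ?a (arrival w (Suc x)) k" for k
    unfolding pmf_arrival_Suc scaleR_sum_left
  proof (rule sum.cong[OF refl])
    fix i assume "i \<in> {..k}"
    then have "cis (t * real i) * cis (t * real (k - i)) = cis (t * real k)"
      by (simp add: cis_mult of_nat_diff algebra_simps)
    then show "?a (arrival w x) i * ?a (hold (w x)) (k - i) = (pmf (arrival w x) i * pmf (hold (w x)) (k - i)) *\<^sub>R cis (t * real k)"
      by (simp add: mult_ac)
  qed
  ultimately show ?thesis using cf_sums sums_unique2 by (metis (no_types, lifting) sums_cong)
qed

lemma bind_pmf_expectation:
  fixes f :: "nat \<Rightarrow> real"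
  assumes f: "\<And>k. 0 \<le> f k" and i: "\<And>i. integrable (measure_pmf (N i)) f"
    and p: "integrable (measure_pmf p) (\<lambda>i. measure_pmf.expectation (N i) f)"
  shows "integrable (measure_pmf (bind_pmf p N)) f"
    "measure_pmf.expectation (bind_pmf p N) f = measure_pmf.expectation p (\<lambda>i. measure_pmf.expectation (N i) f)"
proof -
  have nn: "0 \<le> measure_pmf.expectation (N i) f" for i using f by simp
  have "(\<integral>\<^sup>+k. ennreal (f k) \<partial>bind_pmf p N) = (\<integral>\<^sup>+i. ennreal (measure_pmf.expectation (N i) f) \<partial>p)"
    using f i by (simp add: nn_integral_eq_integral)
  also have "\<dots> = ennreal (measure_pmf.expectation p (\<lambda>i. measure_pmf.expectation (N i) f))"
    using p nn by (simp add: nn_integral_eq_integral)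
  finally have "integrable (measure_pmf (bind_pmf p N)) f \<and>
    measure_pmf.expectation (bind_pmf p N) f = measure_pmf.expectation p (\<lambda>i. measure_pmf.expectation (N i) f)"
    by (subst (asm) nn_integral_eq_integrable) (use f nn in auto)
  then show "integrable (measure_pmf (bind_pmf p N)) f"
    "measure_pmf.expectation (bind_pmf p N) f = measure_pmf.expectation p (\<lambda>i. measure_pmf.expectation (N i) f)" by auto
qed

text \<open>The characteristic series is integrated term by term, which absolute summability of the
  masses permits; all frequencies other than \<open>l\<close> integrate to 0 over a full
  period.\<close>

lemma pmf_fourier_inversion:
  fixes p :: "nat pmf" and l :: nat
  defines "g \<equiv> \<lambda>t. indicator {-pi..pi} t *\<^sub>R (cis (- (t * real l)) * cf p t)"
  shows "integrable lborel g" "(\<integral>t. g t \<partial>lborel) = of_real (2 * pi * pmf p l)"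
proof -
  define f where "f k t = indicator {-pi..pi} t *\<^sub>R (pmf p k *\<^sub>R cis (t * (real k - real l)))" for k and t :: real
  have cont: "continuous_on {-pi..pi} (\<lambda>t. pmf p k *\<^sub>R cis (t * (real k - real l)))" for k
    by (intro continuous_intros)
  have int: "integrable lborel (f k)" for k
    unfolding f_def by (rule borel_integrable_atLeastAtMost'[OF cont, unfolded set_integrable_def])
  have nrm: "norm (f k t) = indicator {-pi..pi} t * pmf p k" for k t
    by (simp add: f_def)
  have intn: "(\<integral>t. norm (f k t) \<partial>lborel) = 2 * pi * pmf p k" for k
    unfolding nrm by simp
  have val: "(\<integral>t. f k t \<partial>lborel) = (if k = l then of_real (2 * pi * pmf p l) else 0)" for k
  proof (cases "k = l")
    case True
    have "(\<integral>t. f k t \<partial>lborel) = (\<integral>t. indicator {-pi..pi} t *\<^sub>R (of_real (pmf p l) :: complex) \<partial>lborel)"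
      by (rule Bochner_Integration.integral_cong) (auto simp: f_def True scaleR_conv_of_real)
    also have "\<dots> = of_real (2 * pi * pmf p l)" by (simp add: scaleR_conv_of_real)
    finally show ?thesis using True by simp
  next
    case False
    define n where "n = real k - real l"
    have n: "n \<noteq> 0" using False by (simp add: n_def)
    \<comment> \<open>A primitive with period \<open>2 * pi\<close>, since \<open>n\<close> is a
      nonzero integer.\<close>
    define F where "F t = (pmf p k / n) *\<^sub>R (- \<i> * cis (t * n))" for t
    have "(\<integral>t. f k t \<partial>lborel) = F pi - F (- pi)"
      unfolding f_def n_def[symmetric]
    proof (rule integral_FTC_atLeastAtMost)
      fix t
      show "(F has_vector_derivative pmf p k *\<^sub>R cis (t * n)) (at t within {-pi..pi})"
        unfolding F_def[abs_def] has_vector_derivative_complex_iff using n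
        by (auto intro!: derivative_eq_intros)
    qed (use cont in \<open>auto simp: n_def\<close>)
    also have "\<dots> = 0"
    proof -
      have "n \<in> \<int>" unfolding n_def by simp
      then obtain j where "n = of_int j" by (elim Ints_cases)
      then have "cis (pi * n) = cis (- (pi * n))"
        by (simp add: complex_eq_iff sin_times_pi_eq_0 mult.commute)
      then show ?thesis by (simp add: F_def)
    qed
    finally show ?thesis using False by simp
  qed
  have sm: "summable (\<lambda>k. \<integral>t. norm (f k t) \<partial>lborel)" unfolding intn using summable_pmf by (intro summable_mult) auto
  have ae: "AE t in lborel. summable (\<lambda>k. norm (f k t))"
    unfolding nrm using summable_pmf by (intro AE_I2 summable_mult) auto
  have g: "(\<Sum>k. f k t) = g t" for t
  proof -
    have "(\<lambda>k. indicator {-pi..pi} t *\<^sub>R (cis (- (t * real l)) * (pmf p k *\<^sub>R cis (t * real k)))) sums g t"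
      unfolding g_def by (intro sums_scaleR_right sums_mult cf_sums)
    moreover have "indicator {-pi..pi} t *\<^sub>R (cis (- (t * real l)) * (pmf p k *\<^sub>R cis (t * real k))) = f k t" for k
      by (simp add: f_def cis_mult algebra_simps)
    ultimately show ?thesis by (simp add: sums_iff)
  qed
  show "integrable lborel g" using integrable_suminf[OF int ae sm] by (simp add: g)
  have "(\<lambda>k. \<integral>t. f k t \<partial>lborel) sums (\<integral>t. g t \<partial>lborel)" using sums_integral[OF int ae sm] by (simp add: g)
  moreover have "(\<lambda>k. \<integral>t. f k t \<partial>lborel) sums of_real (2 * pi * pmf p l)"
    unfolding val using sums_single[of l "\<lambda>_. complex_of_real (2 * pi * pmf p l)"] by simp
  ultimately show "(\<integral>t. g t \<partial>lborel) = of_real (2 * pi * pmf p l)" by (rule sums_unique2)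
qed

text \<open>Rescaling by \<open>sqrt V\<close> reduces this to the characteristic function of the
  standard normal law.\<close>

lemma gaussian_fourier:
  assumes V: "0 < V"
  shows "integrable lborel (\<lambda>t. cis (t * d) * of_real (exp (- V * t\<^sup>2 / 2)))"
    "(\<integral>t. cis (t * d) * of_real (exp (- V * t\<^sup>2 / 2)) \<partial>lborel) = of_real (2 * pi * normal_density 0 (sqrt V) d)"
proof -
  let ?s = "d / sqrt V"
  let ?f = "\<lambda>x. std_normal_density x *\<^sub>R iexp (?s * x)"
  have sV: "0 < sqrt V" "sqrt V \<noteq> 0" using V by auto
  have c: "?f (0 + sqrt V * t) = (1 / sqrt (2 * pi)) *\<^sub>R (cis (t * d) * of_real (exp (- V * t\<^sup>2 / 2)))" for t
  proof -
    have "?s * (sqrt V * t) = t * d" using sV by (simp add: field_simps)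
    moreover have "(sqrt V * t)\<^sup>2 = V * t\<^sup>2" using V by (simp add: power_mult_distrib)
    ultimately show ?thesis
      by (simp add: std_normal_density_def cis_conv_exp scaleR_conv_of_real mult_ac)
  qed
  have int: "integrable lborel ?f"
  proof (rule Bochner_Integration.integrable_bound)
    show "integrable lborel std_normal_density" by (rule integrable_normal_density) simp
  qed (auto simp: std_normal_density_def)
  have "integrable lborel (\<lambda>t. (1 / sqrt (2 * pi)) *\<^sub>R (cis (t * d) * of_real (exp (- V * t\<^sup>2 / 2))))"
    using lborel_integrable_real_affine[OF int sV(2), of 0] unfolding c .
  from integrable_scaleR_right[OF this, of "sqrt (2 * pi)"]
  show i: "integrable lborel (\<lambda>t. cis (t * d) * of_real (exp (- V * t\<^sup>2 / 2)))" by simp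
  have "complex_of_real (exp (- (?s\<^sup>2) / 2)) = (\<integral>x. iexp (?s * x) \<partial>density lborel std_normal_density)"
    by (rule fun_cong[OF char_std_normal_distribution, of ?s, unfolded char_def, symmetric])
  also have "\<dots> = (\<integral>x. ?f x \<partial>lborel)"
    by (subst integral_density) auto
  also have "\<dots> = sqrt V *\<^sub>R (\<integral>t. ?f (0 + sqrt V * t) \<partial>lborel)"
    using lborel_integral_real_affine[OF sV(2), of ?f 0] sV by simp
  also have "\<dots> = (sqrt V / sqrt (2 * pi)) *\<^sub>R (\<integral>t. cis (t * d) * of_real (exp (- V * t\<^sup>2 / 2)) \<partial>lborel)"
    unfolding c by simp
  finally have "(sqrt (2 * pi) / sqrt V) *\<^sub>R complex_of_real (exp (- (?s\<^sup>2) / 2))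
     = (sqrt (2 * pi) / sqrt V) *\<^sub>R ((sqrt V / sqrt (2 * pi)) *\<^sub>R (\<integral>t. cis (t * d) * of_real (exp (- V * t\<^sup>2 / 2)) \<partial>lborel))"
    by simp
  also have "\<dots> = (\<integral>t. cis (t * d) * of_real (exp (- V * t\<^sup>2 / 2)) \<partial>lborel)"
    using sV by simp
  finally have e: "(\<integral>t. cis (t * d) * of_real (exp (- V * t\<^sup>2 / 2)) \<partial>lborel) = of_real (sqrt (2 * pi) / sqrt V * exp (- (?s\<^sup>2) / 2))"
    by (simp add: scaleR_conv_of_real)
  have s2: "?s\<^sup>2 = d\<^sup>2 / V" using V by (simp add: power_divide)
  have "2 * pi = sqrt (2 * pi) * sqrt (2 * pi)" by simp
  then have c2: "2 * pi * (1 / (sqrt (2 * pi) * sqrt V)) = sqrt (2 * pi) / sqrt V"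
    using sV by (simp add: field_simps)
  have nd: "normal_density 0 (sqrt V) d = (1 / (sqrt (2 * pi) * sqrt V)) * exp (- (d\<^sup>2 / V) / 2)"
    using V by (simp add: normal_density_def real_sqrt_mult)
  have "sqrt (2 * pi) / sqrt V * exp (- (?s\<^sup>2) / 2) = 2 * pi * normal_density 0 (sqrt V) d"
    unfolding s2 nd mult.assoc[symmetric] c2 ..
  then show "(\<integral>t. cis (t * d) * of_real (exp (- V * t\<^sup>2 / 2)) \<partial>lborel) = of_real (2 * pi * normal_density 0 (sqrt V) d)"
    using e by simp
qed

locale walk_environment =
  fixes w :: "nat \<Rightarrow> nat \<Rightarrow> real" and \<delta> :: real
  assumes env: "\<And>x. w x \<in> Omega0"
    and sq: "\<And>x. summable (\<lambda>n. (2 * real n + 1) * w x n)"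
    and \<delta>: "0 \<le> \<delta>" "\<delta> \<le> 1"
    and sd: "\<And>x. summable (\<lambda>n. (real n + 1) powr (1 + \<delta>) * w x n)"
begin

lemma arrival_less: "l < x \<Longrightarrow> pmf (arrival w x) l = 0"
proof (induction x arbitrary: l)
  case (Suc x)
  have "pmf (arrival w x) i * pmf (hold (w x)) (l - i) = 0" if "i \<le> l" for i
    using Suc.IH[of i] Suc.prems that by (cases "i = l") (auto simp: pmf_hold[OF env])
  then show ?case unfolding pmf_arrival_Suc by (intro sum.neutral) auto
qed simp

definition "mean_upto x = (\<Sum>u<x. hold_mean (w u))"
definition "var_upto x = (\<Sum>u<x. hold_var (w u))"
definition "gap_upto x = (\<Sum>u<x. hold_gap (w u))"
definition "moment_upto x = (\<Sum>u<x. hold_moment \<delta> (w u))"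

lemma arrival_moments:
  "integrable (arrival w x) real" "measure_pmf.expectation (arrival w x) real = mean_upto x"
  "integrable (arrival w x) (\<lambda>k. (real k)\<^sup>2)"
  "measure_pmf.expectation (arrival w x) (\<lambda>k. (real k)\<^sup>2) = var_upto x + (mean_upto x)\<^sup>2"
proof (induction x)
  case 0
  show "integrable (arrival w 0) real" "measure_pmf.expectation (arrival w 0) real = mean_upto 0"
    "integrable (arrival w 0) (\<lambda>k. (real k)\<^sup>2)"
    "measure_pmf.expectation (arrival w 0) (\<lambda>k. (real k)\<^sup>2) = var_upto 0 + (mean_upto 0)\<^sup>2"
    by (auto simp: mean_upto_def var_upto_def integrable_measure_pmf_finite)
next
  case (Suc x)
  let ?m = "hold_mean (w x)" and ?q = "hold_second (w x)"
  let ?N = "\<lambda>i. map_pmf (\<lambda>k. i + k) (hold (w x))"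
  note h = integrable_hold[OF env sq, of x] expectation_hold[OF env sq, of x]
    integrable_hold_sq[OF env sq, of x] expectation_hold_sq[OF env sq, of x]
  have i1: "integrable (?N i) real" "measure_pmf.expectation (?N i) real = real i + ?m" for i
    using h by auto
  have e: "(real (i + k))\<^sup>2 = (real i)\<^sup>2 + 2 * real i * real k + (real k)\<^sup>2" for i k
    by (simp add: power2_eq_square algebra_simps)
  have i2: "integrable (?N i) (\<lambda>k. (real k)\<^sup>2)"
    "measure_pmf.expectation (?N i) (\<lambda>k. (real k)\<^sup>2) = (real i)\<^sup>2 + 2 * real i * ?m + ?q" for i
    using h by (auto simp: e simp del: of_nat_add)
  have j1: "integrable (arrival w x) (\<lambda>i. real i + ?m)" using Suc(1) by simp
  have j2: "integrable (arrival w x) (\<lambda>i. (real i)\<^sup>2 + 2 * real i * ?m + ?q)" using Suc(1,3) by simp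
  have b1: "integrable (arrival w (Suc x)) real"
      "measure_pmf.expectation (arrival w (Suc x)) real = measure_pmf.expectation (arrival w x) (\<lambda>i. real i + ?m)"
    using bind_pmf_expectation[of real ?N "arrival w x"] i1 j1 by auto
  have b2: "integrable (arrival w (Suc x)) (\<lambda>k. (real k)\<^sup>2)"
      "measure_pmf.expectation (arrival w (Suc x)) (\<lambda>k. (real k)\<^sup>2) = measure_pmf.expectation (arrival w x) (\<lambda>i. (real i)\<^sup>2 + 2 * real i * ?m + ?q)"
    using bind_pmf_expectation[of "\<lambda>k. (real k)\<^sup>2" ?N "arrival w x"] i2 j2 by auto
  show "integrable (arrival w (Suc x)) real" "integrable (arrival w (Suc x)) (\<lambda>k. (real k)\<^sup>2)"
    by (rule b1 b2)+
  show "measure_pmf.expectation (arrival w (Suc x)) real = mean_upto (Suc x)"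
    unfolding b1(2) using Suc(1,2) by (simp add: mean_upto_def)
  have "measure_pmf.expectation (arrival w x) (\<lambda>i. (real i)\<^sup>2 + 2 * real i * ?m + ?q)
     = var_upto x + (mean_upto x)\<^sup>2 + 2 * mean_upto x * ?m + ?q"
    using Suc by simp
  also have "\<dots> = var_upto (Suc x) + (mean_upto (Suc x))\<^sup>2"
    by (simp add: mean_upto_def var_upto_def hold_var_def power2_eq_square algebra_simps)
  finally show "measure_pmf.expectation (arrival w (Suc x)) (\<lambda>k. (real k)\<^sup>2) = var_upto (Suc x) + (mean_upto (Suc x))\<^sup>2"
    unfolding b2(2) .
qed

text \<open>Serves the positions far below the typical one, where \<open>x\<close> may be too small
  for the local limit theorem to say anything.\<close>

lemma arrival_chebyshev:
  assumes "0 < r"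
  shows "measure_pmf.prob (arrival w x) {k. r \<le> \<bar>real k - mean_upto x\<bar>} \<le> var_upto x / r\<^sup>2"
proof -
  have "measure_pmf.variance (arrival w x) real = var_upto x"
    using measure_pmf.variance_eq[OF arrival_moments(1,3)] arrival_moments(2,4) by simp
  then show ?thesis
    using measure_pmf.Chebyshev_inequality[OF _ arrival_moments(3) assms, of x] by (simp add: arrival_moments(2))
qed

end

section \<open>Gaussian approximation of the arrival law\<close>

lemma powr_exp_minus_le:
  fixes y p :: real
  assumes "0 \<le> y" "0 \<le> p" "p \<le> 2"
  shows "y powr p * exp (- y) \<le> 2"
proof -
  have "y powr p \<le> 1 + y\<^sup>2"
  proof (cases "y \<le> 1")
    case True then show ?thesis using powr_le1[of p y] assms zero_le_power2[of y] by linarith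
  next
    case False
    then have "y powr p \<le> y powr 2" using assms by (intro powr_mono) auto
    then show ?thesis using assms by simp
  qed
  also have "\<dots> \<le> 2 * exp y" using exp_lower_Taylor_quadratic[OF assms(1)] assms by simp
  finally have "y powr p * exp (- y) \<le> (2 * exp y) * exp (- y)" by (intro mult_right_mono) auto
  also have "\<dots> = 2" by (simp add: exp_minus)
  finally show ?thesis .
qed

text \<open>Half of the exponent absorbs the power of \<open>t\<close>, at the price
  \<open>G powr (- p / 2)\<close>; the other half remains for integration. The constant is
  \<open>2 * 120\<close>, from \<open>24 powr (3 / 2) \<le> 120\<close>.\<close>

lemma powr_gaussian_le:
  fixes t G p :: real
  assumes G: "0 < G" and p: "0 \<le> p" "p \<le> 3"
  shows "\<bar>t\<bar> powr p * exp (- G * t\<^sup>2 / 12) \<le> 240 * G powr (- p / 2) * exp (- G * t\<^sup>2 / 24)"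
proof -
  define y where "y = G * t\<^sup>2 / 24"
  have y: "0 \<le> y" using G by (simp add: y_def)
  have sq: "sqrt 24 \<le> 5" by (rule real_le_lsqrt) auto
  have "\<bar>t\<bar> powr p = (t\<^sup>2) powr (p / 2)"
  proof -
    have e: "p / 2 = 1 + (p - 2) / 2" by (simp add: field_simps)
    show ?thesis unfolding e using square_powr[of "\<bar>t\<bar>" "p - 2"] by simp
  qed
  also have "t\<^sup>2 = 24 * y * G powr (-1)" using G by (simp add: y_def powr_minus field_simps)
  also have "(24 * y * G powr (-1)) powr (p / 2) = 24 powr (p / 2) * y powr (p / 2) * G powr (- p / 2)"
    by (simp only: powr_mult powr_powr) simp
  finally have t: "\<bar>t\<bar> powr p = 24 powr (p / 2) * y powr (p / 2) * G powr (- p / 2)" .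
  have "(24::real) powr (p / 2) \<le> 24 powr (1 + 1 / 2)" using p by (intro powr_mono) auto
  also have "\<dots> = 24 * sqrt 24" by (simp only: powr_add) (simp add: powr_half_sqrt)
  also have "\<dots> \<le> 120" using sq by simp
  finally have c: "(24::real) powr (p / 2) \<le> 120" .
  have "\<bar>t\<bar> powr p * exp (- G * t\<^sup>2 / 12) = 24 powr (p / 2) * (y powr (p / 2) * exp (- y)) * G powr (- p / 2) * exp (- G * t\<^sup>2 / 24)"
    unfolding t by (simp add: y_def exp_add[symmetric] mult_ac)
  also have "\<dots> \<le> 120 * 2 * G powr (- p / 2) * exp (- G * t\<^sup>2 / 24)"
    using c powr_exp_minus_le[OF y, of "p / 2"] p by (intro mult_right_mono mult_mono) auto
  finally show ?thesis by simp
qed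

lemma pi_squared_le: "pi\<^sup>2 \<le> 10"
proof -
  have "pi\<^sup>2 \<le> (3.15::real)\<^sup>2" using pi_approx by (intro power_mono) auto
  then show ?thesis by (simp add: power2_eq_square)
qed

lemma gaussian_integral:
  assumes G: "0 < G"
  shows "integrable lborel (\<lambda>t. exp (- G * t\<^sup>2 / 24))"
    "(\<integral>t. exp (- G * t\<^sup>2 / 24) \<partial>lborel) \<le> 2 * pi * (2 * G powr (- 1 / 2))"
proof -
  have e: "(\<lambda>t. cis (t * 0) * of_real (exp (- (G / 12) * t\<^sup>2 / 2))) = (\<lambda>t. complex_of_real (exp (- G * t\<^sup>2 / 24)))"
    by (simp add: fun_eq_iff)
  have V: "0 < G / 12" using G by simp
  note g = gaussian_fourier[OF V, of 0, unfolded e]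
  show "integrable lborel (\<lambda>t. exp (- G * t\<^sup>2 / 24))" using integrable_norm[OF g(1)] by simp
  have "(\<integral>t. exp (- G * t\<^sup>2 / 24) \<partial>lborel) = 2 * pi * normal_density 0 (sqrt (G / 12)) 0"
    using g(2) unfolding integral_complex_of_real by (simp only: of_real_eq_iff)
  also have "normal_density 0 (sqrt (G / 12)) 0 = 1 / sqrt (2 * pi * (G / 12))"
    using G by (simp add: normal_density_def)
  also have "\<dots> \<le> 1 / sqrt (G / 4)"
    using G pi_gt3 by (intro divide_left_mono) (auto simp: field_simps)
  also have "\<dots> = 2 * G powr (- 1 / 2)"
    using G by (simp add: real_sqrt_divide powr_minus_divide powr_half_sqrt)
  finally show "(\<integral>t. exp (- G * t\<^sup>2 / 24) \<partial>lborel) \<le> 2 * pi * (2 * G powr (- 1 / 2))" by simp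
qed

context walk_environment
begin

definition "gauss_cf x t = cis (t * mean_upto x) * of_real (exp (- var_upto x * t\<^sup>2 / 2))"

lemma gap_upto_le_var: "gap_upto x \<le> var_upto x"
  unfolding gap_upto_def var_upto_def by (intro sum_mono hold_gap_le_var env sq)

lemma cmod_gauss_cf: "cmod (gauss_cf x t) \<le> exp (- gap_upto x * t\<^sup>2 / 12)"
proof -
  have "0 \<le> gap_upto x" unfolding gap_upto_def by (intro sum_nonneg less_imp_le hold_gap_bounds env)
  then have "gap_upto x / 12 \<le> var_upto x / 2" using gap_upto_le_var[of x] by linarith
  then have "gap_upto x / 12 * t\<^sup>2 \<le> var_upto x / 2 * t\<^sup>2" by (intro mult_right_mono) auto
  then show ?thesis by (simp add: gauss_cf_def norm_mult)
qed

lemma moment_upto_nonneg: "0 \<le> moment_upto x"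
  unfolding moment_upto_def by (intro sum_nonneg hold_moment_nonneg env sq \<delta> sd)

text \<open>Lindeberg replacement, one factor at a time: every exchange costs one moment, while the
  remaining factors, true or Gaussian, keep the decay of their gaps. The estimate holds on the whole
  period, so high frequencies need no separate treatment.\<close>

lemma cf_arrival_approx:
  assumes t: "\<bar>t\<bar> \<le> pi"
  shows "cmod (cf (arrival w x) t - gauss_cf x t)
    \<le> 27 * moment_upto x * \<bar>t\<bar> powr (2 + \<delta>) * exp (- gap_upto x * t\<^sup>2 / 12)"
proof (induction x)
  case 0
  then show ?case by (simp add: gauss_cf_def mean_upto_def var_upto_def moment_upto_def gap_upto_def cf_def)
next
  case (Suc x)
  let ?a = "cf (hold (w x)) t" and ?T = "\<bar>t\<bar> powr (2 + \<delta>)"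
  let ?b = "cis (t * hold_mean (w x)) * of_real (exp (- hold_var (w x) * t\<^sup>2 / 2))"
  have g: "gauss_cf (Suc x) t = gauss_cf x t * ?b"
  proof -
    have c: "cis (t * (a + b)) = cis (t * a) * cis (t * b)" for a b by (simp add: cis_mult distrib_left)
    have e: "exp (- (a + b) * t\<^sup>2 / 2) = exp (- a * t\<^sup>2 / 2) * exp (- b * t\<^sup>2 / 2)" for a b :: real
    proof -
      have "- (a + b) * t\<^sup>2 / 2 = - a * t\<^sup>2 / 2 + - b * t\<^sup>2 / 2" by (simp add: field_simps)
      then show ?thesis by (simp only: exp_add)
    qed
    show ?thesis unfolding gauss_cf_def mean_upto_def var_upto_def sum.lessThan_Suc c e by (simp add: mult_ac)
  qed
  have e: "exp (- gap_upto (Suc x) * t\<^sup>2 / 12) = exp (- gap_upto x * t\<^sup>2 / 12) * exp (- hold_gap (w x) * t\<^sup>2 / 12)"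
  proof -
    have "- gap_upto (Suc x) * t\<^sup>2 / 12 = - gap_upto x * t\<^sup>2 / 12 + - hold_gap (w x) * t\<^sup>2 / 12"
      by (simp add: gap_upto_def field_simps)
    then show ?thesis by (simp only: exp_add)
  qed
  have t2: "t\<^sup>2 \<le> 10" using t power_mono[of "\<bar>t\<bar>" pi 2] pi_squared_le by simp
  \<comment> \<open>The exchanged factor leaves its own decay missing. Since
    \<open>10 / 12 < 1\<close> and \<open>exp 1 \<le> 3\<close>, restoring it costs a factor 3,
    which turns 9 into 27.\<close>
  have "hold_gap (w x) * t\<^sup>2 \<le> 1 * 10"
    using t2 hold_gap_bounds[OF env[of x]] by (intro mult_mono) auto
  then have "exp (hold_gap (w x) * t\<^sup>2 / 12) \<le> exp 1" by simp
  also have "exp 1 \<le> (3::real)" by (rule exp_le)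
  finally have "1 \<le> 3 * exp (- hold_gap (w x) * t\<^sup>2 / 12)" by (simp add: exp_minus field_simps)
  then have e3: "exp (- gap_upto x * t\<^sup>2 / 12) \<le> 3 * exp (- gap_upto (Suc x) * t\<^sup>2 / 12)"
    unfolding e using mult_left_mono[of 1 "3 * exp (- hold_gap (w x) * t\<^sup>2 / 12)" "exp (- gap_upto x * t\<^sup>2 / 12)"] by (simp add: mult_ac)
  have hm: "0 \<le> hold_moment \<delta> (w x)" by (rule hold_moment_nonneg[OF env sq \<delta> sd])
  have "cf (arrival w (Suc x)) t - gauss_cf (Suc x) t = (cf (arrival w x) t - gauss_cf x t) * ?a + gauss_cf x t * (?a - ?b)"
    unfolding cf_arrival_Suc g by (simp add: algebra_simps)
  then have "cmod (cf (arrival w (Suc x)) t - gauss_cf (Suc x) t)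
     \<le> cmod (cf (arrival w x) t - gauss_cf x t) * cmod ?a + cmod (gauss_cf x t) * cmod (?a - ?b)"
    by (simp only: norm_mult[symmetric] norm_triangle_ineq)
  also have "\<dots> \<le> (27 * moment_upto x * ?T * exp (- gap_upto x * t\<^sup>2 / 12)) * exp (- hold_gap (w x) * t\<^sup>2 / 12)
     + exp (- gap_upto x * t\<^sup>2 / 12) * (9 * hold_moment \<delta> (w x) * ?T)"
    using Suc hold_cf_le[OF env t] cmod_gauss_cf hold_cf_approx[OF env sq \<delta> sd] moment_upto_nonneg
    by (intro add_mono mult_mono) auto
  also have "(27 * moment_upto x * ?T * exp (- gap_upto x * t\<^sup>2 / 12)) * exp (- hold_gap (w x) * t\<^sup>2 / 12)
     = 27 * moment_upto x * ?T * exp (- gap_upto (Suc x) * t\<^sup>2 / 12)" unfolding e by (simp only: mult.assoc)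
  also have "27 * moment_upto x * ?T * exp (- gap_upto (Suc x) * t\<^sup>2 / 12) + exp (- gap_upto x * t\<^sup>2 / 12) * (9 * hold_moment \<delta> (w x) * ?T)
     \<le> 27 * moment_upto x * ?T * exp (- gap_upto (Suc x) * t\<^sup>2 / 12)
     + (3 * exp (- gap_upto (Suc x) * t\<^sup>2 / 12)) * (9 * hold_moment \<delta> (w x) * ?T)"
    using hm e3 by (intro add_left_mono mult_right_mono) auto
  also have "\<dots> = 27 * moment_upto (Suc x) * ?T * exp (- gap_upto (Suc x) * t\<^sup>2 / 12)"
    by (simp add: moment_upto_def algebra_simps)
  finally show ?case .
qed

theorem arrival_local_limit:
  assumes G: "0 < gap_upto x"
  shows "\<bar>pmf (arrival w x) l - normal_density (mean_upto x) (sqrt (var_upto x)) (real l)\<bar>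
    \<le> 13000 * (moment_upto x + 1) * gap_upto x powr (- (3 + \<delta>) / 2)"
proof -
  define G where "G = gap_upto x"
  define V where "V = var_upto x"
  define p where "p = 2 + \<delta>"
  define d where "d = mean_upto x - real l"
  have G0: "0 < G" using G by (simp add: G_def)
  have GV: "G \<le> V" unfolding G_def V_def by (rule gap_upto_le_var)
  have V0: "0 < V" using G0 GV by linarith
  define g where "g = (\<lambda>t. indicator {-pi..pi} t *\<^sub>R (cis (- (t * real l)) * cf (arrival w x) t))"
  define h where "h = (\<lambda>t. cis (t * d) * of_real (exp (- V * t\<^sup>2 / 2)))"
  define C where "C = (27 * moment_upto x + 1) * (240 * G powr (- p / 2))"
  note gi = pmf_fourier_inversion[of l "arrival w x", folded g_def]
  note hi = gaussian_fourier[OF V0, of d, folded h_def]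
  have nd: "normal_density (mean_upto x) (sqrt V) (real l) = normal_density 0 (sqrt V) d"
    by (simp add: normal_density_def d_def power2_commute)
  have pt: "cmod (g t - h t) \<le> C * exp (- G * t\<^sup>2 / 24)" for t
  proof -
    have "cmod (g t - h t) \<le> (27 * moment_upto x + 1) * (\<bar>t\<bar> powr p * exp (- G * t\<^sup>2 / 12))"
    proof (cases "\<bar>t\<bar> \<le> pi")
      case True
      have "h t = cis (- (t * real l)) * gauss_cf x t"
        by (simp add: h_def gauss_cf_def d_def V_def cis_mult algebra_simps)
      then have "g t - h t = cis (- (t * real l)) * (cf (arrival w x) t - gauss_cf x t)"
        using True by (simp add: g_def abs_le_iff algebra_simps)
      then have "cmod (g t - h t) = cmod (cf (arrival w x) t - gauss_cf x t)" by (simp add: norm_mult)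
      also have "\<dots> \<le> 27 * moment_upto x * (\<bar>t\<bar> powr p * exp (- G * t\<^sup>2 / 12))"
        using cf_arrival_approx[OF True, of x] by (simp add: p_def G_def mult_ac)
      also have "\<dots> \<le> (27 * moment_upto x + 1) * (\<bar>t\<bar> powr p * exp (- G * t\<^sup>2 / 12))"
        by (intro mult_right_mono) auto
      finally show ?thesis .
    next
      \<comment> \<open>Beyond the period only the Gaussian is left. There
        \<open>\<bar>t\<bar> powr p \<ge> 1\<close>, so its tail obeys the same kind of bound and is
        absorbed by the \<open>+ 1\<close>.\<close>
      case False
      then have "cmod (g t - h t) = exp (- V * t\<^sup>2 / 2)" by (auto simp: g_def h_def norm_mult indicator_def)
      also have "\<dots> \<le> 1 * exp (- G * t\<^sup>2 / 12)"
      proof -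
        have "G / 12 * t\<^sup>2 \<le> V / 2 * t\<^sup>2" using GV G0 by (intro mult_right_mono) auto
        then show ?thesis by simp
      qed
      also have "\<dots> \<le> \<bar>t\<bar> powr p * exp (- G * t\<^sup>2 / 12)"
        using False pi_gt3 \<delta> by (intro mult_right_mono ge_one_powr_ge_zero) (auto simp: p_def)
      also have "\<dots> \<le> (27 * moment_upto x + 1) * (\<bar>t\<bar> powr p * exp (- G * t\<^sup>2 / 12))"
      proof -
        have "1 * (\<bar>t\<bar> powr p * exp (- G * t\<^sup>2 / 12)) \<le> (27 * moment_upto x + 1) * (\<bar>t\<bar> powr p * exp (- G * t\<^sup>2 / 12))"
          using moment_upto_nonneg[of x] by (intro mult_right_mono) auto
        then show ?thesis by simp
      qed
      finally show ?thesis .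
    qed
    also have "\<dots> \<le> (27 * moment_upto x + 1) * (240 * G powr (- p / 2) * exp (- G * t\<^sup>2 / 24))"
      using moment_upto_nonneg[of x] \<delta> by (intro mult_left_mono powr_gaussian_le G0) (auto simp: p_def)
    finally show ?thesis by (simp only: C_def mult.assoc)
  qed
  have C0: "0 \<le> C" using moment_upto_nonneg[of x] by (simp add: C_def)
  have "complex_of_real (2 * pi * (pmf (arrival w x) l - normal_density 0 (sqrt V) d)) = (\<integral>t. g t - h t \<partial>lborel)"
    unfolding Bochner_Integration.integral_diff[OF gi(1) hi(1)] gi(2) hi(2) by (simp add: algebra_simps)
  then have "\<bar>2 * pi * (pmf (arrival w x) l - normal_density 0 (sqrt V) d)\<bar> = cmod (\<integral>t. g t - h t \<partial>lborel)"
    by (metis norm_of_real)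
  also have "\<dots> \<le> (\<integral>t. cmod (g t - h t) \<partial>lborel)" by (rule integral_norm_bound)
  also have "\<dots> \<le> (\<integral>t. C * exp (- G * t\<^sup>2 / 24) \<partial>lborel)"
    using gi(1) hi(1) gaussian_integral(1)[OF G0] pt by (intro integral_mono) auto
  also have "\<dots> = C * (\<integral>t. exp (- G * t\<^sup>2 / 24) \<partial>lborel)" by simp
  also have "\<dots> \<le> C * (2 * pi * (2 * G powr (- 1 / 2)))"
    using gaussian_integral(2)[OF G0] C0 by (intro mult_left_mono)
  finally have "2 * pi * \<bar>pmf (arrival w x) l - normal_density 0 (sqrt V) d\<bar> \<le> 2 * pi * (C * (2 * G powr (- 1 / 2)))"
    by (simp add: abs_mult mult_ac)
  then have "\<bar>pmf (arrival w x) l - normal_density 0 (sqrt V) d\<bar> \<le> C * (2 * G powr (- 1 / 2))"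
    by (rule mult_left_le_imp_le) simp
  also have "\<dots> = (27 * moment_upto x + 1) * 480 * G powr (- (3 + \<delta>) / 2)"
    unfolding C_def p_def by (simp add: powr_add[symmetric] add_divide_distrib diff_divide_distrib)
  \<comment> \<open>\<open>27 * 480 = 12960\<close>.\<close>
  also have "\<dots> \<le> 13000 * (moment_upto x + 1) * G powr (- (3 + \<delta>) / 2)"
    using moment_upto_nonneg[of x] by (intro mult_right_mono) auto
  finally show ?thesis unfolding nd[symmetric] unfolding G_def V_def .
qed

end

section \<open>The position of the walk\<close>

text \<open>The transition law is prescribed given whole histories of positive probability. Summing
  over the countably many histories up to time \<open>n\<close> leaves only the last state; null
  histories contribute 0 to both sides.\<close>

lemma markov_chain_step:
  fixes Z :: "nat \<Rightarrow> 'b \<Rightarrow> 's::countable"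
  assumes mc: "markov_chain N Z p0 p"
  shows "measure N {\<xi>\<in>space N. Z n \<xi> = z \<and> Z (Suc n) \<xi> = z'} = measure N {\<xi>\<in>space N. Z n \<xi> = z} * p z z'"
proof -
  interpret prob_space N using mc by (simp add: markov_chain_def)
  have Zm[measurable]: "\<And>n. Z n \<in> N \<rightarrow>\<^sub>M count_space UNIV" using mc by (simp add: markov_chain_def)
  define H where "H \<xi> = map (\<lambda>i. Z i \<xi>) [0..<Suc n]" for \<xi>
  have He: "H \<xi> = h \<longleftrightarrow> length h = Suc n \<and> (\<forall>i\<le>n. Z i \<xi> = h ! i)" for \<xi> h
    unfolding H_def by (auto simp: list_eq_iff_nth_eq less_Suc_eq_le simp del: upt_Suc)
  have Hs: "{\<xi>\<in>space N. H \<xi> = h \<and> P \<xi>} \<in> sets N" if [measurable]: "Measurable.pred N P" for h P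
    unfolding He by measurable
  have step: "prob {\<xi>\<in>space N. H \<xi> = h \<and> (Z n \<xi> = z \<and> Z (Suc n) \<xi> = z')} = prob {\<xi>\<in>space N. H \<xi> = h \<and> Z n \<xi> = z} * p z z'" for h
  proof (cases "length h = Suc n \<and> h ! n = z")
    case False
    then have "{\<xi>\<in>space N. H \<xi> = h \<and> (Z n \<xi> = z \<and> Z (Suc n) \<xi> = z')} = {}" "{\<xi>\<in>space N. H \<xi> = h \<and> Z n \<xi> = z} = {}"
      unfolding He by auto
    then show ?thesis by (simp only: measure_empty mult_zero_left)
  next
    case True
    have e1: "{\<xi>\<in>space N. H \<xi> = h \<and> (Z n \<xi> = z \<and> Z (Suc n) \<xi> = z')} = {\<xi>\<in>space N. Z (Suc n) \<xi> = z' \<and> (\<forall>i\<le>n. Z i \<xi> = h ! i)}"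
      and e2: "{\<xi>\<in>space N. H \<xi> = h \<and> Z n \<xi> = z} = {\<xi>\<in>space N. \<forall>i\<le>n. Z i \<xi> = h ! i}"
      using True unfolding He by auto
    show ?thesis
    proof (cases "prob {\<xi>\<in>space N. \<forall>i\<le>n. Z i \<xi> = h ! i} > 0")
      case pos: True
      then have "cond_prob N (\<lambda>\<xi>. Z (Suc n) \<xi> = z') (\<lambda>\<xi>. \<forall>i\<le>n. Z i \<xi> = h ! i) = p (h ! n) z'"
        using mc unfolding markov_chain_def by blast
      then show ?thesis unfolding e1 e2 cond_prob_def using pos True by (simp add: field_simps)
    next
      case False
      then have 0: "prob {\<xi>\<in>space N. \<forall>i\<le>n. Z i \<xi> = h ! i} = 0" by (simp add: not_less measure_le_0_iff)
      have "prob {\<xi>\<in>space N. Z (Suc n) \<xi> = z' \<and> (\<forall>i\<le>n. Z i \<xi> = h ! i)} \<le> prob {\<xi>\<in>space N. \<forall>i\<le>n. Z i \<xi> = h ! i}"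
        by (intro finite_measure_mono) (auto intro: measurable_sets)
      then show ?thesis unfolding e1 e2 using 0 by (simp add: measure_le_0_iff)
    qed
  qed
  \<comment> \<open>Histories are enumerated by their codes. Requiring
    \<open>to_nat (H \<xi>) = k\<close> discards numbers that code no history and makes the sets
    disjoint.\<close>
  have tot: "(\<lambda>k. prob {\<xi>\<in>space N. H \<xi> = from_nat k \<and> P \<xi> \<and> to_nat (H \<xi>) = k}) sums prob {\<xi>\<in>space N. P \<xi>}"
    if P[measurable]: "Measurable.pred N P" for P
  proof -
    let ?A = "\<lambda>k. {\<xi>\<in>space N. H \<xi> = from_nat k \<and> P \<xi> \<and> to_nat (H \<xi>) = k}"
    have Ae: "?A k = (if to_nat (from_nat k :: 's list) = k then {\<xi>\<in>space N. H \<xi> = from_nat k \<and> P \<xi>} else {})" for k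
      by auto
    have "range ?A \<subseteq> sets N"
      unfolding Ae using Hs[OF P] by auto
    moreover have "disjoint_family ?A" by (auto simp: disjoint_family_on_def)
    ultimately have "(\<lambda>k. prob (?A k)) sums prob (\<Union>k. ?A k)" by (rule finite_measure_UNION)
    moreover have "(\<Union>k. ?A k) = {\<xi>\<in>space N. P \<xi>}" by auto
    ultimately show ?thesis by simp
  qed
  have s1: "(\<lambda>k. prob {\<xi>\<in>space N. H \<xi> = from_nat k \<and> Z n \<xi> = z \<and> to_nat (H \<xi>) = k} * p z z') sums (prob {\<xi>\<in>space N. Z n \<xi> = z} * p z z')"
    by (intro sums_mult2 tot) measurable
  have eq: "prob {\<xi>\<in>space N. H \<xi> = from_nat k \<and> Z n \<xi> = z \<and> to_nat (H \<xi>) = k} * p z z'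
     = prob {\<xi>\<in>space N. H \<xi> = from_nat k \<and> (Z n \<xi> = z \<and> Z (Suc n) \<xi> = z') \<and> to_nat (H \<xi>) = k}" for k
  proof (cases "to_nat (from_nat k :: 's list) = k")
    case True
    then have "{\<xi>\<in>space N. H \<xi> = from_nat k \<and> P \<xi> \<and> to_nat (H \<xi>) = k} = {\<xi>\<in>space N. H \<xi> = from_nat k \<and> P \<xi>}" for P
      by auto
    then show ?thesis using step[of "from_nat k"] by (simp only:)
  next
    case False
    then have "{\<xi>\<in>space N. H \<xi> = from_nat k \<and> P \<xi> \<and> to_nat (H \<xi>) = k} = {}" for P
      by auto
    then show ?thesis by (simp only: measure_empty mult_zero_left)
  qed
  have s2: "(\<lambda>k. prob {\<xi>\<in>space N. H \<xi> = from_nat k \<and> (Z n \<xi> = z \<and> Z (Suc n) \<xi> = z') \<and> to_nat (H \<xi>) = k}) sums prob {\<xi>\<in>space N. Z n \<xi> = z \<and> Z (Suc n) \<xi> = z'}"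
    by (intro tot) measurable
  show ?thesis using sums_unique2[OF s2 s1[unfolded eq]] .
qed

text \<open>States outside \<open>S\<close> give countably many null sets, so the total probability
  formula becomes a finite sum. For the walk \<open>S\<close> has at most two elements: one step
  down at the same site, or a jump from the site before.\<close>

lemma markov_chain_finite_predecessors:
  assumes mc: "markov_chain N Z p0 p" and S: "finite S" "\<And>z. z \<notin> S \<Longrightarrow> p z z' = 0"
  shows "measure N {\<xi>\<in>space N. Z (Suc n) \<xi> = z'} = (\<Sum>z\<in>S. measure N {\<xi>\<in>space N. Z n \<xi> = z} * p z z')"
proof -
  interpret prob_space N using mc by (simp add: markov_chain_def)
  have Zm[measurable]: "\<And>n. Z n \<in> N \<rightarrow>\<^sub>M count_space UNIV" using mc by (simp add: markov_chain_def)
  let ?A = "\<lambda>z. {\<xi>\<in>space N. Z n \<xi> = z \<and> Z (Suc n) \<xi> = z'}"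
  have "(\<Union>z\<in>-S. ?A z) \<in> null_sets N"
  proof (rule null_sets_UN')
    fix z assume "z \<in> - S"
    then have "prob (?A z) = 0" using markov_chain_step[OF mc, of n z z'] S(2) by simp
    then show "?A z \<in> null_sets N" by (simp add: null_setsI emeasure_eq_measure)
  qed auto
  then have 0: "prob (\<Union>z\<in>-S. ?A z) = 0" and m: "(\<Union>z\<in>-S. ?A z) \<in> sets N" by (auto simp: measure_eq_0_null_sets)
  have "{\<xi>\<in>space N. Z (Suc n) \<xi> = z'} = (\<Union>z\<in>S. ?A z) \<union> (\<Union>z\<in>-S. ?A z)" by auto
  also have "prob \<dots> = prob (\<Union>z\<in>S. ?A z)"
    using m 0 S(1) by (subst finite_measure_Union) auto
  also have "\<dots> = (\<Sum>z\<in>S. prob (?A z))"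
    using S(1) by (intro finite_measure_finite_Union) (auto simp: disjoint_family_on_def)
  finally show ?thesis using markov_chain_step[OF mc] by simp
qed

context
  fixes N :: "'b measure" and Z :: "nat \<Rightarrow> 'b \<Rightarrow> nat \<times> nat" and w :: "nat \<Rightarrow> nat \<Rightarrow> real"
  assumes mc: "markov_chain N Z (walk_init w) (walk_trans w)" and env: "\<And>x. w x \<in> Omega0"
begin

lemma arrival_pos_zero: "pmf (arrival w (Suc x)) 0 = 0"
  by (simp add: pmf_arrival_Suc pmf_hold[OF env] del: arrival.simps)

text \<open>Being at \<open>(x, y)\<close> at time \<open>n\<close> after arriving at time
  \<open>l\<close> means a total holding time \<open>n - l + y + 1\<close>: \<open>n - l\<close>
  steps already spent, \<open>y\<close> still to count down, and one for the jump.\<close>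

lemma walk_pmf:
  "measure N {\<xi>\<in>space N. Z n \<xi> = (x, y)} = (\<Sum>l\<le>n. pmf (arrival w x) l * pmf (hold (w x)) (Suc (y + (n - l))))"
proof (induction n arbitrary: x y)
  case 0
  have "measure N {\<xi>\<in>space N. Z 0 \<xi> = (x, y)} = walk_init w (x, y)"
    using mc by (simp add: markov_chain_def)
  moreover have "pmf (arrival w x) 0 = (if x = 0 then 1 else 0)"
    using arrival_pos_zero by (cases x) (simp_all del: arrival.simps(2))
  ultimately show ?case by (simp add: walk_init_def pmf_hold_Suc[OF env])
next
  case (Suc n)
  have first: "(\<Sum>l\<le>n. pmf (arrival w x) l * pmf (hold (w x)) (Suc (Suc y + (n - l))))
     = (\<Sum>l\<le>n. pmf (arrival w x) l * pmf (hold (w x)) (Suc (y + (Suc n - l))))"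
    by (intro sum.cong) (auto simp: Suc_diff_le)
  show ?case
  proof (cases x)
    case 0
    have "measure N {\<xi>\<in>space N. Z (Suc n) \<xi> = (x, y)} = (\<Sum>z\<in>{(x, Suc y)}. measure N {\<xi>\<in>space N. Z n \<xi> = z} * walk_trans w z (x, y))"
      by (rule markov_chain_finite_predecessors[OF mc]) (auto simp: walk_trans_def 0 split: if_splits)
    then show ?thesis using first by (simp add: Suc.IH walk_trans_def 0)
  next
    case (Suc x')
    have "measure N {\<xi>\<in>space N. Z (Suc n) \<xi> = (x, y)} = (\<Sum>z\<in>{(x, Suc y), (x', 0)}. measure N {\<xi>\<in>space N. Z n \<xi> = z} * walk_trans w z (x, y))"
      by (rule markov_chain_finite_predecessors[OF mc]) (auto simp: walk_trans_def Suc split: if_splits)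
    also have "\<dots> = (\<Sum>l\<le>n. pmf (arrival w x) l * pmf (hold (w x)) (Suc (y + (Suc n - l))))
        + (\<Sum>l\<le>n. pmf (arrival w x') l * pmf (hold (w x')) (Suc n - l)) * pmf (hold (w x)) (Suc y)"
    proof -
      have "(\<Sum>l\<le>n. pmf (arrival w x') l * pmf (hold (w x')) (Suc (0 + (n - l)))) = (\<Sum>l\<le>n. pmf (arrival w x') l * pmf (hold (w x')) (Suc n - l))"
        by (intro sum.cong) (auto simp: Suc_diff_le)
      then show ?thesis using first by (simp add: Suc.IH walk_trans_def Suc pmf_hold_Suc[OF env])
    qed
    \<comment> \<open>Leaving \<open>x'\<close> exactly at time \<open>Suc n\<close> is arriving at
      \<open>x\<close> then. The extra summand \<open>l = Suc n\<close> of the convolution vanishes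
      because holding times are positive.\<close>
    also have "(\<Sum>l\<le>n. pmf (arrival w x') l * pmf (hold (w x')) (Suc n - l)) = pmf (arrival w x) (Suc n)"
      unfolding Suc pmf_arrival_Suc by (simp add: pmf_hold[OF env])
    finally show ?thesis by simp
  qed
qed

text \<open>Summing \<open>walk_pmf\<close> over \<open>y\<close> telescopes the holding masses into
  the tail \<open>w x (n - l)\<close>.\<close>

lemma walk_position_prob:
  "measure N {\<xi>\<in>space N. fst (Z n \<xi>) = x} = (\<Sum>l\<le>n. pmf (arrival w x) l * w x (n - l))"
proof -
  interpret prob_space N using mc by (simp add: markov_chain_def)
  have Zm[measurable]: "\<And>n. Z n \<in> N \<rightarrow>\<^sub>M count_space UNIV" using mc by (simp add: markov_chain_def)
  let ?A = "\<lambda>y. {\<xi>\<in>space N. Z n \<xi> = (x, y)}"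
  have "(\<Union>y. ?A y) = {\<xi>\<in>space N. fst (Z n \<xi>) = x}" by (auto simp: prod_eq_iff)
  moreover have "(\<lambda>y. prob (?A y)) sums prob (\<Union>y. ?A y)"
    by (rule finite_measure_UNION) (auto simp: disjoint_family_on_def)
  ultimately have s1: "(\<lambda>y. prob (?A y)) sums prob {\<xi>\<in>space N. fst (Z n \<xi>) = x}" by (simp only:)
  have s2: "(\<lambda>y. prob (?A y)) sums (\<Sum>l\<le>n. pmf (arrival w x) l * w x (n - l))"
    unfolding walk_pmf
  proof (intro sums_sum sums_mult)
    fix l
    have "(\<lambda>y. w x (y + (n - l))) \<longlonglongrightarrow> 0" by (rule LIMSEQ_ignore_initial_segment[OF Omega0_props(5)[OF env]])
    from telescope_sums'[OF this] show "(\<lambda>y. pmf (hold (w x)) (Suc (y + (n - l)))) sums w x (n - l)"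
      by (simp add: pmf_hold_Suc[OF env])
  qed
  show ?thesis by (rule sums_unique2[OF s1 s2])
qed

end

section \<open>Comparison with the Gaussian kernel\<close>

lemma mult_exp_minus_le_one: "0 \<le> z \<Longrightarrow> z * exp (- z) \<le> 1" for z :: real
proof -
  assume z: "0 \<le> z"
  have "z * exp (- z) \<le> exp z * exp (- z)" using exp_ge_add_one_self[of z] by (intro mult_right_mono, linarith, simp)
  then show ?thesis by (simp add: exp_minus)
qed

lemma normal_density_zero: "0 < V \<Longrightarrow> normal_density 0 (sqrt V) d = 1 / sqrt (2 * pi) * V powr (- 1 / 2) * exp (- d\<^sup>2 / (2 * V))"
  by (simp add: normal_density_def real_sqrt_mult powr_minus_divide powr_half_sqrt)

lemma inverse_sqrt_two_pi_le: "1 / sqrt (2 * pi) \<le> 1 / 2"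
proof -
  have 2: "2 \<le> sqrt (2 * pi)" using pi_gt3 by (intro real_le_rsqrt) simp
  show ?thesis by (rule divide_left_mono[OF 2]) simp_all
qed

lemma normal_density_le:
  assumes "0 < V" shows "normal_density 0 (sqrt V) d \<le> V powr (- 1 / 2) * exp (- d\<^sup>2 / (2 * V))"
proof -
  have "1 / sqrt (2 * pi) * (V powr (- 1 / 2) * exp (- d\<^sup>2 / (2 * V))) \<le> 1 * (V powr (- 1 / 2) * exp (- d\<^sup>2 / (2 * V)))"
  proof (rule mult_right_mono)
    show "1 / sqrt (2 * pi) \<le> 1" using inverse_sqrt_two_pi_le by linarith
  qed simp
  then show ?thesis by (simp add: normal_density_zero[OF assms])
qed

lemma normal_density_lipschitz_mean:
  assumes V: "0 < V"
  shows "\<bar>normal_density 0 (sqrt V) d - normal_density 0 (sqrt V) e\<bar> \<le> \<bar>d - e\<bar> / V"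
proof -
  let ?c = "1 / sqrt (2 * pi)"
  define f' where "f' d = ?c * V powr (- 1 / 2) * (- d / V * exp (- d\<^sup>2 / (2 * V)))" for d
  have "norm (normal_density 0 (sqrt V) d - normal_density 0 (sqrt V) e) \<le> (1 / V) * norm (d - e)"
  proof (rule field_differentiable_bound[where S=UNIV and f'=f'])
    fix z :: real
    show "(normal_density 0 (sqrt V) has_field_derivative f' z) (at z within UNIV)"
    proof -
      have "((\<lambda>d. exp (- d\<^sup>2 / (2 * V))) has_real_derivative - z / V * exp (- z\<^sup>2 / (2 * V))) (at z)"
        using V by (auto intro!: derivative_eq_intros)
      from DERIV_cmult[OF this, of "?c * V powr (- 1 / 2)"] show ?thesis
        unfolding normal_density_zero[OF V, abs_def] f'_def by (simp only: mult.assoc)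
    qed
    define y where "y = \<bar>z\<bar> / sqrt V"
    have y: "y\<^sup>2 = z\<^sup>2 / V" using V by (simp add: y_def power_divide)
    have Y: "y * exp (- (y\<^sup>2 / 2)) \<le> 2"
    proof -
      have "y \<le> 1 + y\<^sup>2 / 2" using sum_squares_bound[of y 1] zero_le_power2[of "y - 1"] by (simp add: power2_eq_square algebra_simps)
      also have "\<dots> \<le> exp (y\<^sup>2 / 2)" by (rule exp_ge_add_one_self)
      finally have "y * exp (- (y\<^sup>2 / 2)) \<le> exp (y\<^sup>2 / 2) * exp (- (y\<^sup>2 / 2))" by (intro mult_right_mono) auto
      then show ?thesis by (simp add: exp_minus)
    qed
    have nf: "norm (f' z) = ?c * (y * exp (- (y\<^sup>2 / 2))) / V"
    proof -
      have E: "exp (- z\<^sup>2 / (2 * V)) = exp (- (y\<^sup>2 / 2))" using y by simp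
      have "norm (f' z) = ?c * (y * exp (- z\<^sup>2 / (2 * V))) / V"
        using V by (simp add: f'_def abs_mult y_def powr_minus_divide powr_half_sqrt)
      then show ?thesis unfolding E .
    qed
    have "0 \<le> y * exp (- (y\<^sup>2 / 2))" using V by (simp add: y_def)
    then have "?c * (y * exp (- (y\<^sup>2 / 2))) \<le> 1 / 2 * 2"
      by (intro mult_mono inverse_sqrt_two_pi_le Y) auto
    then show "norm (f' z) \<le> 1 / V"
      unfolding nf using V by (intro divide_right_mono) auto
  qed auto
  then show ?thesis by simp
qed

lemma normal_density_lipschitz_var:
  assumes v: "0 < v" "v \<le> V" "v \<le> W"
  shows "\<bar>normal_density 0 (sqrt V) d - normal_density 0 (sqrt W) d\<bar> \<le> \<bar>V - W\<bar> * v powr (- 3 / 2)"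
proof -
  let ?c = "1 / sqrt (2 * pi)"
  define f where "f V = ?c * V powr (- 1 / 2) * exp (- d\<^sup>2 / (2 * V))" for V
  define f' where "f' V = ?c * (V powr (- 3 / 2) * (- 1 / 2 + d\<^sup>2 / (2 * V)) * exp (- d\<^sup>2 / (2 * V)))" for V
  have "norm (f V - f W) \<le> v powr (- 3 / 2) * norm (V - W)"
  proof (rule field_differentiable_bound[where S="{v..}" and f'=f'])
    fix z assume "z \<in> {v..}"
    then have z: "v \<le> z" "0 < z" using v by auto
    have p: "z powr (- 1 / 2) = z powr (- 3 / 2) * z"
      using z powr_mult_base[of z "- 3 / 2"] by (simp add: mult.commute)
    have 1: "((\<lambda>z. z powr (- 1 / 2)) has_real_derivative - 1 / 2 * z powr (- 3 / 2)) (at z)"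
      using has_real_derivative_powr[OF z(2), of "- 1 / 2"] by simp
    have 2: "((\<lambda>z. exp (- d\<^sup>2 / (2 * z))) has_real_derivative exp (- d\<^sup>2 / (2 * z)) * (d\<^sup>2 / (2 * z\<^sup>2))) (at z)"
      using z by (auto intro!: derivative_eq_intros simp: power2_eq_square)
    have "(f has_real_derivative ?c * (- 1 / 2 * z powr (- 3 / 2) * exp (- d\<^sup>2 / (2 * z)) + exp (- d\<^sup>2 / (2 * z)) * (d\<^sup>2 / (2 * z\<^sup>2)) * z powr (- 1 / 2))) (at z)"
      using DERIV_cmult[OF DERIV_mult[OF 1 2], of ?c] unfolding f_def[abs_def] by (simp only: mult.assoc)
    moreover have "- 1 / 2 * z powr (- 3 / 2) * exp (- d\<^sup>2 / (2 * z)) + exp (- d\<^sup>2 / (2 * z)) * (d\<^sup>2 / (2 * z\<^sup>2)) * z powr (- 1 / 2)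
        = z powr (- 3 / 2) * (- 1 / 2 + d\<^sup>2 / (2 * z)) * exp (- d\<^sup>2 / (2 * z))"
    proof -
      have "- 1 / 2 * A * E + E * q * (A * z) = A * (- 1 / 2 + r) * E" if "q * z = r" for q r A E :: real
        by (simp add: that[symmetric] algebra_simps)
      moreover have "d\<^sup>2 / (2 * z\<^sup>2) * z = d\<^sup>2 / (2 * z)" using z by (simp add: power2_eq_square)
      ultimately show ?thesis unfolding p by blast
    qed
    ultimately show "(f has_field_derivative f' z) (at z within {v..})"
      unfolding f'_def by (simp only: has_field_derivative_at_within)
    define y where "y = d\<^sup>2 / (2 * z)"
    have y: "0 \<le> y" using z by (simp add: y_def)
    have e: "f' z = ?c * (z powr (- 3 / 2) * ((- 1 / 2 + y) * exp (- y)))"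
      by (simp add: f'_def y_def)
    have "\<bar>(- 1 / 2 + y) * exp (- y)\<bar> \<le> 2"
    proof -
      have "\<bar>(- 1 / 2 + y) * exp (- y)\<bar> \<le> 1 / 2 * exp (- y) + y * exp (- y)"
        unfolding abs_mult abs_exp_cancel distrib_right[symmetric] using y by (intro mult_right_mono) auto
      also have "\<dots> \<le> 1 / 2 * 1 + 1" using y by (intro add_mono mult_left_mono mult_exp_minus_le_one) auto
      finally show ?thesis by simp
    qed
    then have "?c * (z powr (- 3 / 2) * \<bar>(- 1 / 2 + y) * exp (- y)\<bar>) \<le> 1 / 2 * (v powr (- 3 / 2) * 2)"
      using inverse_sqrt_two_pi_le z v by (intro mult_mono powr_mono2') auto
    then show "norm (f' z) \<le> v powr (- 3 / 2)" unfolding e by (simp add: abs_mult)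
  qed (use v in auto)
  then show ?thesis using v by (simp add: f_def normal_density_zero mult.commute)
qed

text \<open>With \<open>v\<close> of order \<open>n\<close>, centres known up to
  \<open>n powr (1 / 2 - \<kappa>)\<close> and variances up to \<open>n powr (1 - \<kappa>)\<close>
  both cost \<open>n powr (- 1 / 2 - \<kappa>)\<close>. This is why cruder information on the
  variances suffices.\<close>

lemma normal_density_diff_le:
  assumes v: "0 < v" "v \<le> V" "v \<le> W"
  shows "\<bar>normal_density 0 (sqrt V) d - normal_density 0 (sqrt W) e\<bar> \<le> \<bar>d - e\<bar> / v + \<bar>V - W\<bar> * v powr (- 3 / 2)"
proof -
  have "\<bar>normal_density 0 (sqrt W) d - normal_density 0 (sqrt W) e\<bar> \<le> \<bar>d - e\<bar> / v"
    using normal_density_lipschitz_mean[of W d e] v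
    by (smt (verit) divide_left_mono mult_pos_pos abs_ge_zero)
  then show ?thesis using normal_density_lipschitz_var[OF v, of d] by linarith
qed

text \<open>The interval is cut into blocks of length \<open>\<lfloor>L\<rfloor>\<close>; as
  \<open>L \<ge> 1\<close>, this is at least \<open>L / 2\<close>, hence the factor 2.\<close>

lemma interval_bound_by_blocks:
  fixes F :: "nat \<Rightarrow> real" and L :: real
  assumes short: "\<And>a b. a \<le> b \<Longrightarrow> b \<le> N \<Longrightarrow> real (b - a) \<le> L \<Longrightarrow> \<bar>F b - F a\<bar> \<le> c"
    and L: "1 \<le> L" and c: "0 \<le> c" and ab: "a \<le> b" "b \<le> N"
  shows "\<bar>F b - F a\<bar> \<le> (2 * real (b - a) / L + 1) * c"
proof -
  define D where "D = nat \<lfloor>L\<rfloor>"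
  have D: "1 \<le> D" "real D \<le> L" "L \<le> 2 * real D"
  proof -
    show D1: "1 \<le> D" "real D \<le> L" using L unfolding D_def by linarith+
    have "L \<le> real D + 1" using L unfolding D_def by linarith
    then show "L \<le> 2 * real D" using D1(1) by linarith
  qed
  define k where "k = (b - a) div D"
  have i: "\<bar>F (a + j * D) - F a\<bar> \<le> real j * c" if "j \<le> k" for j
    using that
  proof (induction j)
    case (Suc j)
    have "Suc j * D \<le> k * D" using Suc.prems by (intro mult_le_mono1)
    then have "Suc j * D \<le> b - a" unfolding k_def by (rule order_trans) (rule div_times_less_eq_dividend)
    then have "\<bar>F (a + Suc j * D) - F (a + j * D)\<bar> \<le> c"
      using ab D by (intro short) auto
    then show ?case using Suc.IH Suc.prems by (simp add: algebra_simps)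
  qed simp
  have kD: "k * D \<le> b - a" "b - a < k * D + D"
    using D div_mult_mod_eq[of "b - a" D] mod_less_divisor[of D "b - a"] unfolding k_def by linarith+
  have "\<bar>F b - F (a + k * D)\<bar> \<le> c"
  proof (rule short)
    have "b - (a + k * D) \<le> D" using kD by linarith
    then show "real (b - (a + k * D)) \<le> L" using D(2) by (meson of_nat_le_iff order_trans)
  qed (use kD ab in auto)
  then have "\<bar>F b - F a\<bar> \<le> (real k + 1) * c" using i[of k] by (simp add: algebra_simps)
  also have "real k \<le> 2 * real (b - a) / L"
  proof -
    have "real k * real D \<le> real (b - a)" using kD(1) by (metis of_nat_le_iff of_nat_mult)
    moreover have "real k * L \<le> real k * (2 * real D)" using D by (intro mult_left_mono) auto
    ultimately have "real k * L \<le> 2 * real (b - a)" by linarith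
    then show ?thesis using L by (simp add: le_divide_eq)
  qed
  finally show ?thesis using c by (simp add: mult_right_mono)
qed

section \<open>The index \<open>M_env\<close> and regular environments\<close>

lemma (in walk_environment) mu_env_eq: "mu_env w x = mean_upto x"
  by (simp add: mu_env_def m_env_def mean_upto_def hold_mean_def)

lemma (in walk_environment) mean_upto_ge: "real x \<le> mean_upto x"
proof -
  have "(\<Sum>u<x. 1) \<le> mean_upto x" unfolding mean_upto_def by (intro sum_mono hold_mean_ge env sq)
  then show ?thesis by simp
qed

text \<open>Holding means are at least 1, so the infimum is over a set containing \<open>l\<close>.
  By minimality the overshoot over \<open>l\<close> is at most the last holding mean added.\<close>

lemma (in walk_environment) M_env_bounds:
  assumes "1 \<le> l"
  shows "M_env w l \<le> l" "real l \<le> mean_upto (M_env w l)" "1 \<le> M_env w l"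
    "mean_upto (M_env w l) \<le> real l + hold_mean (w (M_env w l - 1))"
proof -
  let ?S = "{x. real l \<le> mean_upto x}"
  have e: "M_env w l = Inf ?S" by (simp add: M_env_def mu_env_eq)
  have l: "l \<in> ?S" using mean_upto_ge by simp
  show "M_env w l \<le> l" unfolding e by (rule cInf_lower[OF l]) auto
  have M: "M_env w l \<in> ?S" unfolding e by (rule Inf_nat_def1) (use l in auto)
  then show "real l \<le> mean_upto (M_env w l)" by simp
  show 1: "1 \<le> M_env w l"
  proof (rule ccontr)
    assume "\<not> 1 \<le> M_env w l"
    then have "M_env w l = 0" by simp
    then show False using M assms by (simp add: mean_upto_def)
  qed
  have "M_env w l - 1 \<notin> ?S"
  proof
    assume "M_env w l - 1 \<in> ?S"
    then have "M_env w l \<le> M_env w l - 1" unfolding e by (intro cInf_lower) auto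
    then show False using 1 by simp
  qed
  moreover have "mean_upto (M_env w l) = mean_upto (M_env w l - 1) + hold_mean (w (M_env w l - 1))"
    using 1 by (cases "M_env w l") (auto simp: mean_upto_def)
  ultimately show "mean_upto (M_env w l) \<le> real l + hold_mean (w (M_env w l - 1))" by simp
qed

text \<open>As \<open>w x\<close> decreases and \<open>(real k)\<^sup>2\<close> is the sum of the
  first \<open>k\<close> odd numbers, the first \<open>k\<close> terms of \<open>hold_second\<close>
  already contain \<open>(real k)\<^sup>2 * w x k\<close>.\<close>

lemma (in walk_environment) tail_le_second:
  assumes "0 < k" shows "w x k \<le> hold_second (w x) / (real k)\<^sup>2"
proof -
  have pos: "0 < w x j" for j by (rule Omega0_props(1)[OF env])
  have dec: "w x k \<le> w x j" if "j \<le> k" for j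
    using that by (rule lift_Suc_antimono_le[where f="w x", rotated]) (simp add: less_imp_le Omega0_props(4)[OF env])
  have "(\<Sum>j<k. 2 * real j + 1) = (real k)\<^sup>2"
    by (induction k) (auto simp: power2_eq_square algebra_simps)
  then have "(real k)\<^sup>2 * w x k = (\<Sum>j<k. (2 * real j + 1) * w x k)"
    by (simp only: sum_distrib_right[symmetric])
  also have "\<dots> \<le> (\<Sum>j<k. (2 * real j + 1) * w x j)" using dec by (intro sum_mono mult_left_mono) auto
  also have "\<dots> \<le> hold_second (w x)" unfolding hold_second_def
    by (rule sum_le_suminf[OF sq]) (use pos in \<open>auto simp: less_imp_le\<close>)
  finally show ?thesis using assms by (simp add: field_simps)
qed

lemma (in walk_environment) hold_mean_le_second: "hold_mean (w x) \<le> hold_second (w x)"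
  unfolding hold_mean_def hold_second_def
proof (rule suminf_le[OF _ summable_hold[OF env sq] sq])
  fix n
  have "1 * w x n \<le> (2 * real n + 1) * w x n" using Omega0_props(1)[OF env, of x n] by (intro mult_right_mono) auto
  then show "w x n \<le> (2 * real n + 1) * w x n" by simp
qed

text \<open>The pathwise facts that hold almost surely; from here on the environment is
  deterministic. \<open>\<kappa>0\<close> governs the size of single sites and
  \<open>\<kappa>\<close> the fluctuation of sums. Their difference survives as the rate, and
  \<open>\<kappa> \<le> \<delta> / 2\<close> fits the local limit error under it.\<close>

locale regular_environment = walk_environment +
  fixes \<mu> \<sigma>2 m1 g0 \<kappa>0 \<kappa> \<epsilon> :: real
  assumes \<mu>: "1 < \<mu>" and \<sigma>2: "0 < \<sigma>2" and m1: "0 \<le> m1" and g0: "0 < g0"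
    and \<epsilon>: "0 < \<epsilon>" "\<epsilon> \<le> 1 / 8" and \<kappa>: "0 < \<kappa>0" "\<kappa>0 < \<kappa>" "\<kappa> \<le> 1 / 4" "\<kappa> \<le> \<delta> / 2"
    and second_bound: "\<forall>\<^sub>F N in sequentially. \<forall>x<N. hold_second (w x) \<le> real N powr \<kappa>0"
    and mean_sums: "\<forall>\<^sub>F N in sequentially. \<forall>a b. a \<le> b \<longrightarrow> b \<le> N \<longrightarrow> real (b - a) \<le> real N powr (1 / 2 + \<epsilon>) \<longrightarrow>
        \<bar>\<Sum>i\<in>{a..<b}. (hold_mean (w i) - \<mu>)\<bar> \<le> real N powr (1 / 2 - \<kappa>)"
    and var_sums: "\<forall>\<^sub>F N in sequentially. \<forall>a b. a \<le> b \<longrightarrow> b \<le> N \<longrightarrow> real (b - a) \<le> real N powr (1 / 2 + \<epsilon>) \<longrightarrow>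
        \<bar>\<Sum>i\<in>{a..<b}. (hold_var (w i) - \<sigma>2)\<bar> \<le> real N powr (1 / 2 - \<kappa>)"
    and moment_sums: "\<forall>\<^sub>F N in sequentially. \<forall>a b. a \<le> b \<longrightarrow> b \<le> N \<longrightarrow> real (b - a) \<le> real N powr (1 / 2 + \<epsilon>) \<longrightarrow>
        \<bar>\<Sum>i\<in>{a..<b}. (hold_moment \<delta> (w i) - m1)\<bar> \<le> real N powr (1 / 2 - \<kappa>)"
    and gap_sums: "\<forall>\<^sub>F N in sequentially. \<forall>a b. a \<le> b \<longrightarrow> b \<le> N \<longrightarrow> real (b - a) \<le> real N powr (1 / 2 + \<epsilon>) \<longrightarrow>
        \<bar>\<Sum>i\<in>{a..<b}. (hold_gap (w i) - g0)\<bar> \<le> real N powr (1 / 2 - \<kappa>)"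
begin

lemma long_interval:
  fixes f :: "nat \<Rightarrow> real" and c :: real
  assumes "\<forall>\<^sub>F N in sequentially. \<forall>a b. a \<le> b \<longrightarrow> b \<le> N \<longrightarrow> real (b - a) \<le> real N powr (1 / 2 + \<epsilon>) \<longrightarrow>
        \<bar>\<Sum>i\<in>{a..<b}. (f i - c)\<bar> \<le> real N powr (1 / 2 - \<kappa>)"
  shows "\<forall>\<^sub>F N in sequentially. \<forall>a b. a \<le> b \<longrightarrow> b \<le> N \<longrightarrow>
      \<bar>(\<Sum>i<b. f i) - (\<Sum>i<a. f i) - c * real (b - a)\<bar> \<le> (2 * real (b - a) / real N powr (1 / 2 + \<epsilon>) + 1) * real N powr (1 / 2 - \<kappa>)"
  using assms eventually_ge_at_top[of 1]
proof eventually_elim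
  case (elim N)
  define F where "F n = (\<Sum>i<n. f i - c)" for n
  have F: "F b - F a = (\<Sum>i\<in>{a..<b}. f i - c)" if "a \<le> b" for a b
    using sum_diff_nat_ivl[of 0 a b "\<lambda>i. f i - c"] that by (simp add: F_def lessThan_atLeast0)
  have F': "F b - F a = (\<Sum>i<b. f i) - (\<Sum>i<a. f i) - c * real (b - a)" if "a \<le> b" for a b
    using that by (simp add: F_def sum_subtractf of_nat_diff algebra_simps)
  have L: "1 \<le> real N powr (1 / 2 + \<epsilon>)" using elim(2) \<epsilon> by (intro ge_one_powr_ge_zero) auto
  show ?case
  proof (intro allI impI)
    fix a b :: nat assume ab: "a \<le> b" "b \<le> N"
    have "\<bar>F b - F a\<bar> \<le> (2 * real (b - a) / real N powr (1 / 2 + \<epsilon>) + 1) * real N powr (1 / 2 - \<kappa>)"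
      by (rule interval_bound_by_blocks[where N=N]) (use elim(1) F L ab in auto)
    then show "\<bar>(\<Sum>i<b. f i) - (\<Sum>i<a. f i) - c * real (b - a)\<bar> \<le> (2 * real (b - a) / real N powr (1 / 2 + \<epsilon>) + 1) * real N powr (1 / 2 - \<kappa>)"
      unfolding F'[OF ab(1)] .
  qed
qed

lemma initial_interval:
  fixes f :: "nat \<Rightarrow> real" and c :: real
  assumes "\<forall>\<^sub>F N in sequentially. \<forall>a b. a \<le> b \<longrightarrow> b \<le> N \<longrightarrow> real (b - a) \<le> real N powr (1 / 2 + \<epsilon>) \<longrightarrow>
        \<bar>\<Sum>i\<in>{a..<b}. (f i - c)\<bar> \<le> real N powr (1 / 2 - \<kappa>)"
  shows "\<forall>\<^sub>F N in sequentially. \<forall>x\<le>N. \<bar>(\<Sum>i<x. f i) - c * real x\<bar> \<le> 3 * real N powr (1 - \<kappa>)"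
  using long_interval[OF assms] eventually_ge_at_top[of 1]
proof eventually_elim
  case (elim N)
  show ?case
  proof (intro allI impI)
    fix x assume x: "x \<le> N"
    have "\<bar>(\<Sum>i<x. f i) - c * real x\<bar> \<le> (2 * real x / real N powr (1 / 2 + \<epsilon>) + 1) * real N powr (1 / 2 - \<kappa>)"
      using elim(1)[rule_format, of 0 x] x by simp
    also have "\<dots> \<le> (3 * real N powr (1 / 2)) * real N powr (1 / 2 - \<kappa>)"
    proof (rule mult_right_mono)
      have "2 * real x / real N powr (1 / 2 + \<epsilon>) \<le> 2 * real N / real N powr (1 / 2)"
        using elim(2) x \<epsilon> by (intro frac_le powr_mono) auto
      also have "\<dots> = 2 * real N powr (1 / 2)"
        using elim(2) powr_mult_base[of "real N" "- 1 / 2"] by (simp add: powr_minus_divide)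
      finally have "2 * real x / real N powr (1 / 2 + \<epsilon>) \<le> 2 * real N powr (1 / 2)" .
      moreover have "1 \<le> real N powr (1 / 2)" using elim(2) by (intro ge_one_powr_ge_zero) auto
      ultimately show "2 * real x / real N powr (1 / 2 + \<epsilon>) + 1 \<le> 3 * real N powr (1 / 2)" by linarith
    qed auto
    also have "\<dots> = 3 * real N powr (1 - \<kappa>)" by (simp add: powr_add[symmetric])
    finally show "\<bar>(\<Sum>i<x. f i) - c * real x\<bar> \<le> 3 * real N powr (1 - \<kappa>)" .
  qed
qed

definition good :: "nat \<Rightarrow> bool" where
  "good n \<longleftrightarrow> 1 \<le> n \<and> (\<forall>x\<le>n. hold_second (w x) \<le> 2 * real n powr \<kappa>0)
     \<and> (\<forall>a b. a \<le> b \<longrightarrow> b \<le> n \<longrightarrow> \<bar>mean_upto b - mean_upto a - \<mu> * real (b - a)\<bar>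
          \<le> (2 * real (b - a) / real n powr (1 / 2 + \<epsilon>) + 1) * real n powr (1 / 2 - \<kappa>))
     \<and> (\<forall>x\<le>n. \<bar>mean_upto x - \<mu> * real x\<bar> \<le> 3 * real n powr (1 - \<kappa>))
     \<and> (\<forall>x\<le>n. \<bar>var_upto x - \<sigma>2 * real x\<bar> \<le> 3 * real n powr (1 - \<kappa>))
     \<and> (\<forall>x\<le>n. \<bar>moment_upto x - m1 * real x\<bar> \<le> 3 * real n powr (1 - \<kappa>))
     \<and> (\<forall>x\<le>n. \<bar>gap_upto x - g0 * real x\<bar> \<le> 3 * real n powr (1 - \<kappa>))"

lemma eventually_good: "eventually good sequentially"
proof -
  have "\<forall>\<^sub>F n in sequentially. \<forall>x\<le>n. hold_second (w x) \<le> 2 * real n powr \<kappa>0"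
    \<comment> \<open>\<open>second_bound\<close> speaks of \<open>x < N\<close>; taking
      \<open>N = Suc n\<close> includes \<open>x = n\<close>, and the factor 2 covers the change of
      base.\<close>
    using eventually_ge_at_top[of 1] eventually_sequentially_Suc[THEN iffD2, OF second_bound]
  proof eventually_elim
    case (elim n)
    have "real (Suc n) powr \<kappa>0 \<le> (2 * real n) powr \<kappa>0" using elim(1) \<kappa> by (intro powr_mono2) auto
    also have "\<dots> = 2 powr \<kappa>0 * real n powr \<kappa>0" by (simp add: powr_mult)
    also have "\<dots> \<le> 2 powr 1 * real n powr \<kappa>0" using \<kappa> by (intro mult_right_mono powr_mono) auto
    finally show ?case using elim(2) by (auto simp: less_Suc_eq_le intro: order_trans)
  qed
  with eventually_ge_at_top[of 1] long_interval[OF mean_sums] initial_interval[OF mean_sums] initial_interval[OF var_sums]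
    initial_interval[OF moment_sums] initial_interval[OF gap_sums]
  show ?thesis
    by eventually_elim (auto simp: good_def mean_upto_def var_upto_def moment_upto_def gap_upto_def)
qed

definition kernel :: "nat \<Rightarrow> nat \<Rightarrow> real" where
  "kernel x l = 1 / \<mu> * normal_density (real (M_env w l)) (sqrt (real l * (\<sigma>2 / \<mu> ^ 3))) (real x)"

text \<open>Stretching space by \<open>\<mu>\<close> multiplies the standard deviation by
  \<open>\<mu>\<close> and divides the density by it, which consumes the prefactor
  \<open>1 / \<mu>\<close>. On this time scale the variance \<open>l * \<sigma>2 / \<mu>\<close> is
  comparable with \<open>var_upto x\<close> for \<open>x\<close> near
  \<open>l / \<mu>\<close>.\<close>

lemma kernel_eq:
  assumes "1 \<le> l"
  shows "kernel x l = normal_density 0 (sqrt (real l * \<sigma>2 / \<mu>)) (\<mu> * (real (M_env w l) - real x))"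
proof -
  let ?W = "real l * \<sigma>2 / \<mu>"
  have W: "0 < ?W" using assms \<mu> \<sigma>2 by simp
  have s: "real l * (\<sigma>2 / \<mu> ^ 3) = ?W / \<mu>\<^sup>2" using \<mu> by (simp add: power3_eq_cube power2_eq_square)
  have "sqrt (2 * pi * (?W / \<mu>\<^sup>2)) * \<mu> = sqrt (2 * pi * ?W)"
    using \<mu> by (simp add: real_sqrt_mult real_sqrt_divide)
  then have c: "1 / \<mu> * (1 / sqrt (2 * pi * (?W / \<mu>\<^sup>2))) = 1 / sqrt (2 * pi * ?W)" by (simp add: mult.commute)
  have e: "(real x - real (M_env w l))\<^sup>2 / (2 * (?W / \<mu>\<^sup>2)) = (\<mu> * (real (M_env w l) - real x))\<^sup>2 / (2 * ?W)"
    using \<mu> by (simp add: power_mult_distrib power2_commute[of "real x"])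
  have q: "(sqrt (?W / \<mu>\<^sup>2))\<^sup>2 = ?W / \<mu>\<^sup>2" "(sqrt ?W)\<^sup>2 = ?W"
    using W \<mu> by (simp_all only: real_sqrt_pow2 divide_nonneg_nonneg zero_le_power2 less_imp_le)
  have "kernel x l = (1 / \<mu> * (1 / sqrt (2 * pi * (?W / \<mu>\<^sup>2)))) * exp (- ((real x - real (M_env w l))\<^sup>2 / (2 * (?W / \<mu>\<^sup>2))))"
    unfolding kernel_def normal_density_def s q by simp
  also have "\<dots> = normal_density 0 (sqrt ?W) (\<mu> * (real (M_env w l) - real x))"
    unfolding c e unfolding normal_density_def q by simp
  finally show ?thesis .
qed

lemma kernel_nonneg: "0 \<le> kernel x l"
  unfolding kernel_def using \<mu> by (simp add: normal_density_nonneg)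

definition "kernel_bound = (\<sigma>2 / \<mu>) powr (- 1 / 2)"

lemma kernel_le:
  assumes "1 \<le> l" "l \<le> n"
  shows "kernel x l \<le> kernel_bound * exp (- (\<mu> * (real (M_env w l) - real x))\<^sup>2 * \<mu> / (2 * real n * \<sigma>2))"
proof -
  let ?W = "real l * \<sigma>2 / \<mu>" and ?e = "\<mu> * (real (M_env w l) - real x)"
  have W: "0 < ?W" using assms \<mu> \<sigma>2 by simp
  have "kernel x l \<le> ?W powr (- 1 / 2) * exp (- ?e\<^sup>2 / (2 * ?W))"
    unfolding kernel_eq[OF assms(1)] by (rule normal_density_le[OF W])
  also have "\<dots> \<le> kernel_bound * exp (- ?e\<^sup>2 * \<mu> / (2 * real n * \<sigma>2))"
  proof (rule mult_mono)
    have "1 * (\<sigma>2 / \<mu>) \<le> real l * (\<sigma>2 / \<mu>)" using assms \<mu> \<sigma>2 by (intro mult_right_mono) auto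
    then show "?W powr (- 1 / 2) \<le> kernel_bound" unfolding kernel_bound_def using \<mu> \<sigma>2 by (intro powr_mono2') auto
    have "?e\<^sup>2 / (2 * (real n * \<sigma>2 / \<mu>)) \<le> ?e\<^sup>2 / (2 * ?W)"
      using assms \<mu> \<sigma>2 by (intro divide_left_mono mult_left_mono divide_right_mono mult_right_mono) auto
    then show "exp (- ?e\<^sup>2 / (2 * ?W)) \<le> exp (- ?e\<^sup>2 * \<mu> / (2 * real n * \<sigma>2))"
      using \<mu> by simp
  qed (auto simp: kernel_bound_def)
  finally show ?thesis .
qed

lemma kernel_le_const: "1 \<le> l \<Longrightarrow> kernel x l \<le> kernel_bound"
proof -
  assume l: "1 \<le> l"
  let ?z = "- (\<mu> * (real (M_env w l) - real x))\<^sup>2 * \<mu> / (2 * real l * \<sigma>2)"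
  have "?z \<le> 0" using \<mu> \<sigma>2 by (simp add: divide_nonpos_nonneg)
  then have "kernel_bound * exp ?z \<le> kernel_bound * 1" by (intro mult_left_mono) (auto simp: kernel_bound_def)
  then show ?thesis using kernel_le[OF l order_refl, of x] by linarith
qed

text \<open>A distance of order \<open>n\<close> against a variance of order at most
  \<open>n\<close> makes the kernel exponentially small; this disposes of all atypical
  positions.\<close>

lemma kernel_far_le:
  assumes "1 \<le> l" "l \<le> n" "0 \<le> c" "c * real n \<le> \<bar>\<mu> * (real (M_env w l) - real x)\<bar>"
  shows "kernel x l \<le> kernel_bound * exp (- (c\<^sup>2 * \<mu> / (2 * \<sigma>2)) * real n)"
proof -
  have n: "0 < real n" using assms by auto
  have "kernel x l \<le> kernel_bound * exp (- (\<mu> * (real (M_env w l) - real x))\<^sup>2 * \<mu> / (2 * real n * \<sigma>2))"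
    by (rule kernel_le[OF assms(1,2)])
  also have "\<dots> \<le> kernel_bound * exp (- (c\<^sup>2 * \<mu> / (2 * \<sigma>2)) * real n)"
  proof -
    have "(c * real n)\<^sup>2 \<le> (\<mu> * (real (M_env w l) - real x))\<^sup>2"
      using assms power_mono[OF assms(4), of 2] by simp
    then have "(c * real n)\<^sup>2 * (\<mu> / (2 * real n * \<sigma>2)) \<le> (\<mu> * (real (M_env w l) - real x))\<^sup>2 * (\<mu> / (2 * real n * \<sigma>2))"
      using \<mu> \<sigma>2 by (intro mult_right_mono) auto
    moreover have "(c * real n)\<^sup>2 * (\<mu> / (2 * real n * \<sigma>2)) = (c\<^sup>2 * \<mu> / (2 * \<sigma>2)) * real n"
      using n \<sigma>2 by (simp add: power2_eq_square field_simps)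
    ultimately show ?thesis by (intro mult_left_mono) (auto simp: kernel_bound_def)
  qed
  finally show ?thesis .
qed

lemma M_env_approx:
  assumes "good n" "1 \<le> l" "l \<le> n"
  shows "\<bar>mean_upto (M_env w l) - real l\<bar> \<le> 2 * real n powr \<kappa>0"
    "\<bar>\<mu> * real (M_env w l) - real l\<bar> \<le> 5 * real n powr (1 - \<kappa>)" "M_env w l \<le> n"
proof -
  note M = M_env_bounds[OF assms(2)]
  show Mn: "M_env w l \<le> n" using M(1) assms(3) by simp
  have "hold_mean (w (M_env w l - 1)) \<le> hold_second (w (M_env w l - 1))" by (rule hold_mean_le_second)
  also have "\<dots> \<le> 2 * real n powr \<kappa>0" using assms(1) Mn unfolding good_def by auto
  finally show 1: "\<bar>mean_upto (M_env w l) - real l\<bar> \<le> 2 * real n powr \<kappa>0" using M by linarith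
  have "\<bar>mean_upto (M_env w l) - \<mu> * real (M_env w l)\<bar> \<le> 3 * real n powr (1 - \<kappa>)"
    using assms(1) Mn unfolding good_def by auto
  moreover have "real n powr \<kappa>0 \<le> real n powr (1 - \<kappa>)"
    using assms(1) \<kappa> unfolding good_def by (intro powr_mono) auto
  ultimately show "\<bar>\<mu> * real (M_env w l) - real l\<bar> \<le> 5 * real n powr (1 - \<kappa>)"
    using 1 by linarith
qed

lemma env_bounds: "0 \<le> w x k" "w x k \<le> 1"
  using Omega0_props(1,2)[OF env, of x k] by auto

section \<open>The separate ranges of positions and arrival times\<close>

abbreviation "rate n \<equiv> real n powr (- 1 / 2 - (\<kappa> - \<kappa>0))"

text \<open>Holding times are at least 1, so no site beyond \<open>n\<close> is reached by time
  \<open>n\<close>. The kernel is exponentially small there because \<open>\<mu> > 1\<close> keeps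
  \<open>\<mu> * x - l\<close> above \<open>(\<mu> - 1) * n\<close>; the approximation error takes
  at most half of this.\<close>

lemma beyond_range:
  "\<forall>\<^sub>F n in sequentially. \<forall>x>n. \<bar>(\<Sum>l\<le>n. pmf (arrival w x) l * w x (n - l)) - (\<Sum>l=1..n. kernel x l * w x (n - l))\<bar> \<le> rate n"
proof -
  define c where "c = (\<mu> - 1) / 2"
  define C where "C = c\<^sup>2 * \<mu> / (2 * \<sigma>2)"
  have c: "0 < c" "0 < C" using \<mu> \<sigma>2 by (auto simp: c_def C_def)
  have k: "0 < kernel_bound" using \<mu> \<sigma>2 by (simp add: kernel_bound_def)
  have "\<forall>\<^sub>F n in sequentially. 5 * real n powr (1 - \<kappa>) \<le> c * real n" using c \<kappa> by real_asymp
  moreover have "\<forall>\<^sub>F n in sequentially. real n * (kernel_bound * exp (- C * real n)) \<le> rate n" using c k by real_asymp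
  ultimately show ?thesis using eventually_good
  proof eventually_elim
    case (elim n)
    show ?case
    proof (intro allI impI)
      fix x assume x: "n < x"
      have "(\<Sum>l\<le>n. pmf (arrival w x) l * w x (n - l)) = 0"
        using x by (intro sum.neutral) (auto simp: arrival_less)
      moreover have "(\<Sum>l=1..n. kernel x l * w x (n - l)) \<le> (\<Sum>l=1..n. kernel_bound * exp (- C * real n))"
      proof (rule sum_mono)
        fix l assume "l \<in> {1..n}"
        then have l: "1 \<le> l" "l \<le> n" by auto
        have "\<mu> * real n \<le> \<mu> * real x" using x \<mu> by (intro mult_left_mono) auto
        moreover have "real l \<le> real n" using l by simp
        ultimately have "c * real n \<le> \<mu> * real x - \<mu> * real (M_env w l)"
          using M_env_approx(2)[OF elim(3) l] elim(1) by (simp add: c_def field_simps)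
        then have "c * real n \<le> \<bar>\<mu> * (real (M_env w l) - real x)\<bar>" by (simp add: algebra_simps)
        then have "kernel x l \<le> kernel_bound * exp (- C * real n)" unfolding C_def using c(1) by (intro kernel_far_le l) auto
        then show "kernel x l * w x (n - l) \<le> kernel_bound * exp (- C * real n)"
          using env_bounds[of x "n - l"] kernel_nonneg[of x l] mult_left_le[of "w x (n - l)" "kernel x l"] by linarith
      qed
      moreover have "0 \<le> (\<Sum>l=1..n. kernel x l * w x (n - l))"
        by (intro sum_nonneg mult_nonneg_nonneg kernel_nonneg env_bounds)
      ultimately show "\<bar>(\<Sum>l\<le>n. pmf (arrival w x) l * w x (n - l)) - (\<Sum>l=1..n. kernel x l * w x (n - l))\<bar> \<le> rate n"
        using elim(2) by simp
    qed
  qed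
qed

text \<open>An arrival before \<open>n / 2\<close> requires holding for at least
  \<open>n / 2\<close>, of probability \<open>O(n powr (\<kappa>0 - 2))\<close>. Even
  \<open>n\<close> such terms stay below the rate.\<close>

lemma early_arrivals:
  "\<forall>\<^sub>F n in sequentially. \<forall>x\<le>n. (\<Sum>l\<in>{l. 2 * l \<le> n}. pmf (arrival w x) l * w x (n - l))
     + (\<Sum>l\<in>{l. 1 \<le> l \<and> 2 * l \<le> n}. kernel x l * w x (n - l)) \<le> 8 * (1 + kernel_bound) * rate n"
  using eventually_good
proof eventually_elim
  case (elim n)
  have n: "1 \<le> n" using elim by (simp add: good_def)
  show ?case
  proof (intro allI impI)
    fix x assume x: "x \<le> n"
    define b where "b = 8 * real n powr (\<kappa>0 - 2)"
    have wb: "w x (n - l) \<le> b" if l: "2 * l \<le> n" for l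
    proof -
      have p: "0 < n - l" using l n by linarith
      have h: "real n / 2 \<le> real (n - l)" using l by (simp add: of_nat_diff field_simps)
      have "w x (n - l) \<le> hold_second (w x) / (real (n - l))\<^sup>2" by (rule tail_le_second[OF p])
      also have "\<dots> \<le> (2 * real n powr \<kappa>0) / (real n / 2)\<^sup>2"
        using elim x h n by (intro frac_le power_mono) (auto simp: good_def)
      also have "\<dots> = b" using n by (simp add: b_def powr_diff power2_eq_square)
      finally show ?thesis .
    qed
    have b0: "0 \<le> b" by (simp add: b_def)
    have fin: "finite {l. 2 * l \<le> n}" "finite {l. 1 \<le> l \<and> 2 * l \<le> n}"
      by (auto intro: finite_subset[of _ "{..n}"])
    have "(\<Sum>l\<in>{l. 2 * l \<le> n}. pmf (arrival w x) l * w x (n - l)) \<le> (\<Sum>l\<in>{l. 2 * l \<le> n}. pmf (arrival w x) l * b)"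
      using wb by (intro sum_mono mult_left_mono) auto
    also have "\<dots> = measure_pmf.prob (arrival w x) {l. 2 * l \<le> n} * b"
      using fin by (simp add: measure_measure_pmf_finite sum_distrib_right)
    also have "\<dots> \<le> 1 * b" using b0 by (intro mult_right_mono) auto
    finally have 1: "(\<Sum>l\<in>{l. 2 * l \<le> n}. pmf (arrival w x) l * w x (n - l)) \<le> b" by simp
    have k0: "0 \<le> kernel_bound" by (simp add: kernel_bound_def)
    have "(\<Sum>l\<in>{l. 1 \<le> l \<and> 2 * l \<le> n}. kernel x l * w x (n - l)) \<le> (\<Sum>l\<in>{l. 1 \<le> l \<and> 2 * l \<le> n}. kernel_bound * b)"
      using wb kernel_le_const k0 env_bounds by (intro sum_mono mult_mono) auto
    also have "\<dots> = real (card {l. 1 \<le> l \<and> 2 * l \<le> n}) * (kernel_bound * b)" by simp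
    also have "\<dots> \<le> real n * (kernel_bound * b)"
    proof -
      have "card {l. 1 \<le> l \<and> 2 * l \<le> n} \<le> card {1..n}" by (intro card_mono) auto
      then show ?thesis using b0 k0 by (intro mult_right_mono) auto
    qed
    finally have 2: "(\<Sum>l\<in>{l. 1 \<le> l \<and> 2 * l \<le> n}. kernel x l * w x (n - l)) \<le> real n * (kernel_bound * b)" .
    have "b \<le> real n * b" using n b0 by (simp add: mult_le_cancel_right1)
    then have "b + real n * (kernel_bound * b) \<le> (1 + kernel_bound) * (real n * b)" by (simp add: algebra_simps)
    also have "real n * b = 8 * real n powr (\<kappa>0 - 1)"
      using n powr_mult_base[of "real n" "\<kappa>0 - 2"] by (simp add: b_def)
    also have "(1 + kernel_bound) * (8 * real n powr (\<kappa>0 - 1)) \<le> (1 + kernel_bound) * (8 * rate n)"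
      using n \<kappa> k0 by (intro mult_left_mono powr_mono) auto
    finally have "b + real n * (kernel_bound * b) \<le> 8 * (1 + kernel_bound) * rate n" by (simp only: mult_ac)
    then show "(\<Sum>l\<in>{l. 2 * l \<le> n}. pmf (arrival w x) l * w x (n - l))
     + (\<Sum>l\<in>{l. 1 \<le> l \<and> 2 * l \<le> n}. kernel x l * w x (n - l)) \<le> 8 * (1 + kernel_bound) * rate n"
      by (rule order_trans[OF add_mono[OF 1 2]])
  qed
qed

abbreviation "late n \<equiv> {l. l \<le> n \<and> n < 2 * l}"

text \<open>Sites below \<open>n / (4 * \<mu>)\<close> are reached on average before about
  \<open>n / 4\<close>, so an arrival after \<open>n / 2\<close> deviates by order \<open>n\<close>.
  Chebyshev gives \<open>O(1 / n)\<close>, enough here because all such arrivals are counted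
  together.\<close>

lemma small_positions:
  "\<forall>\<^sub>F n in sequentially. \<forall>x\<le>n. 4 * \<mu> * real x < real n \<longrightarrow>
     (\<Sum>l\<in>late n. pmf (arrival w x) l * w x (n - l)) + (\<Sum>l\<in>late n. kernel x l * w x (n - l)) \<le> (64 * (\<sigma>2 + 3) + 1) * rate n"
proof -
  \<comment> \<open>The distance between \<open>n / 2\<close> and \<open>n / 4\<close> is
    \<open>n / 4\<close>; the approximation errors use at most half of it.\<close>
  define C where "C = (1 / 8)\<^sup>2 * \<mu> / (2 * \<sigma>2)"
  have C: "0 < C" using \<mu> \<sigma>2 by (auto simp: C_def)
  have k: "0 < kernel_bound" using \<mu> \<sigma>2 by (simp add: kernel_bound_def)
  have "\<forall>\<^sub>F n in sequentially. 5 * real n powr (1 - \<kappa>) \<le> 1 / 8 * real n" using \<kappa> by real_asymp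
  moreover have "\<forall>\<^sub>F n in sequentially. real n * (kernel_bound * exp (- C * real n)) \<le> rate n" using C k by real_asymp
  ultimately show ?thesis using eventually_good
  proof eventually_elim
    case (elim n)
    have n: "1 \<le> n" using elim by (simp add: good_def)
    have np: "real n powr (1 - \<kappa>) \<le> real n powr 1" using n \<kappa> by (intro powr_mono) auto
    have fin: "finite (late n)" by (auto intro: finite_subset[of _ "{..n}"])
    show ?case
    proof (intro allI impI)
      fix x assume x: "x \<le> n" "4 * \<mu> * real x < real n"
      have m: "mean_upto x \<le> \<mu> * real x + 3 * real n powr (1 - \<kappa>)" "var_upto x \<le> \<sigma>2 * real x + 3 * real n powr (1 - \<kappa>)"
        using elim(3) x(1) unfolding good_def by (auto dest!: spec[of _ x] simp: abs_le_iff)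
      have "(\<Sum>l\<in>late n. pmf (arrival w x) l * w x (n - l)) \<le> (\<Sum>l\<in>late n. pmf (arrival w x) l)"
        using env_bounds by (intro sum_mono) (simp add: mult_left_le)
      also have "\<dots> = measure_pmf.prob (arrival w x) (late n)"
        using fin by (simp add: measure_measure_pmf_finite)
      also have "\<dots> \<le> measure_pmf.prob (arrival w x) {k. real n / 8 \<le> \<bar>real k - mean_upto x\<bar>}"
      proof (rule measure_pmf.finite_measure_mono)
        show "late n \<subseteq> {k. real n / 8 \<le> \<bar>real k - mean_upto x\<bar>}"
        proof
          fix l assume "l \<in> late n"
          then have "real n < 2 * real l" by (simp add: of_nat_less_iff[symmetric, where 'a=real] del: of_nat_less_iff)
          then have "real n / 8 \<le> real l - mean_upto x" using m(1) x(2) elim(1) by linarith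
          then show "l \<in> {k. real n / 8 \<le> \<bar>real k - mean_upto x\<bar>}" by simp
        qed
      qed simp
      also have "\<dots> \<le> var_upto x / (real n / 8)\<^sup>2" using n by (intro arrival_chebyshev) auto
      also have "\<dots> \<le> ((\<sigma>2 + 3) * real n) / (real n / 8)\<^sup>2"
      proof (rule divide_right_mono)
        have "\<sigma>2 * real x \<le> \<sigma>2 * real n" using x \<sigma>2 by (intro mult_left_mono) auto
        then show "var_upto x \<le> (\<sigma>2 + 3) * real n" using m(2) np n by (simp add: distrib_right)
      qed simp
      also have "\<dots> = 64 * (\<sigma>2 + 3) * real n powr (- 1)"
        using n by (simp add: power2_eq_square powr_minus_divide field_simps)
      also have "\<dots> \<le> 64 * (\<sigma>2 + 3) * rate n"
        using n \<sigma>2 \<kappa> by (intro mult_left_mono powr_mono) auto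
      finally have 1: "(\<Sum>l\<in>late n. pmf (arrival w x) l * w x (n - l)) \<le> 64 * (\<sigma>2 + 3) * rate n" .
      have "(\<Sum>l\<in>late n. kernel x l * w x (n - l)) \<le> (\<Sum>l\<in>late n. kernel_bound * exp (- C * real n))"
      proof (rule sum_mono)
        fix l assume "l \<in> late n"
        then have l: "1 \<le> l" "l \<le> n" and "real n < 2 * real l"
          by (auto simp: of_nat_less_iff[symmetric, where 'a=real] simp del: of_nat_less_iff)
        then have "1 / 8 * real n \<le> \<mu> * real (M_env w l) - \<mu> * real x"
          using M_env_approx(2)[OF elim(3) l] elim(1) x(2) by linarith
        then have "1 / 8 * real n \<le> \<bar>\<mu> * (real (M_env w l) - real x)\<bar>" by (simp add: algebra_simps)
        then have "kernel x l \<le> kernel_bound * exp (- C * real n)" unfolding C_def by (intro kernel_far_le l) auto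
        then show "kernel x l * w x (n - l) \<le> kernel_bound * exp (- C * real n)"
          using env_bounds[of x "n - l"] kernel_nonneg[of x l] mult_left_le[of "w x (n - l)" "kernel x l"] by linarith
      qed
      also have "\<dots> = real (card (late n)) * (kernel_bound * exp (- C * real n))" by simp
      also have "\<dots> \<le> real n * (kernel_bound * exp (- C * real n))"
      proof -
        have "card (late n) \<le> card {1..n}" by (intro card_mono) auto
        then show ?thesis using k by (intro mult_right_mono) auto
      qed
      finally show "(\<Sum>l\<in>late n. pmf (arrival w x) l * w x (n - l)) + (\<Sum>l\<in>late n. kernel x l * w x (n - l)) \<le> (64 * (\<sigma>2 + 3) + 1) * rate n"
        using 1 elim(2) by (simp add: algebra_simps)
    qed
  qed
qed

text \<open>Both variances to be compared lie between \<open>v1 * n\<close> and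
  \<open>v2 * n\<close>. In the main range \<open>\<sigma>2 * x \<ge> 2 * v1 * n\<close>, and half
  is given up to fluctuations. The summands of \<open>cmp_const\<close> are the costs of shifting
  the centre, of changing the variance, and of the far regime.\<close>

definition "v1 = \<sigma>2 / (8 * \<mu>)"
definition "v2 = \<sigma>2 + 3"
definition "llt_const = 13000 * (m1 + 4) * (g0 / (8 * \<mu>)) powr (- (3 + \<delta>) / 2)"
definition "cmp_const = 5 / v1 + (3 + 6 * \<sigma>2) * v1 powr (- 3 / 2) + v1 powr (- 1 / 2)"

lemma v1: "0 < v1" and v2: "0 < v2"
  using \<sigma>2 \<mu> by (auto simp: v1_def v2_def)

text \<open>When \<open>x\<close> is comparable with \<open>n\<close>, moments and gaps both add up
  to order \<open>n\<close>, so the local limit error is \<open>n * n powr (- (3 + \<delta>) / 2) =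
  n powr (- 1 / 2 - \<delta> / 2)\<close>.\<close>

lemma arrival_gauss_le:
  assumes gd: "good n" and x: "x \<le> n" "real n \<le> 4 * \<mu> * real x"
    and num: "3 * real n powr (1 - \<kappa>) \<le> g0 / (8 * \<mu>) * real n"
  shows "\<bar>pmf (arrival w x) l - normal_density (mean_upto x) (sqrt (var_upto x)) (real l)\<bar> \<le> llt_const * real n powr (- 1 / 2 - \<kappa>)"
proof -
  have n: "1 \<le> n" using gd by (simp add: good_def)
  have np: "real n powr (1 - \<kappa>) \<le> real n powr 1" using n \<kappa> by (intro powr_mono) auto
  have m: "moment_upto x \<le> m1 * real x + 3 * real n powr (1 - \<kappa>)" "g0 * real x - 3 * real n powr (1 - \<kappa>) \<le> gap_upto x"
    using gd x(1) unfolding good_def by (auto dest!: spec[of _ x] simp: abs_le_iff)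
  have "g0 / (4 * \<mu>) * real n \<le> g0 / (4 * \<mu>) * (4 * \<mu> * real x)" using x(2) g0 \<mu> by (intro mult_left_mono) auto
  then have "g0 / (4 * \<mu>) * real n \<le> g0 * real x" using \<mu> by simp
  moreover have "g0 / (4 * \<mu>) * real n = 2 * (g0 / (8 * \<mu>) * real n)" by simp
  ultimately have G: "g0 / (8 * \<mu>) * real n \<le> gap_upto x" using m(2) num by linarith
  have G0: "0 < g0 / (8 * \<mu>) * real n" using g0 \<mu> n by simp
  have "m1 * real x \<le> m1 * real n" using x m1 by (intro mult_left_mono) auto
  then have M: "moment_upto x + 1 \<le> (m1 + 4) * real n" using m(1) np n by (simp add: distrib_right)
  have "\<bar>pmf (arrival w x) l - normal_density (mean_upto x) (sqrt (var_upto x)) (real l)\<bar>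
    \<le> 13000 * (moment_upto x + 1) * gap_upto x powr (- (3 + \<delta>) / 2)"
    using G G0 by (intro arrival_local_limit) linarith
  also have "\<dots> \<le> 13000 * ((m1 + 4) * real n) * (g0 / (8 * \<mu>) * real n) powr (- (3 + \<delta>) / 2)"
    using M moment_upto_nonneg[of x] G G0 \<delta> m1 by (intro mult_mono powr_mono2') auto
  also have "\<dots> = llt_const * (real n * real n powr (- (3 + \<delta>) / 2))"
    unfolding llt_const_def powr_mult by simp
  also have "real n * real n powr (- (3 + \<delta>) / 2) = real n powr (- 1 / 2 - \<delta> / 2)"
    using n powr_mult_base[of "real n" "- (3 + \<delta>) / 2"] by (simp add: field_simps)
  also have "llt_const * \<dots> \<le> llt_const * real n powr (- 1 / 2 - \<kappa>)"
    using n \<kappa> m1 by (intro mult_left_mono powr_mono) (auto simp: llt_const_def)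
  finally show ?thesis .
qed

text \<open>Let \<open>D\<close> be the distance from \<open>x\<close> to \<open>M_env w l\<close>.
  If \<open>D\<close> is within the window, the two Gaussians are compared by their Lipschitz
  bounds; if not, both are separately negligible, since the centres then differ by at most
  \<open>D / 2\<close>.\<close>

lemma gauss_kernel_le:
  assumes gd: "good n" and x: "x \<le> n" "real n \<le> 4 * \<mu> * real x" and l: "l \<in> late n"
    and num: "3 * real n powr (1 - \<kappa>) \<le> v1 * real n" "12 * real n powr (1 / 2 - \<kappa>) \<le> real n powr (1 / 2 + \<epsilon>)"
      "2 * real n powr (- \<kappa> - \<epsilon>) \<le> 1 / 4" "exp (- (real n powr (2 * \<epsilon>) / (8 * v2))) \<le> real n powr (- \<kappa>)"
      "2 * real n powr \<kappa>0 \<le> 2 * real n powr (1 / 2 - \<kappa>)"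
  shows "\<bar>normal_density (mean_upto x) (sqrt (var_upto x)) (real l) - kernel x l\<bar> \<le> cmp_const * real n powr (- 1 / 2 - \<kappa>)"
proof -
  have n: "1 \<le> n" using gd by (simp add: good_def)
  have l': "1 \<le> l" "l \<le> n" and nl: "real n < 2 * real l"
    using l by (auto simp: of_nat_less_iff[symmetric, where 'a=real] simp del: of_nat_less_iff)
  define Q where "Q = real n powr (- 1 / 2 - \<kappa>)"
  define V where "V = var_upto x"
  define W where "W = real l * \<sigma>2 / \<mu>"
  define M where "M = M_env w l"
  define d where "d = real l - mean_upto x"
  define e where "e = \<mu> * (real M - real x)"
  define D where "D = \<bar>real x - real M\<bar>"
  note MM = M_env_approx[OF gd l', folded M_def]
  have Q0: "0 < Q" using n by (simp add: Q_def)
  have np: "real n powr (1 - \<kappa>) \<le> real n powr 1" using n \<kappa> by (intro powr_mono) auto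
  have Vb: "\<bar>V - \<sigma>2 * real x\<bar> \<le> 3 * real n powr (1 - \<kappa>)"
    using gd x(1) unfolding good_def V_def by auto
  have "\<sigma>2 / (4 * \<mu>) * real n \<le> \<sigma>2 / (4 * \<mu>) * (4 * \<mu> * real x)" using x(2) \<sigma>2 \<mu> by (intro mult_left_mono) auto
  then have "2 * (v1 * real n) \<le> \<sigma>2 * real x" using \<mu> by (simp add: v1_def)
  then have V1: "v1 * real n \<le> V" using Vb num(1) by linarith
  have W1: "v1 * real n \<le> W"
  proof -
    have "real n * (\<sigma>2 / (8 * \<mu>)) \<le> (8 * real l) * (\<sigma>2 / (8 * \<mu>))" using nl \<sigma>2 \<mu> by (intro mult_right_mono) auto
    then show ?thesis by (simp add: v1_def W_def mult.commute)
  qed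
  have "\<sigma>2 * real x \<le> \<sigma>2 * real n" using x \<sigma>2 by (intro mult_left_mono) auto
  then have V2: "V \<le> v2 * real n" using Vb np n by (simp add: v2_def distrib_right)
  have W2: "W \<le> v2 * real n"
  proof -
    have "W \<le> real l * \<sigma>2"
    proof -
      have "0 \<le> real l * \<sigma>2" using \<sigma>2 by simp
      then show ?thesis unfolding W_def using \<mu> mult_left_mono[of 1 \<mu> "real l * \<sigma>2"] by (simp add: divide_le_eq)
    qed
    also have "\<dots> \<le> real n * v2" using l' \<sigma>2 by (intro mult_mono) (auto simp: v2_def)
    finally show ?thesis by (simp add: mult.commute)
  qed
  have v1n: "0 < v1 * real n" using v1 n by simp
  have V0: "0 < V" and W0: "0 < W" using V1 W1 v1n by auto
  have nd: "normal_density (mean_upto x) (sqrt (var_upto x)) (real l) = normal_density 0 (sqrt V) d"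
    by (simp add: normal_density_def d_def V_def)
  have kd: "kernel x l = normal_density 0 (sqrt W) e"
    using kernel_eq[OF l'(1), of x] by (simp add: W_def e_def M_def)
  have q1: "real n powr (1 / 2 - \<kappa>) = Q * real n"
    using n powr_mult_base[of "real n" "- 1 / 2 - \<kappa>"] by (simp add: Q_def mult.commute)
  have q2: "real n powr (1 - \<kappa>) * real n powr (- 3 / 2) = Q"
    by (simp add: Q_def powr_add[symmetric])
  \<comment> \<open>\<open>d - e\<close> is the fluctuation of the holding means between
    \<open>x\<close> and \<open>M\<close>, minus the overshoot \<open>mean_upto M - l\<close>. Only
    the short window matters, so the much larger fluctuation of \<open>mean_upto x\<close> itself
    does not enter. The 3 is 1 for the window plus 2 for the overshoot.\<close>
  have de: "\<bar>d - e\<bar> \<le> 3 * real n powr (1 / 2 - \<kappa>) + 2 * D * real n powr (- \<kappa> - \<epsilon>)"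
  proof -
    have b: "\<bar>mean_upto (max x M) - mean_upto (min x M) - \<mu> * real (max x M - min x M)\<bar>
       \<le> (2 * real (max x M - min x M) / real n powr (1 / 2 + \<epsilon>) + 1) * real n powr (1 / 2 - \<kappa>)"
      using gd x(1) MM(3) unfolding good_def by auto
    have DD: "real (max x M - min x M) = D" unfolding D_def by (auto simp: max_def min_def of_nat_diff)
    have "\<bar>mean_upto M - mean_upto x - e\<bar> \<le> (2 * D / real n powr (1 / 2 + \<epsilon>) + 1) * real n powr (1 / 2 - \<kappa>)"
    proof (cases "x \<le> M")
      case True
      then show ?thesis using b unfolding DD by (simp add: e_def D_def)
    next
      case False
      then have "mean_upto M - mean_upto x - e = - (mean_upto x - mean_upto M - \<mu> * D)"
        by (simp add: e_def D_def algebra_simps)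
      then show ?thesis using b False unfolding DD by (simp add: abs_minus_commute)
    qed
    also have "\<dots> = 2 * D * real n powr (- \<kappa> - \<epsilon>) + real n powr (1 / 2 - \<kappa>)"
    proof -
      have "real n powr (1 / 2 - \<kappa>) / real n powr (1 / 2 + \<epsilon>) = real n powr (- \<kappa> - \<epsilon>)"
        by (simp add: powr_diff[symmetric])
      moreover have "(2 * D / a + 1) * b = 2 * D * (b / a) + b" for a b :: real by (simp add: distrib_right)
      ultimately show ?thesis by (simp only:)
    qed
    finally show ?thesis using MM(1) num(5) unfolding d_def by linarith
  qed
  have c0: "0 \<le> 5 / v1 + (3 + 6 * \<sigma>2) * v1 powr (- 3 / 2)" using v1 \<sigma>2 by simp
  have "\<bar>normal_density 0 (sqrt V) d - normal_density 0 (sqrt W) e\<bar> \<le> cmp_const * Q"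
  proof (cases "D \<le> real n powr (1 / 2 + \<epsilon>)")
    case True
    have "D * real n powr (- \<kappa> - \<epsilon>) \<le> real n powr (1 / 2 + \<epsilon>) * real n powr (- \<kappa> - \<epsilon>)"
      using True by (intro mult_right_mono) auto
    also have "\<dots> = real n powr (1 / 2 - \<kappa>)" by (simp add: powr_add[symmetric])
    finally have de1: "\<bar>d - e\<bar> \<le> 5 * (Q * real n)" using de q1 by simp
    \<comment> \<open>3 comes from \<open>var_upto x\<close>; the 6 in front of
      \<open>\<sigma>2\<close> is 1 for the window between \<open>x\<close> and \<open>M\<close> and
      5 for \<open>M\<close> against \<open>l / \<mu>\<close>.\<close>
    have VW: "\<bar>V - W\<bar> \<le> (3 + 6 * \<sigma>2) * real n powr (1 - \<kappa>)"
    proof -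
      have "D \<le> real n powr (1 - \<kappa>)"
        using True n \<kappa> \<epsilon> powr_mono[of "1 / 2 + \<epsilon>" "1 - \<kappa>" "real n"] by simp
      moreover have "\<bar>real M - real l / \<mu>\<bar> \<le> 5 * real n powr (1 - \<kappa>)"
      proof -
        have "real M - real l / \<mu> = (\<mu> * real M - real l) / \<mu>" using \<mu> by (simp add: field_simps)
        then have "\<bar>real M - real l / \<mu>\<bar> = \<bar>\<mu> * real M - real l\<bar> / \<mu>" using \<mu> by (simp add: abs_divide)
        also have "\<dots> \<le> \<bar>\<mu> * real M - real l\<bar>" using \<mu> by (simp add: divide_le_eq mult_le_cancel_left1)
        finally show ?thesis using MM(2) by linarith
      qed
      ultimately have "\<bar>real x - real l / \<mu>\<bar> \<le> 6 * real n powr (1 - \<kappa>)" unfolding D_def by linarith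
      then have "\<sigma>2 * \<bar>real x - real l / \<mu>\<bar> \<le> \<sigma>2 * (6 * real n powr (1 - \<kappa>))" using \<sigma>2 by (intro mult_left_mono) auto
      moreover have "\<bar>\<sigma>2 * real x - W\<bar> = \<sigma>2 * \<bar>real x - real l / \<mu>\<bar>"
      proof -
        have "\<sigma>2 * real x - W = \<sigma>2 * (real x - real l / \<mu>)" by (simp add: W_def algebra_simps)
        then show ?thesis using \<sigma>2 by (simp add: abs_mult)
      qed
      ultimately show ?thesis using Vb by (simp add: distrib_right)
    qed
    have "\<bar>normal_density 0 (sqrt V) d - normal_density 0 (sqrt W) e\<bar> \<le> \<bar>d - e\<bar> / (v1 * real n) + \<bar>V - W\<bar> * (v1 * real n) powr (- 3 / 2)"
      by (rule normal_density_diff_le[OF v1n V1 W1])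
    also have "\<dots> \<le> 5 * (Q * real n) / (v1 * real n) + ((3 + 6 * \<sigma>2) * real n powr (1 - \<kappa>)) * (v1 * real n) powr (- 3 / 2)"
      using de1 VW v1n by (intro add_mono divide_right_mono mult_right_mono) auto
    also have "\<dots> = (5 / v1 + (3 + 6 * \<sigma>2) * v1 powr (- 3 / 2)) * Q"
    proof -
      have "((3 + 6 * \<sigma>2) * real n powr (1 - \<kappa>)) * (v1 * real n) powr (- 3 / 2) = (3 + 6 * \<sigma>2) * v1 powr (- 3 / 2) * (real n powr (1 - \<kappa>) * real n powr (- 3 / 2))"
        by (simp add: powr_mult mult_ac)
      moreover have "5 * (Q * real n) / (v1 * real n) = 5 / v1 * Q" using n by simp
      ultimately show ?thesis unfolding q2 by (simp add: distrib_right)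
    qed
    also have "\<dots> \<le> cmp_const * Q" using Q0 by (intro mult_right_mono) (auto simp: cmp_const_def)
    finally show ?thesis .
  next
    case False
    then have D: "real n powr (1 / 2 + \<epsilon>) \<le> D" by simp
    have D0: "0 \<le> D" by (simp add: D_def)
    \<comment> \<open>The part of the centre error proportional to \<open>D\<close> is at most
      \<open>D / 4\<close>, and so is the constant part, because \<open>D\<close> exceeds the
      window.\<close>
    have "D * (2 * real n powr (- \<kappa> - \<epsilon>)) \<le> D * (1 / 4)" using D0 num(3) by (intro mult_left_mono) auto
    then have "\<bar>d - e\<bar> \<le> D / 2" using de D num(2) by (simp add: mult_ac)
    moreover have "D \<le> \<bar>e\<bar>"
    proof -
      have "\<bar>e\<bar> = \<mu> * D" using \<mu> by (simp add: e_def D_def abs_mult abs_minus_commute)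
      moreover have "1 * D \<le> \<mu> * D" using \<mu> D0 by (intro mult_right_mono) auto
      ultimately show ?thesis by simp
    qed
    ultimately have far: "D / 2 \<le> \<bar>d\<bar>" "D / 2 \<le> \<bar>e\<bar>" using D0 by linarith+
    have tiny: "normal_density 0 (sqrt U) z \<le> v1 powr (- 1 / 2) * Q"
      if U: "v1 * real n \<le> U" "U \<le> v2 * real n" and z: "D / 2 \<le> \<bar>z\<bar>" for U z
    proof -
      have U0: "0 < U" using U v1n by linarith
      have "normal_density 0 (sqrt U) z \<le> U powr (- 1 / 2) * exp (- z\<^sup>2 / (2 * U))" by (rule normal_density_le[OF U0])
      also have "\<dots> \<le> (v1 * real n) powr (- 1 / 2) * real n powr (- \<kappa>)"
      proof (rule mult_mono)
        show "U powr (- 1 / 2) \<le> (v1 * real n) powr (- 1 / 2)" using U v1n by (intro powr_mono2') auto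
        have "real n powr (2 * \<epsilon>) * real n = (real n powr (1 / 2 + \<epsilon>))\<^sup>2"
          using n by (simp add: power2_eq_square powr_add[symmetric] powr_mult_base mult.commute)
        also have "\<dots> \<le> D\<^sup>2" using D by (intro power_mono) auto
        also have "\<dots> \<le> 4 * z\<^sup>2"
        proof -
          have "(D / 2)\<^sup>2 \<le> \<bar>z\<bar>\<^sup>2" using z D0 by (intro power_mono) auto
          then show ?thesis by (simp add: power_divide)
        qed
        finally have "real n powr (2 * \<epsilon>) * real n \<le> 4 * z\<^sup>2" .
        then have "real n powr (2 * \<epsilon>) / (8 * v2) \<le> z\<^sup>2 / (2 * (v2 * real n))"
          using n v2 by (simp add: field_simps)
        also have "\<dots> \<le> z\<^sup>2 / (2 * U)" using U U0 v2 n by (intro divide_left_mono mult_pos_pos mult_left_mono) auto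
        finally have "exp (- z\<^sup>2 / (2 * U)) \<le> exp (- (real n powr (2 * \<epsilon>) / (8 * v2)))" by simp
        then show "exp (- z\<^sup>2 / (2 * U)) \<le> real n powr (- \<kappa>)" using num(4) by linarith
      qed auto
      also have "\<dots> = v1 powr (- 1 / 2) * Q" by (simp add: powr_mult Q_def powr_add[symmetric])
      finally show ?thesis .
    qed
    have "\<bar>normal_density 0 (sqrt V) d - normal_density 0 (sqrt W) e\<bar> \<le> v1 powr (- 1 / 2) * Q"
      using tiny[OF V1 V2 far(1)] tiny[OF W1 W2 far(2)] normal_density_nonneg[of 0 "sqrt V" d] normal_density_nonneg[of 0 "sqrt W" e]
      by linarith
    also have "\<dots> \<le> cmp_const * Q" using Q0 c0 by (intro mult_right_mono) (auto simp: cmp_const_def)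
    finally show ?thesis .
  qed
  then show ?thesis unfolding nd kd Q_def .
qed

lemma main_positions:
  "\<forall>\<^sub>F n in sequentially. \<forall>x\<le>n. real n \<le> 4 * \<mu> * real x \<longrightarrow>
     \<bar>(\<Sum>l\<in>late n. pmf (arrival w x) l * w x (n - l)) - (\<Sum>l\<in>late n. kernel x l * w x (n - l))\<bar> \<le> 2 * (llt_const + cmp_const) * rate n"
proof -
  have c: "0 < g0 / (8 * \<mu>)" "0 < v1" "0 < v2" using g0 \<mu> v1 v2 by auto
  have "\<forall>\<^sub>F n in sequentially. 3 * real n powr (1 - \<kappa>) \<le> g0 / (8 * \<mu>) * real n"
    using c(1) \<kappa>(1,2) by (simp only: mult.commute[of "g0 / (8 * \<mu>)"]) real_asymp
  moreover have "\<forall>\<^sub>F n in sequentially. 3 * real n powr (1 - \<kappa>) \<le> v1 * real n"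
    using c(2) \<kappa>(1,2) by real_asymp
  moreover have "\<forall>\<^sub>F n in sequentially. 12 * real n powr (1 / 2 - \<kappa>) \<le> real n powr (1 / 2 + \<epsilon>)"
    using \<kappa>(1,2) \<epsilon> by real_asymp
  moreover have "\<forall>\<^sub>F n in sequentially. 2 * real n powr (- \<kappa> - \<epsilon>) \<le> 1 / 4"
    using \<kappa>(1,2) \<epsilon> by real_asymp
  moreover have "\<forall>\<^sub>F n in sequentially. exp (- (real n powr (2 * \<epsilon>) / (8 * v2))) \<le> real n powr (- \<kappa>)"
    using \<kappa>(1,2) \<epsilon> c(3) by real_asymp
  ultimately show ?thesis using eventually_good
  proof eventually_elim
    case (elim n)
    have n: "1 \<le> n" using elim by (simp add: good_def)
    have num5: "2 * real n powr \<kappa>0 \<le> 2 * real n powr (1 / 2 - \<kappa>)"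
      using n \<kappa> by (intro mult_left_mono powr_mono) auto
    show ?case
    proof (intro allI impI)
      fix x assume x: "x \<le> n" "real n \<le> 4 * \<mu> * real x"
      let ?Q = "real n powr (- 1 / 2 - \<kappa>)"
      have d: "\<bar>pmf (arrival w x) l - kernel x l\<bar> \<le> (llt_const + cmp_const) * ?Q" if "l \<in> late n" for l
        using arrival_gauss_le[OF elim(6) x elim(1), of l] gauss_kernel_le[OF elim(6) x that elim(2,3,4,5) num5]
        by (simp add: distrib_right)
      have c0: "0 \<le> llt_const + cmp_const"
        using m1 v1 \<sigma>2 by (auto simp: llt_const_def cmp_const_def)
      have "\<bar>(\<Sum>l\<in>late n. pmf (arrival w x) l * w x (n - l)) - (\<Sum>l\<in>late n. kernel x l * w x (n - l))\<bar>
         = \<bar>\<Sum>l\<in>late n. (pmf (arrival w x) l - kernel x l) * w x (n - l)\<bar>"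
        by (simp add: sum_subtractf left_diff_distrib)
      also have "\<dots> \<le> (\<Sum>l\<in>late n. (llt_const + cmp_const) * ?Q * w x (n - l))"
        using d env_bounds by (intro order_trans[OF sum_abs] sum_mono) (auto simp: abs_mult intro!: mult_right_mono)
      also have "\<dots> = (llt_const + cmp_const) * ?Q * (\<Sum>l\<in>late n. w x (n - l))" by (simp add: sum_distrib_left)
      also have "(\<Sum>l\<in>late n. w x (n - l)) \<le> hold_second (w x)"
      proof -
        have "(\<Sum>l\<in>late n. w x (n - l)) = sum (w x) ((\<lambda>l. n - l) ` late n)"
          by (subst sum.reindex) (auto simp: inj_on_def)
        also have "\<dots> \<le> hold_mean (w x)" unfolding hold_mean_def
          by (rule sum_le_suminf[OF summable_hold[OF env sq]]) (use env_bounds in \<open>auto intro: finite_subset[of _ "{..n}"]\<close>)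
        also have "\<dots> \<le> hold_second (w x)" by (rule hold_mean_le_second)
        finally show ?thesis .
      qed
      also have "hold_second (w x) \<le> 2 * real n powr \<kappa>0" using elim(6) x(1) by (simp add: good_def)
      also have "(llt_const + cmp_const) * ?Q * (2 * real n powr \<kappa>0) = 2 * (llt_const + cmp_const) * (?Q * real n powr \<kappa>0)"
        by simp
      also have "?Q * real n powr \<kappa>0 = rate n"
      proof -
        have "- 1 / 2 - (\<kappa> - \<kappa>0) = (- 1 / 2 - \<kappa>) + \<kappa>0" by simp
        then show ?thesis by (simp only: powr_add)
      qed
      finally show "\<bar>(\<Sum>l\<in>late n. pmf (arrival w x) l * w x (n - l)) - (\<Sum>l\<in>late n. kernel x l * w x (n - l))\<bar> \<le> 2 * (llt_const + cmp_const) * rate n"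
        using c0 by (simp add: mult_left_mono)
    qed
  qed
qed

theorem arrival_kernel_convolution:
  "\<exists>C. \<forall>\<^sub>F n in sequentially. \<forall>x. \<bar>(\<Sum>l\<le>n. pmf (arrival w x) l * w x (n - l)) - (\<Sum>l=1..n. kernel x l * w x (n - l))\<bar> \<le> C * rate n"
proof -
  define C where "C = 1 + 8 * (1 + kernel_bound) + (64 * (\<sigma>2 + 3) + 1) + 2 * (llt_const + cmp_const)"
  have pos: "0 \<le> kernel_bound" "0 \<le> llt_const + cmp_const" "0 \<le> \<sigma>2"
    using m1 v1 \<sigma>2 by (auto simp: kernel_bound_def llt_const_def cmp_const_def)
  have "\<forall>\<^sub>F n in sequentially. \<forall>x. \<bar>(\<Sum>l\<le>n. pmf (arrival w x) l * w x (n - l)) - (\<Sum>l=1..n. kernel x l * w x (n - l))\<bar> \<le> C * rate n"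
    using beyond_range early_arrivals small_positions main_positions
  proof eventually_elim
    case (elim n)
    have r: "0 \<le> rate n" by simp
    show ?case
    proof
      fix x
      show "\<bar>(\<Sum>l\<le>n. pmf (arrival w x) l * w x (n - l)) - (\<Sum>l=1..n. kernel x l * w x (n - l))\<bar> \<le> C * rate n"
      proof (cases "n < x")
        case True
        have "\<bar>(\<Sum>l\<le>n. pmf (arrival w x) l * w x (n - l)) - (\<Sum>l=1..n. kernel x l * w x (n - l))\<bar> \<le> rate n"
          using elim(1) True by blast
        also have "1 * rate n \<le> C * rate n" using pos by (intro mult_right_mono) (auto simp: C_def)
        finally show ?thesis by simp
      next
        case False
        then have x: "x \<le> n" by simp
        let ?r = "\<lambda>l. pmf (arrival w x) l * w x (n - l)" and ?k = "\<lambda>l. kernel x l * w x (n - l)"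
        have "{..n} = {l. 2 * l \<le> n} \<union> late n" "{1..n} = {l. 1 \<le> l \<and> 2 * l \<le> n} \<union> late n" by auto
        moreover have "finite {l. 2 * l \<le> n}" "finite {l. 1 \<le> l \<and> 2 * l \<le> n}" "finite (late n)"
          by (auto intro: finite_subset[of _ "{..n}"])
        ultimately have sr: "sum ?r {..n} = sum ?r {l. 2 * l \<le> n} + sum ?r (late n)"
          and sk: "sum ?k {1..n} = sum ?k {l. 1 \<le> l \<and> 2 * l \<le> n} + sum ?k (late n)"
          by (auto intro!: sum.union_disjoint)
        have nn: "0 \<le> sum ?r {l. 2 * l \<le> n}" "0 \<le> sum ?k {l. 1 \<le> l \<and> 2 * l \<le> n}" "0 \<le> sum ?r (late n)" "0 \<le> sum ?k (late n)"
          by (auto intro!: sum_nonneg mult_nonneg_nonneg kernel_nonneg env_bounds)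
        have e: "sum ?r {l. 2 * l \<le> n} + sum ?k {l. 1 \<le> l \<and> 2 * l \<le> n} \<le> 8 * (1 + kernel_bound) * rate n" using elim(2) x by blast
        have "\<bar>sum ?r (late n) - sum ?k (late n)\<bar> \<le> (64 * (\<sigma>2 + 3) + 1) * rate n + 2 * (llt_const + cmp_const) * rate n"
        proof (cases "real n \<le> 4 * \<mu> * real x")
          case True
          then have "\<bar>sum ?r (late n) - sum ?k (late n)\<bar> \<le> 2 * (llt_const + cmp_const) * rate n" using elim(4) x by blast
          moreover have "0 \<le> (64 * (\<sigma>2 + 3) + 1) * rate n" using pos by simp
          ultimately show ?thesis by linarith
        next
          case False
          then have "sum ?r (late n) + sum ?k (late n) \<le> (64 * (\<sigma>2 + 3) + 1) * rate n" using elim(3) x by force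
          moreover have "0 \<le> 2 * (llt_const + cmp_const) * rate n" using pos by simp
          ultimately show ?thesis using nn by linarith
        qed
        then have "\<bar>sum ?r {..n} - sum ?k {1..n}\<bar> \<le> 1 * rate n + 8 * (1 + kernel_bound) * rate n + (64 * (\<sigma>2 + 3) + 1) * rate n + 2 * (llt_const + cmp_const) * rate n"
          unfolding sr sk using e nn r by linarith
        also have "\<dots> = C * rate n" unfolding C_def by (simp only: distrib_right)
        finally show ?thesis .
      qed
    qed
  qed
  then show ?thesis by blast
qed

end

section \<open>Random environments\<close>

locale random_environment = prob_space M for M :: "'a measure" +
  fixes \<Theta> :: "'a \<Rightarrow> 'a" and \<gamma> :: "'a \<Rightarrow> nat \<Rightarrow> real" and q v :: real
  assumes preserving: "measure_preserving_map M \<Theta>"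
    and \<gamma>_meas: "\<gamma> \<in> M \<rightarrow>\<^sub>M Omega0_borel"
    and q8: "8 < q" and v_gt: "2 * q / (q - 8) < v"
    and mixing_rate: "alpha_mixing M \<Theta> \<gamma> \<in> O(\<lambda>n. real n powr (- v))"
begin

lemma \<Theta>_meas: "\<Theta> \<in> M \<rightarrow>\<^sub>M M"
  using preserving by (simp add: measure_preserving_map_def)

lemma iterate_meas[measurable]: "(\<Theta> ^^ i) \<in> M \<rightarrow>\<^sub>M M"
  by (induction i) (auto intro: measurable_compose[OF _ \<Theta>_meas])

lemma distr_iterate: "distr M M (\<Theta> ^^ i) = M"
proof (induction i)
  case (Suc i)
  have 1: "distr M M \<Theta> = M"
  proof (rule measure_eqI)
    fix A assume "A \<in> sets (distr M M \<Theta>)"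
    then have A: "A \<in> sets M" by simp
    then show "emeasure (distr M M \<Theta>) A = emeasure M A"
      using preserving \<Theta>_meas by (simp add: emeasure_distr emeasure_eq_measure measure_preserving_map_def)
  qed simp
  have "distr M M (\<Theta> ^^ Suc i) = distr (distr M M (\<Theta> ^^ i)) M \<Theta>"
    by (subst distr_distr) (auto simp: \<Theta>_meas iterate_meas comp_def)
  then show ?case using Suc 1 by (simp add: comp_def)
qed (simp add: distr_id2)

lemma stationary:
  fixes g :: "'a \<Rightarrow> real"
  assumes "g \<in> borel_measurable M"
  shows "expectation (\<lambda>\<omega>. g ((\<Theta> ^^ i) \<omega>)) = expectation g"
    "integrable M (\<lambda>\<omega>. g ((\<Theta> ^^ i) \<omega>)) \<longleftrightarrow> integrable M g"
  using integral_distr[OF iterate_meas assms, of i] integrable_distr_eq[OF iterate_meas assms, of i]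
  by (simp_all add: distr_iterate)

lemma AE_shift:
  assumes "AE \<omega> in M. P \<omega>" shows "AE \<omega> in M. \<forall>i. P ((\<Theta> ^^ i) \<omega>)"
  unfolding AE_all_countable
proof
  fix i
  show "AE \<omega> in M. P ((\<Theta> ^^ i) \<omega>)"
    by (rule AE_distrD[OF iterate_meas]) (subst distr_iterate, rule assms)
qed

definition coord_events :: "nat set \<Rightarrow> 'a set set" where
  "coord_events J = (\<Union>j\<in>J. {(\<gamma> \<circ> (\<Theta> ^^ j)) -` S \<inter> space M | S. S \<in> sets Omega0_borel})"

definition coord_algebra :: "nat set \<Rightarrow> 'a measure" where
  "coord_algebra J = sigma (space M) (coord_events J)"

lemma coord_events_Pow: "coord_events J \<subseteq> Pow (space M)"
  by (auto simp: coord_events_def)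

lemma coord_algebra: "space (coord_algebra J) = space M" "sets (coord_algebra J) = env_events M \<Theta> \<gamma> J"
  using coord_events_Pow[of J] by (auto simp: coord_algebra_def env_events_def coord_events_def[symmetric])

lemma coord_meas: "(\<gamma> \<circ> (\<Theta> ^^ j)) \<in> M \<rightarrow>\<^sub>M Omega0_borel"
  by (rule measurable_comp[OF iterate_meas \<gamma>_meas])

lemma subalgebra_coord: "subalgebra M (coord_algebra J)"
proof -
  have "coord_events J \<subseteq> sets M" unfolding coord_events_def using measurable_sets[OF coord_meas] by auto
  then have "sigma_sets (space M) (coord_events J) \<subseteq> sets M" by (rule sets.sigma_sets_subset)
  then show ?thesis unfolding subalgebra_def coord_algebra by (simp add: env_events_def coord_events_def)
qed

lemma coord_meas_algebra:
  assumes "j \<in> J" shows "(\<gamma> \<circ> (\<Theta> ^^ j)) \<in> coord_algebra J \<rightarrow>\<^sub>M Omega0_borel"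
proof (rule measurableI)
  fix \<omega> assume "\<omega> \<in> space (coord_algebra J)"
  then show "(\<gamma> \<circ> (\<Theta> ^^ j)) \<omega> \<in> space Omega0_borel"
    using measurable_space[OF coord_meas] by (simp add: coord_algebra)
next
  fix S assume "S \<in> sets Omega0_borel"
  then have "(\<gamma> \<circ> (\<Theta> ^^ j)) -` S \<inter> space M \<in> coord_events J" using assms unfolding coord_events_def by blast
  then show "(\<gamma> \<circ> (\<Theta> ^^ j)) -` S \<inter> space (coord_algebra J) \<in> sets (coord_algebra J)"
    unfolding coord_algebra env_events_def coord_events_def[symmetric] by (rule sigma_sets.Basic)
qed

lemma prob_diff_le_one: "\<bar>prob (A \<inter> B) - prob A * prob B\<bar> \<le> 1"
proof -
  have "0 \<le> prob A * prob B" "prob A * prob B \<le> 1" by (auto intro: mult_le_one)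
  moreover have "0 \<le> prob (A \<inter> B)" "prob (A \<inter> B) \<le> 1" by auto
  ultimately show ?thesis by linarith
qed

text \<open>The real supremum is meaningful because the set is bounded by 1 and contains the value
  for empty events.\<close>

lemma alpha_mixing_props:
  "A \<in> env_events M \<Theta> \<gamma> {..l} \<Longrightarrow> B \<in> env_events M \<Theta> \<gamma> {l + k..} \<Longrightarrow> \<bar>prob (A \<inter> B) - prob A * prob B\<bar> \<le> alpha_mixing M \<Theta> \<gamma> k"
  "alpha_mixing M \<Theta> \<gamma> k \<le> 1"
proof -
  let ?S = "{\<bar>measure M (A \<inter> B) - measure M A * measure M B\<bar> | A B l.
     A \<in> env_events M \<Theta> \<gamma> {..l} \<and> B \<in> env_events M \<Theta> \<gamma> {l + k..}}"
  have b: "bdd_above ?S" by (rule bdd_aboveI[of _ 1]) (use prob_diff_le_one in auto)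
  show "\<bar>prob (A \<inter> B) - prob A * prob B\<bar> \<le> alpha_mixing M \<Theta> \<gamma> k"
    if "A \<in> env_events M \<Theta> \<gamma> {..l}" "B \<in> env_events M \<Theta> \<gamma> {l + k..}"
    unfolding alpha_mixing_def by (rule cSup_upper[OF _ b]) (use that in blast)
  have e: "{} \<in> env_events M \<Theta> \<gamma> J" for J unfolding env_events_def by (rule sigma_sets.Empty)
  have "?S \<noteq> {}" using e[of "{..0}"] e[of "{0 + k..}"] by blast
  then show "alpha_mixing M \<Theta> \<gamma> k \<le> 1"
    unfolding alpha_mixing_def by (rule cSup_least) (use prob_diff_le_one in auto)
qed

lemma v_pos: "0 < v"
  using v_gt q8 by (smt (verit) divide_pos_pos)

lemma obtain_mixing_filtration:
  obtains Ca where "mixing_filtration M (\<lambda>l. coord_algebra {..l}) (\<lambda>l. coord_algebra {l..}) Ca v"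
proof -
  obtain c where c: "0 < c" "\<forall>\<^sub>F n in sequentially. norm (alpha_mixing M \<Theta> \<gamma> n) \<le> c * norm (real n powr (- v))"
    using mixing_rate by (rule landau_o.bigE)
  then obtain n0 where n0: "\<And>n. n0 \<le> n \<Longrightarrow> alpha_mixing M \<Theta> \<gamma> n \<le> c * real n powr (- v)"
    unfolding eventually_sequentially by fastforce
  \<comment> \<open>The 1 secures \<open>1 \<le> Ca\<close>; \<open>c * 2 powr v\<close> serves
    large \<open>k\<close>, where \<open>k \<ge> (k + 1) / 2\<close>; the last summand serves the
    finitely many remaining \<open>k\<close>, where the coefficient is just bounded by 1.\<close>
  define Ca where "Ca = 1 + c * 2 powr v + (real n0 + 2) powr v"
  have le: "alpha_mixing M \<Theta> \<gamma> k \<le> Ca * (real k + 1) powr (- v)" for k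
  proof (cases "n0 \<le> k \<and> 1 \<le> k")
    case True
    have "real k powr (- v) \<le> ((real k + 1) / 2) powr (- v)" using True v_pos by (intro powr_mono2') auto
    also have "\<dots> = 2 powr v * (real k + 1) powr (- v)" by (simp add: powr_divide powr_minus field_simps)
    finally have "c * real k powr (- v) \<le> c * (2 powr v * (real k + 1) powr (- v))" using c by (intro mult_left_mono) auto
    also have "\<dots> \<le> Ca * (real k + 1) powr (- v)" by (simp add: Ca_def distrib_right add_increasing)
    finally show ?thesis using n0[of k] True by linarith
  next
    case False
    have "alpha_mixing M \<Theta> \<gamma> k \<le> 1" by (rule alpha_mixing_props(2))
    also have "1 \<le> (real n0 + 2) powr v * (real k + 1) powr (- v)"
    proof -
      have "(real k + 1) powr v \<le> (real n0 + 2) powr v" using False v_pos by (intro powr_mono2) auto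
      then show ?thesis by (simp add: powr_minus_divide)
    qed
    also have "\<dots> \<le> Ca * (real k + 1) powr (- v)" using c by (intro mult_right_mono) (auto simp: Ca_def)
    finally show ?thesis .
  qed
  have "mixing_filtration M (\<lambda>l. coord_algebra {..l}) (\<lambda>l. coord_algebra {l..}) Ca v"
  proof
    show "\<bar>prob (A \<inter> B) - prob A * prob B\<bar> \<le> Ca * (real k + 1) powr (- v)"
      if "A \<in> sets (coord_algebra {..l})" "B \<in> sets (coord_algebra {l + k..})" for A B l k
      using alpha_mixing_props(1)[of A l B k] that le[of k] unfolding coord_algebra by linarith
  qed (use c v_pos in \<open>auto simp: subalgebra_coord Ca_def\<close>)
  then show ?thesis by (rule that)
qed

lemma AE_functional_sums:
  fixes f :: "(nat \<Rightarrow> real) \<Rightarrow> real"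
  assumes f: "f \<in> borel_measurable borel" and nn: "\<And>\<omega>. \<omega> \<in> space M \<Longrightarrow> 0 \<le> f (\<gamma> \<omega>)"
    and int: "integrable M (\<lambda>\<omega>. f (\<gamma> \<omega>) powr q)"
    and \<epsilon>: "0 < \<epsilon>" "\<epsilon> \<le> (q - 8) / q / 100"
  shows "AE \<omega> in M. \<forall>\<^sub>F N in sequentially.
     (\<forall>x<N. f (env \<Theta> \<gamma> \<omega> x) \<le> real N powr (1 / q + 2 * \<epsilon>)) \<and>
     (\<forall>a b. a \<le> b \<longrightarrow> b \<le> N \<longrightarrow> real (b - a) \<le> real N powr (1 / 2 + \<epsilon>) \<longrightarrow>
        \<bar>\<Sum>i\<in>{a..<b}. (f (env \<Theta> \<gamma> \<omega> i) - expectation (\<lambda>\<omega>. f (\<gamma> \<omega>)))\<bar> \<le> real N powr (1 / 2 - (1 / q + 3 * \<epsilon>)))"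
proof -
  obtain Ca where "mixing_filtration M (\<lambda>l. coord_algebra {..l}) (\<lambda>l. coord_algebra {l..}) Ca v"
    by (rule obtain_mixing_filtration)
  then interpret mixing_filtration M "\<lambda>l. coord_algebra {..l}" "\<lambda>l. coord_algebra {l..}" Ca v .
  have f0: "f \<in> borel_measurable Omega0_borel" by (rule measurable_restrict_space1[OF f])
  have fg: "(\<lambda>\<omega>. f (\<gamma> \<omega>)) \<in> borel_measurable M" by (rule measurable_compose[OF \<gamma>_meas f0])
  have Ym: "(\<lambda>\<omega>. f (\<gamma> ((\<Theta> ^^ i) \<omega>))) \<in> borel_measurable (coord_algebra J)" if "i \<in> J" for i J
    using measurable_compose[OF coord_meas_algebra[OF that] f0] by (simp add: comp_def)
  have "mixing_average M (\<lambda>l. coord_algebra {..l}) (\<lambda>l. coord_algebra {l..}) Ca v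
     (\<lambda>i \<omega>. f (\<gamma> ((\<Theta> ^^ i) \<omega>))) q (expectation (\<lambda>\<omega>. f (\<gamma> \<omega>) powr q)) (expectation (\<lambda>\<omega>. f (\<gamma> \<omega>)))"
  proof
    have fq: "(\<lambda>\<omega>. f (\<gamma> \<omega>) powr q) \<in> borel_measurable M" using fg by measurable
    show "0 \<le> f (\<gamma> ((\<Theta> ^^ i) \<omega>))" if "\<omega> \<in> space M" for i \<omega>
      using nn measurable_space[OF iterate_meas that] by blast
    show "integrable M (\<lambda>\<omega>. f (\<gamma> ((\<Theta> ^^ i) \<omega>)) powr q)" for i
      using stationary(2)[OF fq] int by simp
    show "expectation (\<lambda>\<omega>. f (\<gamma> ((\<Theta> ^^ i) \<omega>)) powr q) \<le> expectation (\<lambda>\<omega>. f (\<gamma> \<omega>) powr q)" for i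
      using stationary(1)[OF fq] by simp
    show "expectation (\<lambda>\<omega>. f (\<gamma> ((\<Theta> ^^ i) \<omega>))) = expectation (\<lambda>\<omega>. f (\<gamma> \<omega>))" for i
      by (rule stationary(1)[OF fg])
  qed (use Ym q8 v_gt in auto)
  then interpret mixing_average M "\<lambda>l. coord_algebra {..l}" "\<lambda>l. coord_algebra {l..}" Ca v
     "\<lambda>i \<omega>. f (\<gamma> ((\<Theta> ^^ i) \<omega>))" q "expectation (\<lambda>\<omega>. f (\<gamma> \<omega>) powr q)" "expectation (\<lambda>\<omega>. f (\<gamma> \<omega>))" .
  have e: "env \<Theta> \<gamma> \<omega> x = \<gamma> ((\<Theta> ^^ x) \<omega>)" for \<omega> x by (simp add: env_def fun_eq_iff)
  have x: "1 / 2 - (1 / q + 3 * \<epsilon>) = 1 / 2 - 1 / q - 3 * \<epsilon>" by simp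
  show ?thesis unfolding e x by (rule AE_interval_sums) (use \<epsilon> in \<open>auto simp: margin_def\<close>)
qed

end

section \<open>Moments from the tail condition\<close>

lemma one_add_powr_le:
  fixes B :: real
  assumes "0 \<le> B" "0 \<le> q"
  shows "(1 + B) powr q \<le> 2 powr q * (1 + B powr q)"
proof (cases "B \<le> 1")
  case True
  then have "(1 + B) powr q \<le> 2 powr q" using assms by (intro powr_mono2) auto
  also have "\<dots> \<le> 2 powr q * (1 + B powr q)" by (simp add: mult_le_cancel_left1)
  finally show ?thesis .
next
  case False
  then have "(1 + B) powr q \<le> (2 * B) powr q" using assms by (intro powr_mono2) auto
  also have "\<dots> \<le> 2 powr q * (1 + B powr q)" by (simp add: powr_mult)
  finally show ?thesis .
qed

text \<open>The bound controls increments, so \<open>a n\<close> is recovered as the sum of all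
  later ones. The decay \<open>\<beta> + 1\<close> is split into \<open>s\<close>, which yields the
  rate in \<open>n\<close>, and at least \<open>1 + t - s > 1\<close>, which makes the sum converge.
  A lower bound \<open>t\<close> of \<open>\<beta>\<close> keeps the constant free of
  \<open>\<beta>\<close>.\<close>

lemma tail_le_of_Abar':
  fixes a :: "nat \<Rightarrow> real"
  assumes a: "a \<in> Omega0" and b: "\<And>k. 1 \<le> k \<Longrightarrow> real k powr (\<beta> + 1) * (a (k - 1) - a k) \<le> b"
    and s: "0 \<le> s" "s < t" "t \<le> \<beta>" and n: "1 \<le> n"
  shows "a n \<le> zeta_shift (1 + t - s) * b * real n powr (- s)"
proof -
  have b0: "0 \<le> b" using order_trans[OF _ b[of 1]] Omega0_props(4)[OF a, of 0] by simp
  have p: "1 < 1 + t - s" using s by simp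
  have sm: "summable (\<lambda>k. (real k + 1) powr (- (1 + t - s)))" by (rule summable_zeta_shift[OF p])
  have step: "a (n + k) - a (Suc (n + k)) \<le> b * real n powr (- s) * (real k + 1) powr (- (1 + t - s))" for k
  proof -
    let ?x = "real (Suc (n + k))"
    have x: "1 \<le> ?x" by simp
    have "?x powr (\<beta> + 1) * (a (n + k) - a (Suc (n + k))) \<le> b" using b[of "Suc (n + k)"] by simp
    then have "a (n + k) - a (Suc (n + k)) \<le> b * ?x powr (- (\<beta> + 1))"
      using x by (simp only: powr_minus_divide) (simp add: field_simps)
    also have "\<dots> \<le> b * (?x powr (- s) * ?x powr (- (1 + t - s)))"
      unfolding powr_add[symmetric] using x b0 s by (intro mult_left_mono powr_mono) auto
    also have "\<dots> \<le> b * (real n powr (- s) * (real k + 1) powr (- (1 + t - s)))"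
      using n s b0 by (intro mult_left_mono mult_mono powr_mono2') auto
    finally show ?thesis by (simp add: mult_ac)
  qed
  have lim: "(\<lambda>k. a (n + k)) \<longlonglongrightarrow> 0"
    using LIMSEQ_ignore_initial_segment[OF Omega0_props(5)[OF a], of n] by (simp add: add.commute)
  have "(\<lambda>k. a (n + k) - a (n + Suc k)) sums (a (n + 0) - 0)" by (rule telescope_sums'[OF lim])
  then have sums: "(\<lambda>k. a (n + k) - a (Suc (n + k))) sums a n" by simp
  have "a n \<le> (\<Sum>k. b * real n powr (- s) * (real k + 1) powr (- (1 + t - s)))"
    unfolding sums_unique[OF sums] by (rule suminf_le[OF step sums_summable[OF sums] summable_mult[OF sm]])
  also have "\<dots> = b * real n powr (- s) * zeta_shift (1 + t - s)"
    unfolding zeta_shift_def by (rule suminf_mult[OF sm])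
  finally show ?thesis by (simp add: mult_ac)
qed

lemma zeta_shift_ge_one: "1 < p \<Longrightarrow> 1 \<le> zeta_shift p"
  using sum_le_suminf[OF summable_zeta_shift, of p "{0}"] by (simp add: zeta_shift_def)

text \<open>The bounds are linear in \<open>c\<close>, so a \<open>q\<close>-th moment of the random
  tail constant passes to the moments of the holding time.\<close>

lemma moments_of_tail:
  fixes a :: "nat \<Rightarrow> real"
  assumes a: "a \<in> Omega0" and c: "0 \<le> c" "\<And>n. 1 \<le> n \<Longrightarrow> a n \<le> c * real n powr (- s)"
    and s: "2 + \<delta> < s" "0 \<le> \<delta>"
  shows "summable (\<lambda>n. (real n + 1) powr (1 + \<delta>) * a n)"
    "hold_moment \<delta> a \<le> 1 + c * (2 powr s * zeta_shift (s - 1 - \<delta>))"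
    "summable (\<lambda>n. (2 * real n + 1) * a n)"
    "hold_second a \<le> 2 * hold_moment \<delta> a"
proof -
  have p: "1 < s - 1 - \<delta>" using s by simp
  let ?g = "\<lambda>n. (if n = 0 then 1 else 0) + c * 2 powr s * (real n + 1) powr (- (s - 1 - \<delta>))"
  have gs: "?g sums (1 + c * 2 powr s * zeta_shift (s - 1 - \<delta>))"
  proof (rule sums_add)
    show "(\<lambda>n. if n = 0 then 1 else 0::real) sums 1" using sums_single[of 0 "\<lambda>_. 1::real"] by simp
    show "(\<lambda>n. c * 2 powr s * (real n + 1) powr (- (s - 1 - \<delta>))) sums (c * 2 powr s * zeta_shift (s - 1 - \<delta>))"
      unfolding zeta_shift_def by (intro sums_mult summable_sums summable_zeta_shift p)
  qed
  have sg: "summable ?g" by (rule sums_summable[OF gs])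
  have g: "(\<Sum>n. ?g n) = 1 + c * (2 powr s * zeta_shift (s - 1 - \<delta>))"
    using sums_unique[OF gs] by (simp add: mult_ac)
  have pos: "0 < a n" for n by (rule Omega0_props(1)[OF a])
  have le: "(real n + 1) powr (1 + \<delta>) * a n \<le> ?g n" for n
  proof (cases "n = 0")
    case True then show ?thesis using Omega0_props(3)[OF a] c by simp
  next
    case False
    have "real n powr (- s) \<le> ((real n + 1) / 2) powr (- s)" using False s by (intro powr_mono2') auto
    also have "\<dots> = 2 powr s * (real n + 1) powr (- s)" by (simp add: powr_divide powr_minus field_simps)
    finally have "c * real n powr (- s) \<le> c * (2 powr s * (real n + 1) powr (- s))" using c(1) by (rule mult_left_mono)
    then have "a n \<le> c * (2 powr s * (real n + 1) powr (- s))"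
      using c(2)[of n] False by linarith
    then have "(real n + 1) powr (1 + \<delta>) * a n \<le> (real n + 1) powr (1 + \<delta>) * (c * (2 powr s * (real n + 1) powr (- s)))"
      by (intro mult_left_mono) auto
    also have "\<dots> = c * 2 powr s * ((real n + 1) powr (1 + \<delta>) * (real n + 1) powr (- s))" by simp
    also have "(real n + 1) powr (1 + \<delta>) * (real n + 1) powr (- s) = (real n + 1) powr (- (s - 1 - \<delta>))"
    proof -
      have "- (s - 1 - \<delta>) = (1 + \<delta>) + - s" by simp
      then show ?thesis by (simp only: powr_add)
    qed
    finally show ?thesis using False by simp
  qed
  show sd: "summable (\<lambda>n. (real n + 1) powr (1 + \<delta>) * a n)"
    by (rule summable_comparison_test'[OF sg, of 0]) (use le pos in \<open>auto simp: abs_mult abs_of_pos\<close>)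
  show "hold_moment \<delta> a \<le> 1 + c * (2 powr s * zeta_shift (s - 1 - \<delta>))"
    unfolding hold_moment_def g[symmetric] by (rule suminf_le[OF le sd sg])
  have le2: "(2 * real n + 1) * a n \<le> 2 * ((real n + 1) powr (1 + \<delta>) * a n)" for n
  proof -
    have "(real n + 1) powr 1 \<le> (real n + 1) powr (1 + \<delta>)" using s by (intro powr_mono) auto
    then have "2 * real n + 1 \<le> 2 * (real n + 1) powr (1 + \<delta>)" by simp
    then show ?thesis using pos[of n] mult_right_mono[of "2 * real n + 1" "2 * (real n + 1) powr (1 + \<delta>)" "a n"] by (simp add: mult.assoc)
  qed
  show sq: "summable (\<lambda>n. (2 * real n + 1) * a n)"
    by (rule summable_comparison_test'[OF summable_mult[OF sd, of 2], of 0]) (use le2 pos in \<open>auto simp: abs_mult abs_of_pos\<close>)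
  have "hold_second a \<le> (\<Sum>n. 2 * ((real n + 1) powr (1 + \<delta>) * a n))"
    unfolding hold_second_def by (rule suminf_le[OF le2 sq summable_mult[OF sd]])
  then show "hold_second a \<le> 2 * hold_moment \<delta> a" unfolding hold_moment_def by (simp add: suminf_mult[OF sd])
qed

lemma borel_measurable_functionals:
  "hold_mean \<in> borel_measurable borel" "hold_second \<in> borel_measurable borel" "hold_var \<in> borel_measurable borel"
  "hold_gap \<in> borel_measurable borel" "hold_moment \<delta> \<in> borel_measurable borel"
proof -
  have c: "(\<lambda>a. a n) \<in> borel_measurable borel" for n :: nat
    by (intro borel_measurable_continuous_onI continuous_on_product_coordinates)
  show 1: "hold_mean \<in> borel_measurable borel"
    unfolding hold_mean_def[abs_def] by (intro borel_measurable_suminf c)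
  show 2: "hold_second \<in> borel_measurable borel"
    unfolding hold_second_def[abs_def] by (intro borel_measurable_suminf borel_measurable_times borel_measurable_const c)
  show "hold_var \<in> borel_measurable borel"
    unfolding hold_var_def[abs_def] by (intro borel_measurable_diff borel_measurable_power 1 2)
  show "hold_gap \<in> borel_measurable borel"
    unfolding hold_gap_def[abs_def] by (intro borel_measurable_diff borel_measurable_times borel_measurable_const c)
  show "hold_moment \<delta> \<in> borel_measurable borel"
    unfolding hold_moment_def[abs_def] by (intro borel_measurable_suminf borel_measurable_times borel_measurable_const c)
qed

context random_environment
begin

lemma \<gamma>_Omega0: "\<omega> \<in> space M \<Longrightarrow> \<gamma> \<omega> \<in> Omega0"
  using measurable_space[OF \<gamma>_meas] by (simp add: space_restrict_space)

lemma \<gamma>_functional_meas: "f \<in> borel_measurable borel \<Longrightarrow> (\<lambda>\<omega>. f (\<gamma> \<omega>)) \<in> borel_measurable M"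
  by (rule measurable_compose[OF \<gamma>_meas measurable_restrict_space1])

lemma \<gamma>_coord_meas[measurable]: "(\<lambda>\<omega>. \<gamma> \<omega> n) \<in> borel_measurable M"
  by (rule \<gamma>_functional_meas) (intro borel_measurable_continuous_onI continuous_on_product_coordinates)

lemma env_eq: "env \<Theta> \<gamma> \<omega> x = \<gamma> ((\<Theta> ^^ x) \<omega>)"
  by (simp add: env_def fun_eq_iff)

lemma AE_dominated_functional_sums:
  fixes f :: "(nat \<Rightarrow> real) \<Rightarrow> real"
  assumes f: "f \<in> borel_measurable borel" and nn: "AE \<omega> in M. 0 \<le> f (\<gamma> \<omega>)"
    and bd: "AE \<omega> in M. f (\<gamma> \<omega>) \<le> H \<omega>" and H: "integrable M (\<lambda>\<omega>. H \<omega> powr q)"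
    and \<epsilon>: "0 < \<epsilon>" "\<epsilon> \<le> (q - 8) / q / 100"
  shows "AE \<omega> in M. \<forall>\<^sub>F N in sequentially.
     (\<forall>x<N. f (env \<Theta> \<gamma> \<omega> x) \<le> real N powr (1 / q + 2 * \<epsilon>)) \<and>
     (\<forall>a b. a \<le> b \<longrightarrow> b \<le> N \<longrightarrow> real (b - a) \<le> real N powr (1 / 2 + \<epsilon>) \<longrightarrow>
        \<bar>\<Sum>i\<in>{a..<b}. (f (env \<Theta> \<gamma> \<omega> i) - expectation (\<lambda>\<omega>. f (\<gamma> \<omega>)))\<bar> \<le> real N powr (1 / 2 - (1 / q + 3 * \<epsilon>)))"
proof -
  \<comment> \<open>The averaging result wants nonnegativity at every point of the space. Cutting at
    0 achieves this and changes nothing almost surely, along the whole orbit by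
    \<open>AE_shift\<close>.\<close>
  define g where "g a = max 0 (f a)" for a
  have gm: "g \<in> borel_measurable borel" unfolding g_def[abs_def] using f by measurable
  have eq: "AE \<omega> in M. g (\<gamma> \<omega>) = f (\<gamma> \<omega>)" using nn by eventually_elim (simp add: g_def)
  have ex: "expectation (\<lambda>\<omega>. g (\<gamma> \<omega>)) = expectation (\<lambda>\<omega>. f (\<gamma> \<omega>))"
    by (rule integral_cong_AE) (use \<gamma>_functional_meas gm f eq in auto)
  have gH: "AE \<omega> in M. g (\<gamma> \<omega>) powr q \<le> H \<omega> powr q"
    using nn bd
  proof eventually_elim
    case (elim \<omega>)
    then show ?case using q8 by (auto simp: g_def max_def intro!: powr_mono2)
  qed
  have "integrable M (\<lambda>\<omega>. g (\<gamma> \<omega>) powr q)"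
  proof (rule Bochner_Integration.integrable_bound[OF H])
    show "(\<lambda>\<omega>. g (\<gamma> \<omega>) powr q) \<in> borel_measurable M" using \<gamma>_functional_meas[OF gm] by measurable
  qed (use gH in auto)
  then have "AE \<omega> in M. \<forall>\<^sub>F N in sequentially.
     (\<forall>x<N. g (env \<Theta> \<gamma> \<omega> x) \<le> real N powr (1 / q + 2 * \<epsilon>)) \<and>
     (\<forall>a b. a \<le> b \<longrightarrow> b \<le> N \<longrightarrow> real (b - a) \<le> real N powr (1 / 2 + \<epsilon>) \<longrightarrow>
        \<bar>\<Sum>i\<in>{a..<b}. (g (env \<Theta> \<gamma> \<omega> i) - expectation (\<lambda>\<omega>. g (\<gamma> \<omega>)))\<bar> \<le> real N powr (1 / 2 - (1 / q + 3 * \<epsilon>)))"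
    by (intro AE_functional_sums gm \<epsilon>) (auto simp: g_def)
  then show ?thesis using AE_shift[OF eq]
  proof eventually_elim
    case (elim \<omega>)
    have "g (env \<Theta> \<gamma> \<omega> x) = f (env \<Theta> \<gamma> \<omega> x)" for x using elim(2) by (simp add: env_eq)
    then show ?case using elim(1) unfolding ex by (simp only:)
  qed
qed

context
  fixes \<beta> :: "'a \<Rightarrow> real" and \<beta>s \<delta> :: real and Bbar :: "'a \<Rightarrow> ennreal"
  assumes \<beta>_meas[measurable]: "\<beta> \<in> borel_measurable M" and \<beta>s: "ess_inf M \<beta> = ereal \<beta>s"
    and Bbar_eq: "Bbar = (if \<beta>s > 3 then Abar \<beta> \<gamma> else Abar' \<beta> \<gamma>)"
    and C1: "(\<integral>\<^sup>+\<omega>. ennreal_powr (Bbar \<omega>) q \<partial>M) < \<top>"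
    and \<delta>: "0 \<le> \<delta>" "2 + \<delta> < \<beta>s"
begin

lemma Bbar_meas[measurable]: "Bbar \<in> borel_measurable M"
proof -
  have "(\<lambda>\<omega>. SUP n\<in>{1..}. ennreal (real n powr \<beta> \<omega> * \<gamma> \<omega> n)) \<in> borel_measurable M"
    by (rule borel_measurable_SUP) (simp, measurable)
  moreover have "(\<lambda>\<omega>. SUP n\<in>{1..}. ennreal (real n powr (\<beta> \<omega> + 1) * (\<gamma> \<omega> (n - 1) - \<gamma> \<omega> n))) \<in> borel_measurable M"
    by (rule borel_measurable_SUP) (simp, measurable)
  ultimately show ?thesis unfolding Bbar_eq Abar_def[abs_def] Abar'_def[abs_def] by (cases "3 < \<beta>s") (simp_all only: if_True if_False simp_thms)
qed

lemma AE_\<beta>_ge: "AE \<omega> in M. \<beta>s \<le> \<beta> \<omega>"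
proof -
  have "- (- esssup M (\<lambda>\<omega>. - ereal (\<beta> \<omega>))) = - ereal \<beta>s" using \<beta>s unfolding ess_inf_def by simp
  then have e: "esssup M (\<lambda>\<omega>. - ereal (\<beta> \<omega>)) = - ereal \<beta>s" by (simp only: ereal_uminus_uminus)
  show ?thesis using esssup_AE[of "\<lambda>\<omega>. - ereal (\<beta> \<omega>)" M] unfolding e by eventually_elim simp
qed

lemma AE_Bbar_finite: "AE \<omega> in M. Bbar \<omega> \<noteq> \<top>"
proof -
  have "AE \<omega> in M. ennreal_powr (Bbar \<omega>) q \<noteq> \<infinity>"
  proof (rule nn_integral_PInf_AE)
    show "(\<lambda>\<omega>. ennreal_powr (Bbar \<omega>) q) \<in> borel_measurable M" unfolding ennreal_powr_def by measurable
  qed (use C1 in auto)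
  then show ?thesis by eventually_elim (auto simp: ennreal_powr_def)
qed

text \<open>Halfway between the order \<open>2 + \<delta>\<close> needed for moments and the
  guaranteed decay \<open>\<beta>s\<close>: both series, the sum of increments and the moment, then
  converge with deterministic constants. The factor 2 in \<open>dominant\<close> lets it bound
  \<open>hold_second\<close> as well as \<open>hold_moment\<close>.\<close>

definition "tail_exp = (2 + \<delta> + \<beta>s) / 2"
definition "dom_const = zeta_shift (1 + \<beta>s - tail_exp) * (2 powr tail_exp * zeta_shift (tail_exp - 1 - \<delta>))"
definition "dominant \<omega> = 2 * (1 + dom_const * enn2real (Bbar \<omega>))"

lemma zetas_ge_one: "1 \<le> zeta_shift (1 + \<beta>s - tail_exp)" "1 \<le> zeta_shift (tail_exp - 1 - \<delta>)"
proof -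
  have "1 < 1 + \<beta>s - tail_exp" "1 < tail_exp - 1 - \<delta>" using \<delta> unfolding tail_exp_def by (simp_all add: field_simps)
  then show "1 \<le> zeta_shift (1 + \<beta>s - tail_exp)" "1 \<le> zeta_shift (tail_exp - 1 - \<delta>)"
    by (auto intro: zeta_shift_ge_one)
qed

lemma dom_const_nonneg: "0 \<le> dom_const"
  using zetas_ge_one by (simp add: dom_const_def)

lemma integrable_dominant: "integrable M (\<lambda>\<omega>. dominant \<omega> powr q)"
proof (rule Bochner_Integration.integrable_bound)
  let ?b = "\<lambda>\<omega>. enn2real (Bbar \<omega>)"
  have "integrable M (\<lambda>\<omega>. ?b \<omega> powr q)"
  proof (rule integrableI_bounded)
    have "(\<integral>\<^sup>+ \<omega>. ennreal (norm (?b \<omega> powr q)) \<partial>M) \<le> (\<integral>\<^sup>+\<omega>. ennreal_powr (Bbar \<omega>) q \<partial>M)"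
      by (intro nn_integral_mono) (auto simp: ennreal_powr_def)
    then show "(\<integral>\<^sup>+ \<omega>. ennreal (norm (?b \<omega> powr q)) \<partial>M) < \<infinity>" using C1 by (simp add: order_le_less_trans)
  qed measurable
  then show "integrable M (\<lambda>\<omega>. 2 powr q * (2 powr q * (1 + dom_const powr q * ?b \<omega> powr q)))" by simp
  show "AE \<omega> in M. norm (dominant \<omega> powr q) \<le> norm (2 powr q * (2 powr q * (1 + dom_const powr q * ?b \<omega> powr q)))"
  proof (rule AE_I2)
    fix \<omega>
    have "dominant \<omega> powr q = 2 powr q * (1 + dom_const * ?b \<omega>) powr q" by (simp only: dominant_def powr_mult)
    also have "\<dots> \<le> 2 powr q * (2 powr q * (1 + (dom_const * ?b \<omega>) powr q))"
      using q8 dom_const_nonneg by (intro mult_left_mono one_add_powr_le) auto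
    finally show "norm (dominant \<omega> powr q) \<le> norm (2 powr q * (2 powr q * (1 + dom_const powr q * ?b \<omega> powr q)))"
      by (simp add: powr_mult)
  qed
  show "(\<lambda>\<omega>. dominant \<omega> powr q) \<in> borel_measurable M" unfolding dominant_def by measurable
qed

lemma tail_bound:
  assumes \<omega>: "\<omega> \<in> space M" "\<beta>s \<le> \<beta> \<omega>" "Bbar \<omega> \<noteq> \<top>" and n: "1 \<le> n"
  shows "\<gamma> \<omega> n \<le> zeta_shift (1 + \<beta>s - tail_exp) * enn2real (Bbar \<omega>) * real n powr (- tail_exp)"
proof -
  have s: "0 \<le> tail_exp" "tail_exp < \<beta>s" using \<delta> by (auto simp: tail_exp_def)
  have le: "x \<le> enn2real (Bbar \<omega>)" if "ennreal x \<le> Bbar \<omega>" for x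
  proof -
    have "enn2real (ennreal x) \<le> enn2real (Bbar \<omega>)"
      using that \<omega>(3) by (intro enn2real_mono) (auto simp: less_top)
    then show ?thesis by (cases "0 \<le> x") (auto intro: order_trans[of _ 0])
  qed
  show ?thesis
  proof (cases "\<beta>s > 3")
    case True
    have "ennreal (real n powr \<beta> \<omega> * \<gamma> \<omega> n) \<le> Bbar \<omega>"
      using True n by (auto simp: Bbar_eq Abar_def intro!: SUP_upper)
    then have "real n powr \<beta> \<omega> * \<gamma> \<omega> n \<le> enn2real (Bbar \<omega>)" by (rule le)
    then have "\<gamma> \<omega> n \<le> enn2real (Bbar \<omega>) * real n powr (- \<beta> \<omega>)"
      using n by (simp only: powr_minus_divide) (simp add: field_simps)
    also have "\<dots> \<le> enn2real (Bbar \<omega>) * real n powr (- tail_exp)"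
      using n s \<omega>(2) by (intro mult_left_mono powr_mono) auto
    also have "1 * \<dots> \<le> zeta_shift (1 + \<beta>s - tail_exp) * (enn2real (Bbar \<omega>) * real n powr (- tail_exp))"
      using zetas_ge_one(1) by (intro mult_right_mono) auto
    finally show ?thesis by (simp add: mult_ac)
  next
    case False
    show ?thesis
    proof (rule tail_le_of_Abar'[OF \<gamma>_Omega0[OF \<omega>(1)] _ s \<omega>(2) n])
      fix k :: nat assume k: "1 \<le> k"
      have "ennreal (real k powr (\<beta> \<omega> + 1) * (\<gamma> \<omega> (k - 1) - \<gamma> \<omega> k)) \<le> Bbar \<omega>"
        using False k by (auto simp: Bbar_eq Abar'_def intro!: SUP_upper)
      then show "real k powr (\<beta> \<omega> + 1) * (\<gamma> \<omega> (k - 1) - \<gamma> \<omega> k) \<le> enn2real (Bbar \<omega>)" by (rule le)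
    qed
  qed
qed

lemma AE_moments:
  "AE \<omega> in M. \<gamma> \<omega> \<in> Omega0 \<and> summable (\<lambda>n. (real n + 1) powr (1 + \<delta>) * \<gamma> \<omega> n) \<and>
     summable (\<lambda>n. (2 * real n + 1) * \<gamma> \<omega> n) \<and> hold_moment \<delta> (\<gamma> \<omega>) \<le> dominant \<omega> \<and> hold_second (\<gamma> \<omega>) \<le> dominant \<omega>"
  using AE_space AE_\<beta>_ge AE_Bbar_finite
proof eventually_elim
  case (elim \<omega>)
  let ?c = "zeta_shift (1 + \<beta>s - tail_exp) * enn2real (Bbar \<omega>)"
  have c: "0 \<le> ?c" using zetas_ge_one by simp
  have s: "2 + \<delta> < tail_exp" using \<delta> by (simp add: tail_exp_def)
  note m = moments_of_tail[OF \<gamma>_Omega0[OF elim(1)] c tail_bound[OF elim] s \<delta>(1)]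
  have "hold_moment \<delta> (\<gamma> \<omega>) \<le> 1 + dom_const * enn2real (Bbar \<omega>)"
    using m(2) by (simp add: dom_const_def mult_ac)
  moreover have "0 \<le> dom_const * enn2real (Bbar \<omega>)" using dom_const_nonneg by simp
  ultimately show ?case using m \<gamma>_Omega0[OF elim(1)] by (simp add: dominant_def)
qed

end
end

lemma (in random_environment) AE_walk_local_limit:
  fixes \<beta> :: "'a \<Rightarrow> real" and \<beta>s \<mu> \<sigma>2 :: real and Bbar :: "'a \<Rightarrow> ennreal"
    and P :: "'a \<Rightarrow> 'b measure" and Z :: "'a \<Rightarrow> nat \<Rightarrow> 'b \<Rightarrow> nat \<times> nat"
  assumes chain: "\<And>\<omega>. \<omega> \<in> space M \<Longrightarrow>
      markov_chain (P \<omega>) (Z \<omega>) (walk_init (env \<Theta> \<gamma> \<omega>)) (walk_trans (env \<Theta> \<gamma> \<omega>))"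
    and \<beta>_meas: "\<beta> \<in> borel_measurable M" and \<beta>s: "ess_inf M \<beta> = ereal \<beta>s" "2 < \<beta>s" and q: "2 / (\<beta>s - 2) < q"
    and Bbar_eq: "Bbar = (if \<beta>s > 3 then Abar \<beta> \<gamma> else Abar' \<beta> \<gamma>)"
    and C1: "(\<integral>\<^sup>+\<omega>. ennreal_powr (Bbar \<omega>) q \<partial>M) < \<top>"
    and \<mu>: "\<mu> = expectation (\<lambda>\<omega>. hold_mean (\<gamma> \<omega>))" and \<sigma>2: "\<sigma>2 = expectation (\<lambda>\<omega>. hold_var (\<gamma> \<omega>))"
  shows "AE \<omega> in M. \<forall>\<epsilon>>0. \<forall>\<^sub>F n in sequentially. \<forall>x::nat.
      \<bar>\<P>(\<xi> in P \<omega>. fst (Z \<omega> n \<xi>) = x)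
        - 1 / \<mu> * (\<Sum>l=1..n. normal_density (real (M_env (env \<Theta> \<gamma> \<omega>) l)) (sqrt (real l * (\<sigma>2 / \<mu> ^ 3))) (real x) * env \<Theta> \<gamma> \<omega> x (n - l))\<bar>
      \<le> \<epsilon> * real n powr (- 1 / 2)"
proof -
  \<comment> \<open>The midpoint of \<open>2 / q\<close> and \<open>min 1 (\<beta>s - 2)\<close>;
    the interval is nonempty since \<open>q\<close> exceeds both 8 and
    \<open>2 / (\<beta>s - 2)\<close>.\<close>
  define \<delta> where "\<delta> = (2 / q + min 1 (\<beta>s - 2)) / 2"
  have "2 / q < min 1 (\<beta>s - 2)" using q \<beta>s(2) q8 by (simp add: field_simps)
  moreover have "0 \<le> (u + c) / 2 \<and> (u + c) / 2 \<le> 1 \<and> 2 + (u + c) / 2 < \<beta>s \<and> u / 2 < (u + c) / 2 / 2"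
    if "u < c" "0 < u" "c \<le> 1" "c \<le> \<beta>s - 2" for u c :: real
    using that by (simp add: field_simps)
  moreover have "0 < 2 / q" "(2 / q) / 2 = 1 / q" using q8 by auto
  ultimately have \<delta>: "0 \<le> \<delta>" "\<delta> \<le> 1" "2 + \<delta> < \<beta>s" "1 / q < \<delta> / 2"
    unfolding \<delta>_def by (metis min.cobounded1 min.cobounded2)+
  \<comment> \<open>The first bound keeps the bad events summable, the second leaves the fluctuation
    exponent \<open>1 / q + 3 * e\<close> below \<open>\<delta> / 2\<close>.\<close>
  define e where "e = min ((q - 8) / q / 100) ((\<delta> / 2 - 1 / q) / 3)"
  have third: "x \<le> (d - u) / 3 \<Longrightarrow> u + 3 * x \<le> d" for x d u :: real by simp
  have "1 / q + 3 * e \<le> \<delta> / 2" unfolding e_def by (rule third) (rule min.cobounded2)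
  then have e: "0 < e" "e \<le> (q - 8) / q / 100" "1 / q + 3 * e \<le> \<delta> / 2" using \<delta>(4) q8 by (auto simp: e_def)
  have e1: "e \<le> 1 / 100"
  proof -
    have "(q - 8) / q \<le> 1" using q8 by simp
    from order_trans[OF e(2) divide_right_mono[OF this, of 100]] show ?thesis by simp
  qed
  then have e8: "e \<le> 1 / 8" by simp
  have \<kappa>: "0 < u + 2 * x \<and> u + 2 * x < u + 3 * x \<and> u + 3 * x \<le> 1 / 4"
    if "0 < u" "u < 1 / 8" "0 < x" "x \<le> 1 / 100" for u x :: real using that by simp
  have \<kappa>: "0 < 1 / q + 2 * e" "1 / q + 2 * e < 1 / q + 3 * e" "1 / q + 3 * e \<le> 1 / 4"
    using \<kappa>[OF _ _ e(1) e1, of "1 / q"] q8 by auto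
  note mom = AE_moments[OF \<beta>_meas \<beta>s(1) Bbar_eq C1 \<delta>(1,3)]
  note dom = integrable_dominant[OF \<beta>_meas \<beta>s(1) Bbar_eq C1 \<delta>(1,3)]
  let ?H = "dominant \<beta>s \<delta> Bbar"
  have bounds: "AE \<omega> in M. 0 \<le> hold_gap (\<gamma> \<omega>) \<and> hold_gap (\<gamma> \<omega>) \<le> hold_var (\<gamma> \<omega>) \<and> hold_var (\<gamma> \<omega>) \<le> ?H \<omega>
     \<and> 0 \<le> hold_moment \<delta> (\<gamma> \<omega>) \<and> hold_moment \<delta> (\<gamma> \<omega>) \<le> ?H \<omega> \<and> 1 + hold_gap (\<gamma> \<omega>) \<le> hold_mean (\<gamma> \<omega>)
     \<and> hold_mean (\<gamma> \<omega>) \<le> hold_second (\<gamma> \<omega>) \<and> hold_second (\<gamma> \<omega>) \<le> ?H \<omega>"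
    using mom
  proof eventually_elim
    case (elim \<omega>)
    then have a: "\<gamma> \<omega> \<in> Omega0" and sd: "summable (\<lambda>n. (real n + 1) powr (1 + \<delta>) * \<gamma> \<omega> n)"
      and sq: "summable (\<lambda>n. (2 * real n + 1) * \<gamma> \<omega> n)" by auto
    interpret walk_environment "\<lambda>_. \<gamma> \<omega>" \<delta> using a sd sq \<delta> by unfold_locales auto
    have "hold_var (\<gamma> \<omega>) \<le> hold_second (\<gamma> \<omega>)" by (simp add: hold_var_def)
    moreover have "1 + hold_gap (\<gamma> \<omega>) \<le> hold_mean (\<gamma> \<omega>)"
    proof -
      have "(\<Sum>n<2. \<gamma> \<omega> n) \<le> hold_mean (\<gamma> \<omega>)" unfolding hold_mean_def
        by (rule sum_le_suminf[OF summable_hold[OF a sq]]) (use Omega0_props(1)[OF a] in \<open>auto simp: less_imp_le\<close>)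
      then have "1 + \<gamma> \<omega> 1 \<le> hold_mean (\<gamma> \<omega>)" using Omega0_props(3)[OF a] by (simp add: numeral_2_eq_2)
      moreover have "hold_gap (\<gamma> \<omega>) \<le> 1 * \<gamma> \<omega> 1"
        unfolding hold_gap_def using Omega0_head_props[OF a] by (intro mult_mono) auto
      ultimately show ?thesis by simp
    qed
    ultimately show ?case
      using elim hold_gap_bounds[OF a] hold_gap_le_var[OF a sq] hold_moment_nonneg[OF a sq \<delta>(1,2) sd] hold_mean_le_second
      by (auto simp: less_imp_le)
  qed
  have n1: "AE \<omega> in M. 0 \<le> hold_mean (\<gamma> \<omega>)" using bounds by eventually_elim linarith
  have n2: "AE \<omega> in M. 0 \<le> hold_second (\<gamma> \<omega>)" using bounds by eventually_elim linarith
  have n3: "AE \<omega> in M. 0 \<le> hold_var (\<gamma> \<omega>)" using bounds by eventually_elim linarith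
  have n4: "AE \<omega> in M. 0 \<le> hold_gap (\<gamma> \<omega>)" using bounds by eventually_elim linarith
  have n5: "AE \<omega> in M. 0 \<le> hold_moment \<delta> (\<gamma> \<omega>)" using bounds by eventually_elim linarith
  have b1: "AE \<omega> in M. hold_mean (\<gamma> \<omega>) \<le> ?H \<omega>" using bounds by eventually_elim linarith
  have b2: "AE \<omega> in M. hold_second (\<gamma> \<omega>) \<le> ?H \<omega>" using bounds by eventually_elim linarith
  have b3: "AE \<omega> in M. hold_var (\<gamma> \<omega>) \<le> ?H \<omega>" using bounds by eventually_elim linarith
  have b4: "AE \<omega> in M. hold_gap (\<gamma> \<omega>) \<le> ?H \<omega>" using bounds by eventually_elim linarith
  have b5: "AE \<omega> in M. hold_moment \<delta> (\<gamma> \<omega>) \<le> ?H \<omega>" using bounds by eventually_elim linarith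
  have int: "integrable M (\<lambda>\<omega>. f (\<gamma> \<omega>))"
    if f: "f \<in> borel_measurable borel" and b: "AE \<omega> in M. 0 \<le> f (\<gamma> \<omega>)" "AE \<omega> in M. f (\<gamma> \<omega>) \<le> ?H \<omega>" for f
  proof (rule Bochner_Integration.integrable_bound)
    show "integrable M (\<lambda>\<omega>. 1 + ?H \<omega> powr q)" using dom by simp
    show "AE \<omega> in M. norm (f (\<gamma> \<omega>)) \<le> norm (1 + ?H \<omega> powr q)"
      using b
    proof eventually_elim
      case (elim \<omega>)
      have "?H \<omega> \<le> 1 + ?H \<omega> powr q"
      proof (cases "?H \<omega> \<le> 1")
        case True then show ?thesis by (simp add: add_increasing2)
      next
        case False
        then have "?H \<omega> powr 1 \<le> ?H \<omega> powr q" using q8 by (intro powr_mono) auto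
        then show ?thesis using False by simp
      qed
      then show ?case using elim by (simp add: abs_of_nonneg add_nonneg_nonneg)
    qed
  qed (use \<gamma>_functional_meas[OF f] in simp)
  note meas = borel_measurable_functionals
  have ig: "integrable M (\<lambda>\<omega>. hold_gap (\<gamma> \<omega>))" by (rule int[OF meas(4) n4 b4])
  have iv: "integrable M (\<lambda>\<omega>. hold_var (\<gamma> \<omega>))" by (rule int[OF meas(3) n3 b3])
  have im: "integrable M (\<lambda>\<omega>. hold_mean (\<gamma> \<omega>))" by (rule int[OF meas(1) n1 b1])
  define g0 where "g0 = expectation (\<lambda>\<omega>. hold_gap (\<gamma> \<omega>))"
  define m1 where "m1 = expectation (\<lambda>\<omega>. hold_moment \<delta> (\<gamma> \<omega>))"
  \<comment> \<open>The gap is positive at every point, so its mean is positive. Through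
    \<open>hold_gap \<le> hold_var\<close> and \<open>1 + hold_gap \<le> hold_mean\<close> this also
    yields \<open>\<sigma>2 > 0\<close> and the strict \<open>\<mu> > 1\<close>.\<close>
  have g0: "0 < g0"
  proof -
    have "g0 \<noteq> 0"
    proof
      assume "g0 = 0"
      then have "AE \<omega> in M. hold_gap (\<gamma> \<omega>) = 0"
        using integral_nonneg_eq_0_iff_AE[OF ig n4] by (simp add: g0_def)
      with AE_space have "AE \<omega> in M. False"
      proof eventually_elim
        case (elim \<omega>) then show False using hold_gap_bounds(1)[OF \<gamma>_Omega0[OF elim(1)]] by simp
      qed
      then show False by simp
    qed
    moreover have "0 \<le> g0" unfolding g0_def using n4 by (rule integral_nonneg_AE)
    ultimately show ?thesis by simp
  qed
  have \<mu>1: "1 < \<mu>"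
  proof -
    have "expectation (\<lambda>\<omega>. 1 + hold_gap (\<gamma> \<omega>)) \<le> \<mu>"
      unfolding \<mu>
    proof (rule integral_mono_AE)
      show "AE \<omega> in M. 1 + hold_gap (\<gamma> \<omega>) \<le> hold_mean (\<gamma> \<omega>)" using bounds by eventually_elim linarith
    qed (use ig im in auto)
    then show ?thesis using g0 ig by (simp add: prob_space g0_def)
  qed
  have \<sigma>0: "0 < \<sigma>2"
  proof -
    have "g0 \<le> \<sigma>2"
      unfolding \<sigma>2 g0_def
    proof (rule integral_mono_AE[OF ig iv])
      show "AE \<omega> in M. hold_gap (\<gamma> \<omega>) \<le> hold_var (\<gamma> \<omega>)" using bounds by eventually_elim linarith
    qed
    then show ?thesis using g0 by simp
  qed
  have m1: "0 \<le> m1" unfolding m1_def using n5 by (rule integral_nonneg_AE)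
  note sums = AE_dominated_functional_sums[OF _ _ _ dom e(1,2)]
  show ?thesis
    using AE_space AE_shift[OF mom] sums[OF meas(1) n1 b1] sums[OF meas(2) n2 b2] sums[OF meas(3) n3 b3]
      sums[OF meas(4) n4 b4] sums[OF meas(5) n5 b5]
  proof eventually_elim
    case (elim \<omega>)
    define w where "w = env \<Theta> \<gamma> \<omega>"
    note sums = elim(3-7)[folded \<mu> \<sigma>2 g0_def m1_def, folded w_def, unfolded eventually_conj_iff]
    have w: "w x = \<gamma> ((\<Theta> ^^ x) \<omega>)" for x unfolding w_def by (rule env_eq)
    \<comment> \<open>With \<open>\<kappa>0 = 1 / q + 2 * e\<close> and
      \<open>\<kappa> = 1 / q + 3 * e\<close> the final rate is
      \<open>n powr (- 1 / 2 - e)\<close>.\<close>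
    have "regular_environment w \<delta> \<mu> \<sigma>2 m1 g0 (1 / q + 2 * e) (1 / q + 3 * e) e"
    proof
      show "w x \<in> Omega0" "summable (\<lambda>n. (2 * real n + 1) * w x n)" "summable (\<lambda>n. (real n + 1) powr (1 + \<delta>) * w x n)" for x
        unfolding w using elim(2)[rule_format, of x] by auto
    qed (rule \<delta>(1,2) \<mu>1 \<sigma>0 m1 g0 e(1,3) e8 \<kappa> sums(2)[THEN conjunct1] sums[THEN conjunct2])+
    then interpret regular_environment w \<delta> \<mu> \<sigma>2 m1 g0 "1 / q + 2 * e" "1 / q + 3 * e" e .
    obtain C where C: "\<forall>\<^sub>F n in sequentially. \<forall>x. \<bar>(\<Sum>l\<le>n. pmf (arrival w x) l * w x (n - l)) - (\<Sum>l=1..n. kernel x l * w x (n - l))\<bar>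
        \<le> C * real n powr (- 1 / 2 - (1 / q + 3 * e - (1 / q + 2 * e)))"
      using arrival_kernel_convolution by blast
    define D where "D = \<bar>C\<bar> + 1"
    have D: "0 < D" "C \<le> D" by (auto simp: D_def)
    show ?case unfolding w_def[symmetric]
    proof (intro allI impI)
      fix \<epsilon> :: real assume "0 < \<epsilon>"
      then have "\<forall>\<^sub>F n in sequentially. D * real n powr (- 1 / 2 - e) \<le> \<epsilon> * real n powr (- 1 / 2)"
        using D(1) e(1) by real_asymp
      with C show "\<forall>\<^sub>F n in sequentially. \<forall>x. \<bar>\<P>(\<xi> in P \<omega>. fst (Z \<omega> n \<xi>) = x)
        - 1 / \<mu> * (\<Sum>l=1..n. normal_density (real (M_env w l)) (sqrt (real l * (\<sigma>2 / \<mu> ^ 3))) (real x) * w x (n - l))\<bar>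
        \<le> \<epsilon> * real n powr (- 1 / 2)"
      proof eventually_elim
        case (elim n)
        show ?case
        proof
          fix x
          have p: "\<P>(\<xi> in P \<omega>. fst (Z \<omega> n \<xi>) = x) = (\<Sum>l\<le>n. pmf (arrival w x) l * w x (n - l))"
            by (rule walk_position_prob[OF chain[OF \<open>\<omega> \<in> space M\<close>, folded w_def] env])
          have k: "1 / \<mu> * (\<Sum>l=1..n. normal_density (real (M_env w l)) (sqrt (real l * (\<sigma>2 / \<mu> ^ 3))) (real x) * w x (n - l))
              = (\<Sum>l=1..n. kernel x l * w x (n - l))"
            by (simp only: kernel_def sum_distrib_left mult.assoc)
          have "\<bar>(\<Sum>l\<le>n. pmf (arrival w x) l * w x (n - l)) - (\<Sum>l=1..n. kernel x l * w x (n - l))\<bar> \<le> C * real n powr (- 1 / 2 - e)"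
            using elim(1)[rule_format, of x] by simp
          also have "\<dots> \<le> D * real n powr (- 1 / 2 - e)" using D(2) by (intro mult_right_mono) auto
          finally show "\<bar>\<P>(\<xi> in P \<omega>. fst (Z \<omega> n \<xi>) = x)
            - 1 / \<mu> * (\<Sum>l=1..n. normal_density (real (M_env w l)) (sqrt (real l * (\<sigma>2 / \<mu> ^ 3))) (real x) * w x (n - l))\<bar>
            \<le> \<epsilon> * real n powr (- 1 / 2)"
            unfolding p k using elim(2) by linarith
        qed
      qed
    qed
  qed
qed

theorem theorem2p9:
  fixes M :: "'a measure" and \<Theta> :: "'a \<Rightarrow> 'a" and \<gamma> :: "'a \<Rightarrow> nat \<Rightarrow> real"
    and \<beta> :: "'a \<Rightarrow> real" and \<beta>s q \<mu> \<sigma>2 \<sigma>t2 :: real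
    and P :: "'a \<Rightarrow> 'b measure" and Z :: "'a \<Rightarrow> nat \<Rightarrow> 'b \<Rightarrow> nat \<times> nat"
    and Bbar :: "'a \<Rightarrow> ennreal" and h :: "'a \<Rightarrow> nat \<Rightarrow> real \<Rightarrow> real"
  assumes "prob_space M"
    and "measure_preserving_map M \<Theta>"
    and "\<gamma> \<in> M \<rightarrow>\<^sub>M Omega0_borel"
    and chain: "\<And>\<omega>. \<omega> \<in> space M \<Longrightarrow>
      markov_chain (P \<omega>) (Z \<omega>) (walk_init (env \<Theta> \<gamma> \<omega>)) (walk_trans (env \<Theta> \<gamma> \<omega>))"
    and "\<beta> \<in> borel_measurable M" and "\<And>\<omega>. \<omega> \<in> space M \<Longrightarrow> 1 < \<beta> \<omega>"
    and "ess_inf M \<beta> = ereal \<beta>s" and "\<beta>s > 2"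
    and "q > max 8 (2 / (\<beta>s - 2))"
    and Bbar_eq: "Bbar = (if \<beta>s > 3 then Abar \<beta> \<gamma> else Abar' \<beta> \<gamma>)"
    and C1: "(\<integral>\<^sup>+\<omega>. ennreal_powr (Bbar \<omega>) q \<partial>M) < \<top>"
    and C2: "\<exists>v > 2 * q / (q - 8). alpha_mixing M \<Theta> \<gamma> \<in> O(\<lambda>n. real n powr (- v))"
    and C3: "\<exists>\<delta> > 0. (\<integral>\<^sup>+\<omega>. ennreal_powr (Kbar \<gamma> \<omega>) (1 + \<delta>) \<partial>M) < \<top>"
    and mu_eq: "\<mu> = (\<integral>\<omega>. m_env (env \<Theta> \<gamma> \<omega>) 0 \<partial>M)"
    and sigma2_eq: "\<sigma>2 = (\<integral>\<omega>. s2_env (env \<Theta> \<gamma> \<omega>) 0 \<partial>M)"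
    and sigmat2_eq: "\<sigma>t2 = \<sigma>2 / \<mu> ^ 3"
    and h_eq: "\<And>\<omega> l. h \<omega> l = normal_density (real (M_env (env \<Theta> \<gamma> \<omega>) l)) (sqrt (real l * \<sigma>t2))"
  shows "AE \<omega> in M. \<forall>\<epsilon>>0. \<forall>\<^sub>F n in sequentially. \<forall>x::nat.
      \<bar>\<P>(\<xi> in P \<omega>. fst (Z \<omega> n \<xi>) = x)
        - 1 / \<mu> * (\<Sum>l=1..n. h \<omega> l (real x) * env \<Theta> \<gamma> \<omega> x (n - l))\<bar>
      \<le> \<epsilon> * real n powr (- 1 / 2)"
proof -
  obtain v where v: "2 * q / (q - 8) < v" "alpha_mixing M \<Theta> \<gamma> \<in> O(\<lambda>n. real n powr (- v))" using C2 by auto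
  interpret prob_space M by fact
  interpret random_environment M \<Theta> \<gamma> q v
    using assms(2,3) \<open>q > max 8 (2 / (\<beta>s - 2))\<close> v by unfold_locales auto
  have m: "m_env (env \<Theta> \<gamma> \<omega>) 0 = hold_mean (\<gamma> \<omega>)" and s: "s2_env (env \<Theta> \<gamma> \<omega>) 0 = hold_var (\<gamma> \<omega>)" for \<omega>
    by (auto simp: m_env_def s2_env_def hold_mean_def hold_var_def hold_second_def env_def)
  show ?thesis
    unfolding h_eq sigmat2_eq
    by (rule AE_walk_local_limit[OF chain \<open>\<beta> \<in> borel_measurable M\<close> \<open>ess_inf M \<beta> = ereal \<beta>s\<close> \<open>\<beta>s > 2\<close> _ Bbar_eq C1 mu_eq[unfolded m] sigma2_eq[unfolded s]])
      (use \<open>q > max 8 (2 / (\<beta>s - 2))\<close> in auto)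
qed

end
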